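(* Let $r\ge 0$ be an integer. The vertex functor $V:m\mathcal G(r)\to\mathcal S(r+1)$ gives a homotopy equivalence of classifying spaces $$Bm\mathcal G(r)\simeq B\mathcal S(r+1)\simeq BS_{r+1},$$ where $S_n$ is the symmetric group on $n$ letters.
   Context: A (finite) graph $G$ consists of a finite set of vertices $G_0$, a finite set of edges $G_1$, a two-fold covering $\widetilde G_1\to G_1$ (a surjection with all fibers of size two) whose elements are called half-edges, and an incidence map $\partial:\widetilde G_1\to G_0$ (loops and multiple edges are allowed). Let $\tau$ be the free involution of $\widetilde G_1$ switching the two half-edges of each edge, and extend $\tau$ and $\partial$ to $G_0\coprod\widetilde G_1$ by the identity on $G_0$. A morphism of graphs $G\to G'$ is a map $G_0\coprod\widetilde G_1\to G_0'\coprod\widetilde G_1'$ commuting with $\tau$ and $\partial$. A graph monomorphism is a morphism $f$ of graphs that is injective as a map $G_0\coprod\widetilde G_1\to G_0'\coprod\widetilde G_1'$ and satisfies $f(G_0)=G_0'$ and $f(\widetilde G_1)\subseteq\widetilde G_1'$ (i.e. an isomorphism onto a spanning subgraph). $m\mathcal G(r)$ is the category whose objects are connected graphs with $r+1$ vertices and whose morphisms are graph monomorphisms. $\mathcal S(r+1)$ is the category of sets of cardinality $r+1$ and bijections. The vertex functor $V:m\mathcal G(r)\to\mathcal S(r+1)$ sends $G$ to its vertex set $G_0$. $B\mathcal C$ is the classifying space (geometric realization of the nerve) of a category $\mathcal C$, with categories replaced by equivalent small ones. *)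

theory Defs
  imports
    "HOL-Analysis.Analysis"
    "HOL-Library.Infinite_Typeclass"
    "HOL-Homology.Simplices"
    "HOL-Algebra.Sym_Groups"
begin

section \<open>Small categories and functors\<close>

text \<open>\<open>Cmp C g f\<close> is the composite \<open>g\<close> after \<open>f\<close>.\<close>

record ('o, 'm) cat =
  Ob :: "'o set"
  Ar :: "'m set"
  Src :: "'m \<Rightarrow> 'o"
  Tgt :: "'m \<Rightarrow> 'o"
  Idt :: "'o \<Rightarrow> 'm"
  Cmp :: "'m \<Rightarrow> 'm \<Rightarrow> 'm"

definition is_category :: "('o, 'm) cat \<Rightarrow> bool" where
  "is_category C \<longleftrightarrow>
     (\<forall>f\<in>Ar C. Src C f \<in> Ob C \<and> Tgt C f \<in> Ob C) \<and>
     (\<forall>a\<in>Ob C. Idt C a \<in> Ar C \<and> Src C (Idt C a) = a \<and> Tgt C (Idt C a) = a) \<and>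
     (\<forall>f\<in>Ar C. \<forall>g\<in>Ar C. Tgt C f = Src C g \<longrightarrow>
        Cmp C g f \<in> Ar C \<and> Src C (Cmp C g f) = Src C f \<and> Tgt C (Cmp C g f) = Tgt C g) \<and>
     (\<forall>f\<in>Ar C. Cmp C f (Idt C (Src C f)) = f \<and> Cmp C (Idt C (Tgt C f)) f = f) \<and>
     (\<forall>f\<in>Ar C. \<forall>g\<in>Ar C. \<forall>h\<in>Ar C. Tgt C f = Src C g \<and> Tgt C g = Src C h \<longrightarrow>
        Cmp C h (Cmp C g f) = Cmp C (Cmp C h g) f)"

text \<open>Both components of a functor are extensional (hence \<open>\<rightarrow>\<^sub>E\<close>), so that equality of functors
  in HOL is equality of functors in the mathematical sense.\<close>

record ('o, 'm, 'p, 'n) fctr =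
  fob :: "'o \<Rightarrow> 'p"
  far :: "'m \<Rightarrow> 'n"

definition is_functor ::
    "('o, 'm) cat \<Rightarrow> ('p, 'n) cat \<Rightarrow> ('o, 'm, 'p, 'n) fctr \<Rightarrow> bool" where
  "is_functor C D F \<longleftrightarrow>
     fob F \<in> Ob C \<rightarrow>\<^sub>E Ob D \<and> far F \<in> Ar C \<rightarrow>\<^sub>E Ar D \<and>
     (\<forall>f\<in>Ar C. Src D (far F f) = fob F (Src C f) \<and> Tgt D (far F f) = fob F (Tgt C f)) \<and>
     (\<forall>a\<in>Ob C. far F (Idt C a) = Idt D (fob F a)) \<and>
     (\<forall>f\<in>Ar C. \<forall>g\<in>Ar C. Tgt C f = Src C g \<longrightarrow>
        far F (Cmp C g f) = Cmp D (far F g) (far F f))"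

text \<open>\<open>comp_functor C G F\<close> is \<open>G\<close> after \<open>F\<close>, where \<open>C\<close> is the source of \<open>F\<close>.\<close>

definition comp_functor ::
    "('o, 'm) cat \<Rightarrow> ('p, 'n, 'q, 'k) fctr \<Rightarrow> ('o, 'm, 'p, 'n) fctr \<Rightarrow> ('o, 'm, 'q, 'k) fctr" where
  "comp_functor C G F =
     \<lparr>fob = compose (Ob C) (fob G) (fob F), far = compose (Ar C) (far G) (far F)\<rparr>"

text \<open>The one-object category of a group (or monoid).\<close>

definition one_object_cat :: "('a, 'b) monoid_scheme \<Rightarrow> (unit, 'a) cat" where
  "one_object_cat G =
     \<lparr>Ob = {()}, Ar = carrier G, Src = (\<lambda>_. ()), Tgt = (\<lambda>_. ()),
      Idt = (\<lambda>_. one G), Cmp = mult G\<rparr>"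

lemma is_category_one_object_cat:
  assumes "Group.monoid G"
  shows "is_category (one_object_cat G)"
proof -
  interpret Group.monoid G by fact
  show ?thesis by (simp add: is_category_def one_object_cat_def m_assoc)
qed


section \<open>Simplicial sets and geometric realization\<close>

text \<open>\<open>mono_maps m n\<close> are the order-preserving maps \<open>[m] \<rightarrow> [n]\<close>, where \<open>[n] = {0..n}\<close>; values
  outside \<open>[m]\<close> are irrelevant. For such a map \<open>\<theta>\<close>, \<open>act X m \<theta>\<close> is the induced map from the
  \<open>n\<close>-simplices to the \<open>m\<close>-simplices of \<open>X\<close>.\<close>

definition mono_maps :: "nat \<Rightarrow> nat \<Rightarrow> (nat \<Rightarrow> nat) set" where
  "mono_maps m n = {\<theta>. \<theta> ` {..m} \<subseteq> {..n} \<and> mono_on {..m} \<theta>}"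

record 'x sset =
  simplices :: "nat \<Rightarrow> 'x set"
  act :: "nat \<Rightarrow> (nat \<Rightarrow> nat) \<Rightarrow> 'x \<Rightarrow> 'x"

text \<open>The affine map of standard simplices that sends vertex \<open>i\<close> to vertex \<open>\<theta> i\<close>.\<close>

definition simplex_push :: "nat \<Rightarrow> (nat \<Rightarrow> nat) \<Rightarrow> (nat \<Rightarrow> real) \<Rightarrow> (nat \<Rightarrow> real)" where
  "simplex_push m \<theta> t = (\<lambda>j. \<Sum>i | i \<le> m \<and> \<theta> i = j. t i)"

text \<open>The quotient of a space by an equivalence relation on its points.\<close>

definition quotient_topology :: "'a topology \<Rightarrow> ('a \<times> 'a) set \<Rightarrow> 'a set topology" where
  "quotient_topology X R =
     topology (\<lambda>U. U \<subseteq> topspace X // R \<and> openin X {p \<in> topspace X. R `` {p} \<in> U})"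

lemma openin_quotient_topology:
  "openin (quotient_topology X R) U \<longleftrightarrow>
     U \<subseteq> topspace X // R \<and> openin X {p \<in> topspace X. R `` {p} \<in> U}"
proof -
  have 1: "{p \<in> topspace X. R `` {p} \<in> S \<inter> T} =
      {p \<in> topspace X. R `` {p} \<in> S} \<inter> {p \<in> topspace X. R `` {p} \<in> T}" for S T
    by auto
  have 2: "{p \<in> topspace X. R `` {p} \<in> \<Union>K} = (\<Union>S\<in>K. {p \<in> topspace X. R `` {p} \<in> S})" for K
    by auto
  have "istopology (\<lambda>U. U \<subseteq> topspace X // R \<and> openin X {p \<in> topspace X. R `` {p} \<in> U})"
    unfolding istopology_def 1 2 by blast
  then show ?thesis
    by (simp add: quotient_topology_def)
qed

lemma topspace_quotient_topology [simp]:
  "topspace (quotient_topology X R) = topspace X // R"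
proof -
  have "{p \<in> topspace X. R `` {p} \<in> topspace X // R} = topspace X"
    by (auto simp: quotientI)
  then have "openin (quotient_topology X R) (topspace X // R)"
    by (simp add: openin_quotient_topology)
  then show ?thesis
    by (metis openin_quotient_topology openin_subset openin_topspace subset_antisym)
qed

lemma quotient_map_quotient_topology:
  assumes "equiv (topspace X) R"
  shows "quotient_map X (quotient_topology X R) (\<lambda>p. R `` {p})"
  unfolding quotient_map_def
  by (auto simp: openin_quotient_topology quotient_def)

text \<open>The coproduct, over all \<open>n\<close> and all \<open>n\<close>-simplices \<open>x\<close>, of copies of the topological
  \<open>n\<close>-simplex; its points have the form \<open>((n, x), t)\<close>.\<close>

definition simplex_coproduct :: "'x sset \<Rightarrow> ((nat \<times> 'x) \<times> (nat \<Rightarrow> real)) topology" where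
  "simplex_coproduct X =
     sum_topology (\<lambda>(n, x). subtopology (powertop_real UNIV) (standard_simplex n))
       {(n, x). x \<in> simplices X n}"

definition realization_step ::
    "'x sset \<Rightarrow> (((nat \<times> 'x) \<times> (nat \<Rightarrow> real)) \<times> ((nat \<times> 'x) \<times> (nat \<Rightarrow> real))) set" where
  "realization_step X =
     {(((m, act X m \<theta> x), t), ((n, x), simplex_push m \<theta> t)) | m n \<theta> x t.
        \<theta> \<in> mono_maps m n \<and> x \<in> simplices X n \<and> t \<in> standard_simplex m}"

definition realization_rel ::
    "'x sset \<Rightarrow> (((nat \<times> 'x) \<times> (nat \<Rightarrow> real)) \<times> ((nat \<times> 'x) \<times> (nat \<Rightarrow> real))) set" where
  "realization_rel X =
     (realization_step X \<union> (realization_step X)\<inverse>)\<^sup>* \<inter>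
       topspace (simplex_coproduct X) \<times> topspace (simplex_coproduct X)"

lemma equiv_realization_rel:
  "equiv (topspace (simplex_coproduct X)) (realization_rel X)"
proof -
  have "sym (realization_step X \<union> (realization_step X)\<inverse>)"
    by (auto simp: sym_def)
  then have "sym ((realization_step X \<union> (realization_step X)\<inverse>)\<^sup>*)"
    by (rule sym_rtrancl)
  then show ?thesis
    unfolding realization_rel_def
    by (auto simp: equiv_def refl_on_def sym_def trans_def)
qed

definition realization :: "'x sset \<Rightarrow> ((nat \<times> 'x) \<times> (nat \<Rightarrow> real)) set topology" where
  "realization X = quotient_topology (simplex_coproduct X) (realization_rel X)"

text \<open>The map of realizations induced by a simplicial map \<open>\<phi>\<close> into \<open>Y\<close>: it sends the class of
  \<open>((n, x), t)\<close> to the class of \<open>((n, \<phi> n x), t)\<close>.\<close>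

definition realization_map ::
    "'y sset \<Rightarrow> (nat \<Rightarrow> 'x \<Rightarrow> 'y) \<Rightarrow>
     ((nat \<times> 'x) \<times> (nat \<Rightarrow> real)) set \<Rightarrow> ((nat \<times> 'y) \<times> (nat \<Rightarrow> real)) set" where
  "realization_map Y \<phi> c = realization_rel Y `` ((\<lambda>((n, x), t). ((n, \<phi> n x), t)) ` c)"


section \<open>Nerve and classifying space\<close>

text \<open>The poset \<open>[n]\<close> as a category; the arrow \<open>(i, j)\<close> goes from \<open>i\<close> to \<open>j\<close>.\<close>

definition ord_cat :: "nat \<Rightarrow> (nat, nat \<times> nat) cat" where
  "ord_cat n =
     \<lparr>Ob = {..n}, Ar = {(i, j). i \<le> j \<and> j \<le> n}, Src = fst, Tgt = snd,
      Idt = (\<lambda>i. (i, i)), Cmp = (\<lambda>g f. (fst f, snd g))\<rparr>"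

definition ord_functor :: "nat \<Rightarrow> (nat \<Rightarrow> nat) \<Rightarrow> (nat, nat \<times> nat, nat, nat \<times> nat) fctr" where
  "ord_functor m \<theta> =
     \<lparr>fob = restrict \<theta> (Ob (ord_cat m)), far = restrict (map_prod \<theta> \<theta>) (Ar (ord_cat m))\<rparr>"

definition nerve :: "('o, 'm) cat \<Rightarrow> (nat, nat \<times> nat, 'o, 'm) fctr sset" where
  "nerve C =
     \<lparr>simplices = (\<lambda>n. {x. is_functor (ord_cat n) C x}),
      act = (\<lambda>m \<theta> x. comp_functor (ord_cat m) x (ord_functor m \<theta>))\<rparr>"

definition classifying_space ::
    "('o, 'm) cat \<Rightarrow> ((nat \<times> (nat, nat \<times> nat, 'o, 'm) fctr) \<times> (nat \<Rightarrow> real)) set topology" where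
  "classifying_space C = realization (nerve C)"

text \<open>The map of classifying spaces induced by a functor \<open>F\<close> into \<open>D\<close>.\<close>

definition classifying_map ::
    "('p, 'n) cat \<Rightarrow> ('o, 'm, 'p, 'n) fctr \<Rightarrow>
     ((nat \<times> (nat, nat \<times> nat, 'o, 'm) fctr) \<times> (nat \<Rightarrow> real)) set \<Rightarrow>
     ((nat \<times> (nat, nat \<times> nat, 'p, 'n) fctr) \<times> (nat \<Rightarrow> real)) set" where
  "classifying_map D F = realization_map (nerve D) (\<lambda>n x. comp_functor (ord_cat n) F x)"

definition homotopy_equivalence_map :: "'a topology \<Rightarrow> 'b topology \<Rightarrow> ('a \<Rightarrow> 'b) \<Rightarrow> bool" where
  "homotopy_equivalence_map X Y f \<longleftrightarrow>
     continuous_map X Y f \<and>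
     (\<exists>g. continuous_map Y X g \<and>
          homotopic_with (\<lambda>_. True) X X (g \<circ> f) id \<and>
          homotopic_with (\<lambda>_. True) Y Y (f \<circ> g) id)"

lemma homotopy_equivalent_space_iff_map:
  "X homotopy_equivalent_space Y \<longleftrightarrow> (\<exists>f. homotopy_equivalence_map X Y f)"
  by (auto simp: homotopy_equivalent_space_def homotopy_equivalence_map_def)


section \<open>Graphs\<close>

text \<open>\<open>cover\<close> is the two-fold covering from half-edges to edges, \<open>inc\<close> the incidence map. Both
  are extensional, so that a graph determines its record uniquely.\<close>

record ('v, 'e, 'h) graph =
  verts :: "'v set"
  edges :: "'e set"
  halfs :: "'h set"
  cover :: "'h \<Rightarrow> 'e"
  inc :: "'h \<Rightarrow> 'v"

definition is_graph :: "('v, 'e, 'h) graph \<Rightarrow> bool" where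
  "is_graph G \<longleftrightarrow>
     finite (verts G) \<and> finite (edges G) \<and>
     cover G \<in> halfs G \<rightarrow>\<^sub>E edges G \<and>
     (\<forall>e\<in>edges G. card {h \<in> halfs G. cover G h = e} = 2) \<and>
     inc G \<in> halfs G \<rightarrow>\<^sub>E verts G"

text \<open>The involution switching the two half-edges of each edge.\<close>

definition other_half :: "('v, 'e, 'h) graph \<Rightarrow> 'h \<Rightarrow> 'h" where
  "other_half G h = (THE h'. h' \<in> halfs G \<and> cover G h' = cover G h \<and> h' \<noteq> h)"

definition cells :: "('v, 'e, 'h) graph \<Rightarrow> ('v + 'h) set" where
  "cells G = verts G <+> halfs G"

fun tau :: "('v, 'e, 'h) graph \<Rightarrow> 'v + 'h \<Rightarrow> 'v + 'h" where
  "tau G (Inl v) = Inl v"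
| "tau G (Inr h) = Inr (other_half G h)"

fun bd :: "('v, 'e, 'h) graph \<Rightarrow> 'v + 'h \<Rightarrow> 'v + 'h" where
  "bd G (Inl v) = Inl v"
| "bd G (Inr h) = Inl (inc G h)"

definition graph_morphism ::
    "('v, 'e, 'h) graph \<Rightarrow> ('v, 'e, 'h) graph \<Rightarrow> ('v + 'h \<Rightarrow> 'v + 'h) \<Rightarrow> bool" where
  "graph_morphism G G' f \<longleftrightarrow>
     f \<in> cells G \<rightarrow>\<^sub>E cells G' \<and>
     (\<forall>c\<in>cells G. f (tau G c) = tau G' (f c) \<and> f (bd G c) = bd G' (f c))"

definition graph_mono ::
    "('v, 'e, 'h) graph \<Rightarrow> ('v, 'e, 'h) graph \<Rightarrow> ('v + 'h \<Rightarrow> 'v + 'h) \<Rightarrow> bool" where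
  "graph_mono G G' f \<longleftrightarrow>
     graph_morphism G G' f \<and> inj_on f (cells G) \<and>
     f ` Inl ` verts G = Inl ` verts G' \<and> f ` Inr ` halfs G \<subseteq> Inr ` halfs G'"

definition connected_graph :: "('v, 'e, 'h) graph \<Rightarrow> bool" where
  "connected_graph G \<longleftrightarrow>
     verts G \<noteq> {} \<and>
     (\<forall>u\<in>verts G. \<forall>v\<in>verts G. (u, v) \<in> {(inc G h, inc G (other_half G h)) | h. h \<in> halfs G}\<^sup>*)"


section \<open>The categories and the vertex functor\<close>

text \<open>An arrow is a triple (source, underlying extensional map, target).

  The small model of the category of connected graphs with \<open>r + 1\<close> vertices consists of the graphs
  whose vertices, edges and half-edges are elements of \<open>'v\<close>, \<open>'e\<close> and \<open>'h\<close>. When these types are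
  infinite it contains an isomorphic copy of every such graph. The same holds for
  finite sets and \<open>bij_cat\<close>.\<close>

type_synonym ('v, 'e, 'h) graph_arrow =
  "('v, 'e, 'h) graph \<times> ('v + 'h \<Rightarrow> 'v + 'h) \<times> ('v, 'e, 'h) graph"

definition mono_graph_cat ::
    "nat \<Rightarrow> (('v, 'e, 'h) graph, ('v, 'e, 'h) graph_arrow) cat" where
  "mono_graph_cat r =
     (let obs = {G. is_graph G \<and> connected_graph G \<and> card (verts G) = r + 1} in
      \<lparr>Ob = obs,
       Ar = {(G, f, G'). G \<in> obs \<and> G' \<in> obs \<and> graph_mono G G' f},
       Src = (\<lambda>(G, f, G'). G),
       Tgt = (\<lambda>(G, f, G'). G'),
       Idt = (\<lambda>G. (G, restrict id (cells G), G)),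
       Cmp = (\<lambda>(G', g, G'') (G, f, _). (G, compose (cells G) g f, G''))\<rparr>)"

definition bij_cat :: "nat \<Rightarrow> ('v set, 'v set \<times> ('v \<Rightarrow> 'v) \<times> 'v set) cat" where
  "bij_cat n =
     (let obs = {A. finite A \<and> card A = n} in
      \<lparr>Ob = obs,
       Ar = {(A, f, B). A \<in> obs \<and> B \<in> obs \<and> f \<in> extensional A \<and> bij_betw f A B},
       Src = (\<lambda>(A, f, B). A),
       Tgt = (\<lambda>(A, f, B). B),
       Idt = (\<lambda>A. (A, restrict id A, A)),
       Cmp = (\<lambda>(B, g, C) (A, f, _). (A, compose A g f, C))\<rparr>)"

definition vertex_functor ::
    "nat \<Rightarrow> (('v, 'e, 'h) graph, ('v, 'e, 'h) graph_arrow, 'v set, 'v set \<times> ('v \<Rightarrow> 'v) \<times> 'v set) fctr"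
  where
  "vertex_functor r =
     \<lparr>fob = restrict verts (Ob (mono_graph_cat r)),
      far = restrict (\<lambda>(G, f, G'). (verts G, restrict (\<lambda>v. projl (f (Inl v))) (verts G), verts G'))
              (Ar (mono_graph_cat r))\<rparr>"

lemma mono_graph_cat_simps:
  "G \<in> Ob (mono_graph_cat r) \<longleftrightarrow> is_graph G \<and> connected_graph G \<and> card (verts G) = r + 1"
  "(G, f, G') \<in> Ar (mono_graph_cat r) \<longleftrightarrow>
     G \<in> Ob (mono_graph_cat r) \<and> G' \<in> Ob (mono_graph_cat r) \<and> graph_mono G G' f"
  "Src (mono_graph_cat r) (G, f, G') = G"
  "Tgt (mono_graph_cat r) (G, f, G') = G'"
  "Idt (mono_graph_cat r) G = (G, restrict id (cells G), G)"
  "Cmp (mono_graph_cat r) (H, g, H') (G, f, G') = (G, compose (cells G) g f, H')"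
  by (simp_all add: mono_graph_cat_def)

lemma bij_cat_simps:
  "A \<in> Ob (bij_cat n) \<longleftrightarrow> finite A \<and> card A = n"
  "(A, f, B) \<in> Ar (bij_cat n) \<longleftrightarrow>
     A \<in> Ob (bij_cat n) \<and> B \<in> Ob (bij_cat n) \<and> f \<in> extensional A \<and> bij_betw f A B"
  "Src (bij_cat n) (A, f, B) = A"
  "Tgt (bij_cat n) (A, f, B) = B"
  "Idt (bij_cat n) A = (A, restrict id A, A)"
  "Cmp (bij_cat n) (B, g, C) (A, f, B') = (A, compose A g f, C)"
  by (simp_all add: bij_cat_def)

lemma other_half_in:
  assumes "is_graph G" "h \<in> halfs G"
  shows "other_half G h \<in> halfs G" "cover G (other_half G h) = cover G h" "other_half G h \<noteq> h"
proof -
  have e: "cover G h \<in> edges G"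
    using assms by (auto simp: is_graph_def)
  then have "card {x \<in> halfs G. cover G x = cover G h} = 2"
    using assms(1) by (simp add: is_graph_def)
  then obtain a b where ab: "{x \<in> halfs G. cover G x = cover G h} = {a, b}" "a \<noteq> b"
    unfolding card_2_iff by blast
  then have "h = a \<or> h = b"
    using assms(2) by blast
  then obtain c where c: "{x \<in> halfs G. cover G x = cover G h} = {h, c}" "c \<noteq> h"
    using ab by (metis insert_commute)
  have "\<exists>!h'. h' \<in> halfs G \<and> cover G h' = cover G h \<and> h' \<noteq> h"
  proof (rule ex1I[of _ c])
    show "c \<in> halfs G \<and> cover G c = cover G h \<and> c \<noteq> h"
      using c by blast
    show "x = c" if "x \<in> halfs G \<and> cover G x = cover G h \<and> x \<noteq> h" for x
      using c that by blast
  qed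
  from theI'[OF this]
  show "other_half G h \<in> halfs G" "cover G (other_half G h) = cover G h" "other_half G h \<noteq> h"
    unfolding other_half_def by blast+
qed

lemma tau_bd_in_cells:
  assumes "is_graph G" "c \<in> cells G"
  shows "tau G c \<in> cells G" "bd G c \<in> cells G"
  using assms other_half_in[of G] by (auto simp: cells_def is_graph_def)

lemma graph_mono_id:
  assumes "is_graph G"
  shows "graph_mono G G (restrict id (cells G))"
proof -
  have "restrict id (cells G) ` Inl ` verts G = Inl ` verts G"
    "restrict id (cells G) ` Inr ` halfs G = Inr ` halfs G"
    by (force simp: cells_def)+
  then show ?thesis
    using tau_bd_in_cells[OF assms]
    by (auto simp: graph_mono_def graph_morphism_def inj_on_def)
qed

lemma graph_mono_comp:
  assumes "is_graph G" "graph_mono G G' f" "graph_mono G' G'' g"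
  shows "graph_mono G G'' (compose (cells G) g f)"
proof -
  have f: "f c \<in> cells G'" if "c \<in> cells G" for c
    using assms(2) that by (auto simp: graph_mono_def graph_morphism_def)
  have "graph_morphism G G'' (compose (cells G) g f)"
    using assms tau_bd_in_cells[OF assms(1)] f
    by (auto simp: graph_mono_def graph_morphism_def compose_eq compose_def)
  moreover have "inj_on (compose (cells G) g f) (cells G)"
    using assms f by (auto simp: graph_mono_def inj_on_def compose_eq)
  moreover have "compose (cells G) g f ` S = g ` f ` S" if "S \<subseteq> cells G" for S
    unfolding image_image using that by (intro image_cong) (auto simp: compose_def)
  then have "compose (cells G) g f ` Inl ` verts G = g ` f ` Inl ` verts G"
    "compose (cells G) g f ` Inr ` halfs G = g ` f ` Inr ` halfs G"
    by (simp_all add: cells_def Plus_def)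
  moreover have "g ` f ` Inl ` verts G = Inl ` verts G''"
    using assms by (simp add: graph_mono_def)
  moreover have "g ` f ` Inr ` halfs G \<subseteq> Inr ` halfs G''"
    using assms unfolding graph_mono_def by (meson image_mono subset_trans)
  ultimately show ?thesis
    by (simp add: graph_mono_def)
qed

lemma is_category_mono_graph_cat: "is_category (mono_graph_cat r)"
proof -
  have ext: "f \<in> cells G \<rightarrow>\<^sub>E cells G'" if "graph_mono G G' f" for G G' :: "('a, 'b, 'c) graph" and f
    using that by (simp add: graph_mono_def graph_morphism_def)
  have un: "compose (cells G) f (restrict id (cells G)) = f"
    "compose (cells G) (restrict id (cells G')) f = f"
    if "graph_mono G G' f" for G G' :: "('a, 'b, 'c) graph" and f
    using ext[OF that] by (auto simp: compose_def fun_eq_iff PiE_def extensional_def Pi_def)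
  have as: "compose (cells G) h (compose (cells G) g f) = compose (cells G) (compose (cells G') h g) f"
    if "graph_mono G G' f" for G G' :: "('a, 'b, 'c) graph" and f and h g :: "'a + 'c \<Rightarrow> 'a + 'c"
    using ext[OF that] by (auto simp: compose_def fun_eq_iff)
  let ?C = "mono_graph_cat r :: (('a, 'b, 'c) graph, _) cat"
  show ?thesis
    unfolding is_category_def
  proof (intro conjI ballI impI)
    fix a assume A: "a \<in> Ar ?C"
    obtain G f G' where a: "a = (G, f, G')" by (cases a)
    show "Src ?C a \<in> Ob ?C" "Tgt ?C a \<in> Ob ?C"
      using A unfolding a mono_graph_cat_simps by blast+
    show "Cmp ?C a (Idt ?C (Src ?C a)) = a" "Cmp ?C (Idt ?C (Tgt ?C a)) a = a"
      using A un[of G G' f] unfolding a mono_graph_cat_simps by simp_all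
  next
    fix G assume "G \<in> Ob ?C"
    then show "Idt ?C G \<in> Ar ?C" "Src ?C (Idt ?C G) = G" "Tgt ?C (Idt ?C G) = G"
      unfolding mono_graph_cat_simps by (simp_all add: graph_mono_id)
  next
    fix a b assume ab: "a \<in> Ar ?C" "b \<in> Ar ?C" "Tgt ?C a = Src ?C b"
    obtain G f G' where a: "a = (G, f, G')" by (cases a)
    obtain H g H' where b: "b = (H, g, H')" by (cases b)
    show "Cmp ?C b a \<in> Ar ?C" "Src ?C (Cmp ?C b a) = Src ?C a" "Tgt ?C (Cmp ?C b a) = Tgt ?C b"
      using ab graph_mono_comp[of G G' f H' g] unfolding a b mono_graph_cat_simps by simp_all
  next
    fix a b c assume abc: "a \<in> Ar ?C" "b \<in> Ar ?C" "c \<in> Ar ?C"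
      "Tgt ?C a = Src ?C b \<and> Tgt ?C b = Src ?C c"
    obtain G f G' where a: "a = (G, f, G')" by (cases a)
    obtain H g H' where b: "b = (H, g, H')" by (cases b)
    obtain K h K' where c: "c = (K, h, K')" by (cases c)
    show "Cmp ?C c (Cmp ?C b a) = Cmp ?C (Cmp ?C c b) a"
      using abc as[of G G' f h g] unfolding a b c mono_graph_cat_simps by simp
  qed
qed

lemma is_category_bij_cat: "is_category (bij_cat n)"
proof -
  have un: "compose A f (restrict id A) = f" "compose A (restrict id B) f = f"
    if "f \<in> extensional A" "bij_betw f A B" for A B :: "'a set" and f
    using that bij_betwE[OF that(2)] by (force simp: compose_def fun_eq_iff extensional_def)+
  have as: "compose A h (compose A g f) = compose A (compose B h g) f"
    if "bij_betw f A B" for A f B and h g :: "'a \<Rightarrow> 'a"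
    using bij_betwE[OF that] by (force simp: compose_def fun_eq_iff)
  have co: "bij_betw (compose A g f) A C" if "bij_betw f A B" "bij_betw g B C"
    for A B C :: "'a set" and f g
    using bij_betw_compose that by blast
  have id: "bij_betw (restrict id A) A A" for A :: "'a set"
    by (auto simp: bij_betw_def inj_on_def)
  let ?C = "bij_cat n :: ('a set, _) cat"
  show ?thesis
    unfolding is_category_def
  proof (intro conjI ballI impI)
    fix a assume A: "a \<in> Ar ?C"
    obtain G f G' where a: "a = (G, f, G')" by (cases a)
    show "Src ?C a \<in> Ob ?C" "Tgt ?C a \<in> Ob ?C"
      using A unfolding a bij_cat_simps by blast+
    show "Cmp ?C a (Idt ?C (Src ?C a)) = a" "Cmp ?C (Idt ?C (Tgt ?C a)) a = a"
      using A un[of f G G'] unfolding a bij_cat_simps by simp_all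
  next
    fix G assume "G \<in> Ob ?C"
    then show "Idt ?C G \<in> Ar ?C" "Src ?C (Idt ?C G) = G" "Tgt ?C (Idt ?C G) = G"
      unfolding bij_cat_simps by (simp_all add: id)
  next
    fix a b assume ab: "a \<in> Ar ?C" "b \<in> Ar ?C" "Tgt ?C a = Src ?C b"
    obtain G f G' where a: "a = (G, f, G')" by (cases a)
    obtain H g H' where b: "b = (H, g, H')" by (cases b)
    show "Cmp ?C b a \<in> Ar ?C" "Src ?C (Cmp ?C b a) = Src ?C a" "Tgt ?C (Cmp ?C b a) = Tgt ?C b"
      using ab co[of f G G' g H'] unfolding a b bij_cat_simps by (simp_all add: compose_extensional)
  next
    fix a b c assume abc: "a \<in> Ar ?C" "b \<in> Ar ?C" "c \<in> Ar ?C"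
      "Tgt ?C a = Src ?C b \<and> Tgt ?C b = Src ?C c"
    obtain G f G' where a: "a = (G, f, G')" by (cases a)
    obtain H g H' where b: "b = (H, g, H')" by (cases b)
    obtain K h K' where c: "c = (K, h, K')" by (cases c)
    show "Cmp ?C c (Cmp ?C b a) = Cmp ?C (Cmp ?C c b) a"
      using abc as[of f G G' h g] unfolding a b c bij_cat_simps by simp
  qed
qed

lemma is_functor_vertex_functor:
  "is_functor (mono_graph_cat r) (bij_cat (r + 1))
     (vertex_functor r :: (('v, 'e, 'h) graph, ('v, 'e, 'h) graph_arrow, 'v set, _) fctr)"
proof -
  let ?V = "\<lambda>(f :: 'v + 'h \<Rightarrow> 'v + 'h) (G :: ('v, 'e, 'h) graph). restrict (\<lambda>v. projl (f (Inl v))) (verts G)"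
  have pos: "\<exists>w\<in>verts G'. f (Inl v) = Inl w" if "graph_mono G G' f" "v \<in> verts G"
    for G G' :: "('v, 'e, 'h) graph" and f v
    using that unfolding graph_mono_def by blast
  have bij: "bij_betw (?V f G) (verts G) (verts G')" if m: "graph_mono G G' f"
    for G G' :: "('v, 'e, 'h) graph" and f
  proof -
    have inj: "inj_on f (cells G)" and im: "f ` Inl ` verts G = Inl ` verts G'"
      using m by (auto simp: graph_mono_def)
    have "inj_on (?V f G) (verts G)"
    proof (rule inj_onI)
      fix u v assume uv: "u \<in> verts G" "v \<in> verts G" "?V f G u = ?V f G v"
      then have "f (Inl u) = f (Inl v)"
        using pos[OF m uv(1)] pos[OF m uv(2)] by auto
      with inj uv show "u = v"
        by (auto simp: inj_on_def cells_def)
    qed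
    moreover have "?V f G ` verts G = projl ` f ` Inl ` verts G"
      by (auto simp: image_image)
    then have "?V f G ` verts G = verts G'"
      unfolding im by (simp add: image_image)
    ultimately show ?thesis
      unfolding bij_betw_def by blast
  qed
  have co: "?V (compose (cells G) g f) G = compose (verts G) (?V g G') (?V f G)"
    if m: "graph_mono G G' f" for G G' :: "('v, 'e, 'h) graph" and f g
    using pos[OF m] by (fastforce simp: compose_def cells_def fun_eq_iff)
  have id: "?V (restrict id (cells G)) G = restrict id (verts G)" for G :: "('v, 'e, 'h) graph"
    by (auto simp: cells_def fun_eq_iff)
  show ?thesis
    unfolding is_functor_def
  proof (intro conjI ballI impI)
    show "fob (vertex_functor r) \<in> Ob (mono_graph_cat r :: (('v, 'e, 'h) graph, _) cat) \<rightarrow>\<^sub>E Ob (bij_cat (r + 1))"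
      by (auto simp: vertex_functor_def mono_graph_cat_simps bij_cat_simps is_graph_def)
    show "far (vertex_functor r) \<in> Ar (mono_graph_cat r :: (('v, 'e, 'h) graph, _) cat) \<rightarrow>\<^sub>E Ar (bij_cat (r + 1))"
      using bij by (auto simp: vertex_functor_def mono_graph_cat_simps bij_cat_simps is_graph_def)
  next
    fix a assume a: "a \<in> Ar (mono_graph_cat r :: (('v, 'e, 'h) graph, _) cat)"
    obtain G f G' where aeq: "a = (G, f, G')" by (cases a)
    show "Src (bij_cat (r + 1)) (far (vertex_functor r) a) = fob (vertex_functor r) (Src (mono_graph_cat r) a)"
      "Tgt (bij_cat (r + 1)) (far (vertex_functor r) a) = fob (vertex_functor r) (Tgt (mono_graph_cat r) a)"
      using a by (auto simp: aeq vertex_functor_def mono_graph_cat_simps bij_cat_simps)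
  next
    fix G assume G: "G \<in> Ob (mono_graph_cat r :: (('v, 'e, 'h) graph, _) cat)"
    show "far (vertex_functor r) (Idt (mono_graph_cat r) G) =
          Idt (bij_cat (r + 1)) (fob (vertex_functor r) G)"
      using G graph_mono_id[of G] id[of G]
      by (simp add: vertex_functor_def mono_graph_cat_simps bij_cat_simps)
  next
    fix a b assume ab: "a \<in> Ar (mono_graph_cat r :: (('v, 'e, 'h) graph, _) cat)"
      "b \<in> Ar (mono_graph_cat r)" "Tgt (mono_graph_cat r) a = Src (mono_graph_cat r) b"
    obtain G f G' where aeq: "a = (G, f, G')" by (cases a)
    obtain H g H' where beq: "b = (H, g, H')" by (cases b)
    have [simp]: "H = G'" using ab(3) by (simp add: aeq beq mono_graph_cat_simps)
    have m: "graph_mono G G' f" "graph_mono G' H' g" "is_graph G"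
      using ab by (auto simp: aeq beq mono_graph_cat_simps)
    show "far (vertex_functor r) (Cmp (mono_graph_cat r) b a) =
          Cmp (bij_cat (r + 1)) (far (vertex_functor r) b) (far (vertex_functor r) a)"
      using ab co[OF m(1), of g] graph_mono_comp[OF m(3) m(1,2)]
      by (simp add: aeq beq vertex_functor_def mono_graph_cat_simps bij_cat_simps)
  qed
qed

end

theory Submission
  imports Defs
begin

text \<open>
  A natural transformation induces a homotopy of classifying maps, so it suffices to connect functors
  by zigzags of natural transformations. Let \<open>T G\<close> be the union of a graph \<open>G\<close> with a disjoint complete
  graph on its vertex set, and \<open>K A\<close> the complete graph on \<open>A\<close>. Both are functorial in monomorphisms,
  \<open>V \<circ> K\<close> is the identity, and the inclusions \<open>G \<rightarrow> T G\<close> and \<open>K (V G) \<rightarrow> T G\<close> are natural; hence \<open>K\<close> is a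
  homotopy inverse of \<open>V\<close>. The finite sets of a given size form a connected groupoid with
  automorphism group the symmetric group, which gives the second equivalence.
\<close>

section \<open>Maps out of a realization\<close>

text \<open>The zigzag is forced. A graph may have loops and multiple edges, so in general it has no
  monomorphism to the complete graph on its vertices; it may also lack edges, so there is none in
  the other direction either. The union receives both, and as it is disjoint, old and new half-edges
  never have to be compared.

  The homotopy of a natural transformation is not deduced from a product theorem for realizations
  but written down in coordinates. The partial sums of the barycentric coordinates cut the unit
  interval, and the position of the time \<open>s\<close> among them selects one prism simplex and
  the weights on it. What has to be checked is that neighbouring prism simplices agree, that the
  formula respects all monotone maps, degeneracies included, and that it is continuous.

  All graphs live in the fixed types \<open>'v\<close>, \<open>'e\<close> and \<open>'h\<close>, so
  an added complete graph needs room there. An infinite type absorbs a countable set of codes, and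
  chosen enumerations of the vertex sets turn pairs of vertices into pairs of numbers.\<close>

lemma continuous_map_from_prod_sum_topology:
  assumes "\<And>i. i \<in> I \<Longrightarrow> continuous_map (prod_topology Z (X i)) Y (\<lambda>(s, t). g (s, (i, t)))"
  shows "continuous_map (prod_topology Z (sum_topology X I)) Y g"
  unfolding continuous_map_def
proof (intro conjI allI impI)
  show "g \<in> topspace (prod_topology Z (sum_topology X I)) \<rightarrow> topspace Y"
  proof
    fix z assume "z \<in> topspace (prod_topology Z (sum_topology X I))"
    then obtain s i t where "z = (s, (i, t))" "i \<in> I" "s \<in> topspace Z" "t \<in> topspace (X i)"
      by auto
    then show "g z \<in> topspace Y"
      using continuous_map_image_subset_topspace[OF assms[of i]] by fastforce
  qed
next
  fix U assume U: "openin Y U"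
  show "openin (prod_topology Z (sum_topology X I))
    {z \<in> topspace (prod_topology Z (sum_topology X I)). g z \<in> U}"
    unfolding openin_prod_topology_alt
  proof (intro allI impI)
    fix s p assume "(s, p) \<in> {z \<in> topspace (prod_topology Z (sum_topology X I)). g z \<in> U}"
    then obtain i t where p: "p = (i, t)" "i \<in> I" "s \<in> topspace Z" "t \<in> topspace (X i)" "g (s, (i, t)) \<in> U"
      by auto
    have "openin (prod_topology Z (X i))
        {z \<in> topspace (prod_topology Z (X i)). (case z of (s, t) \<Rightarrow> g (s, (i, t))) \<in> U}"
      using assms[OF p(2)] U by (simp add: continuous_map_def)
    moreover have "(s, t) \<in> {z \<in> topspace (prod_topology Z (X i)). (case z of (s, t) \<Rightarrow> g (s, (i, t))) \<in> U}"
      using p by auto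
    ultimately obtain V W where VW: "openin Z V" "openin (X i) W" "s \<in> V" "t \<in> W"
      "V \<times> W \<subseteq> {z \<in> topspace (prod_topology Z (X i)). (case z of (s, t) \<Rightarrow> g (s, (i, t))) \<in> U}"
      unfolding openin_prod_topology_alt by (smt (verit))
    \<comment> \<open>Summands are open in the sum, so a product neighbourhood found in
      \<open>Z\<close> times one summand is still open in the whole product.\<close>
    have "openin (sum_topology X I) (Pair i ` W)"
      using open_map_component_injection[OF p(2)] VW(2) by (auto simp: open_map_def)
    moreover have "V \<times> Pair i ` W \<subseteq> {z \<in> topspace (prod_topology Z (sum_topology X I)). g z \<in> U}"
      using VW(5) p(2) by fastforce
    ultimately show "\<exists>V W. openin Z V \<and> openin (sum_topology X I) W \<and> s \<in> V \<and> p \<in> W \<and>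
        V \<times> W \<subseteq> {z \<in> topspace (prod_topology Z (sum_topology X I)). g z \<in> U}"
      using VW p by blast
  qed
qed

abbreviation simplex_space :: "nat \<Rightarrow> (nat \<Rightarrow> real) topology" where
  "simplex_space n \<equiv> subtopology (powertop_real UNIV) (standard_simplex n)"

lemma standard_simplexI:
  assumes "\<And>i. 0 \<le> t i" "\<And>i. i > n \<Longrightarrow> t i = 0" "(\<Sum>i\<le>n. t i) = 1"
  shows "t \<in> standard_simplex n"
proof -
  have "t i \<le> 1" for i
  proof (cases "i \<le> n")
    case True
    then have "t i \<le> (\<Sum>i\<le>n. t i)"
      by (intro member_le_sum) (auto simp: assms)
    then show ?thesis by (simp add: assms)
  qed (simp add: assms)
  with assms show ?thesis by (simp add: standard_simplex_def)
qed

lemma simplex_push_in: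
  assumes "\<theta> \<in> mono_maps m n" "t \<in> standard_simplex m"
  shows "simplex_push m \<theta> t \<in> standard_simplex n"
proof (rule standard_simplexI)
  have t: "0 \<le> t i" "(\<Sum>i\<le>m. t i) = 1" for i
    using assms(2) by (auto simp: standard_simplex_def)
  show "0 \<le> simplex_push m \<theta> t j" for j
    unfolding simplex_push_def by (intro sum_nonneg) (simp add: t)
  have le: "\<theta> i \<le> n" if "i \<le> m" for i
    using assms(1) that by (auto simp: mono_maps_def)
  show "simplex_push m \<theta> t j = 0" if "j > n" for j
  proof -
    have "{i. i \<le> m \<and> \<theta> i = j} = {}"
      using le that by force
    then show ?thesis by (simp only: simplex_push_def sum.empty)
  qed
  have "(\<Sum>j\<le>n. sum t {i \<in> {..m}. \<theta> i = j}) = sum t {..m}"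
    by (rule sum.group) (use le in auto)
  then show "(\<Sum>j\<le>n. simplex_push m \<theta> t j) = 1"
    by (simp add: simplex_push_def t)
qed

text \<open>\<open>realization_rel\<close> relates only points of the coproduct; this closure puts
  the source of a generating step there.\<close>

definition closed_under_act :: "'x sset \<Rightarrow> bool" where
  "closed_under_act X \<longleftrightarrow>
     (\<forall>m n \<theta> x. \<theta> \<in> mono_maps m n \<longrightarrow> x \<in> simplices X n \<longrightarrow> act X m \<theta> x \<in> simplices X m)"

definition simplex_point ::
    "'x sset \<Rightarrow> nat \<Rightarrow> 'x \<Rightarrow> (nat \<Rightarrow> real) \<Rightarrow> ((nat \<times> 'x) \<times> (nat \<Rightarrow> real)) set" where
  "simplex_point X n x t = realization_rel X `` {((n, x), t)}"

lemma topspace_simplex_coproduct: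
  "((n, x), t) \<in> topspace (simplex_coproduct X) \<longleftrightarrow> x \<in> simplices X n \<and> t \<in> standard_simplex n"
  by (simp add: simplex_coproduct_def)

lemma simplex_point_act:
  assumes "closed_under_act X" "\<theta> \<in> mono_maps m n" "x \<in> simplices X n" "t \<in> standard_simplex m"
  shows "simplex_point X m (act X m \<theta> x) t = simplex_point X n x (simplex_push m \<theta> t)"
proof -
  have "(((m, act X m \<theta> x), t), ((n, x), simplex_push m \<theta> t)) \<in> realization_step X"
    using assms unfolding realization_step_def by blast
  moreover have "act X m \<theta> x \<in> simplices X m"
    using assms by (auto simp: closed_under_act_def)
  ultimately have "(((m, act X m \<theta> x), t), ((n, x), simplex_push m \<theta> t)) \<in> realization_rel X"
    using assms simplex_push_in[OF assms(2,4)]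
    by (auto simp: realization_rel_def topspace_simplex_coproduct)
  then show ?thesis
    unfolding simplex_point_def by (rule equiv_class_eq[OF equiv_realization_rel])
qed

text \<open>Induction along the zigzag of generating steps that witnesses the relation. This is how
  functions on simplices descend to the realization.\<close>

lemma realization_rel_invariant:
  assumes "\<And>m n \<theta> x t. \<theta> \<in> mono_maps m n \<Longrightarrow> x \<in> simplices X n \<Longrightarrow> t \<in> standard_simplex m \<Longrightarrow>
      g ((m, act X m \<theta> x), t) = g ((n, x), simplex_push m \<theta> t)"
    and "(p, q) \<in> realization_rel X"
  shows "g p = g q"
proof -
  have *: "g p = g q" if "(p, q) \<in> realization_step X" for p q
    using that assms(1) unfolding realization_step_def by fast
  have "(p, q) \<in> (realization_step X \<union> (realization_step X)\<inverse>)\<^sup>*"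
    using assms(2) by (simp add: realization_rel_def)
  then show ?thesis
    by (induction rule: rtrancl_induct) (auto dest: *)
qed

lemma topspace_realization_cases:
  assumes "c \<in> topspace (realization X)"
  obtains n x t where "x \<in> simplices X n" "t \<in> standard_simplex n" "c = simplex_point X n x t"
proof -
  obtain p where p: "p \<in> topspace (simplex_coproduct X)" "c = realization_rel X `` {p}"
    using assms by (auto simp: realization_def quotient_def)
  obtain n x t where "p = ((n, x), t)"
    by (metis surj_pair)
  with p that show thesis
    by (auto simp: topspace_simplex_coproduct simplex_point_def)
qed

lemma quotient_map_realization:
  "quotient_map (simplex_coproduct X) (realization X) (\<lambda>p. realization_rel X `` {p})"
  unfolding realization_def
  by (rule quotient_map_quotient_topology[OF equiv_realization_rel])

lemma continuous_map_simplex_point: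
  assumes "x \<in> simplices X n"
  shows "continuous_map (simplex_space n) (realization X) (simplex_point X n x)"
proof -
  have "continuous_map (simplex_space n) (simplex_coproduct X) (Pair (n, x))"
    unfolding simplex_coproduct_def
    using continuous_map_component_injection[of "(n, x)" "{(n, x). x \<in> simplices X n}"
        "\<lambda>(n, x). simplex_space n"] assms by simp
  from continuous_map_compose[OF this quotient_imp_continuous_map[OF quotient_map_realization]]
  show ?thesis
    by (simp add: o_def simplex_point_def[abs_def])
qed

text \<open>A homotopy out of a realization may be defined simplexwise. Local compactness of the
  parameter space makes its product with the quotient map again a quotient map.\<close>

lemma realization_parametrized_lift:
  assumes Z: "locally_compact_space Z" "Hausdorff_space Z"
    and cont: "\<And>n x. x \<in> simplices X n \<Longrightarrow>
      continuous_map (prod_topology Z (simplex_space n)) Y (\<lambda>(s, t). h s n x t)"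
    and compat: "\<And>s m n \<theta> x t. \<lbrakk>s \<in> topspace Z; \<theta> \<in> mono_maps m n; x \<in> simplices X n; t \<in> standard_simplex m\<rbrakk>
      \<Longrightarrow> h s m (act X m \<theta> x) t = h s n x (simplex_push m \<theta> t)"
  obtains k where "continuous_map (prod_topology Z (realization X)) Y k"
    "\<And>s n x t. \<lbrakk>s \<in> topspace Z; x \<in> simplices X n; t \<in> standard_simplex n\<rbrakk> \<Longrightarrow>
      k (s, simplex_point X n x t) = h s n x t"
proof -
  define g where "g = (\<lambda>(s, ((n, x), t)). h s n x t)"
  have q: "quotient_map (prod_topology Z (simplex_coproduct X)) (prod_topology Z (realization X))
      (\<lambda>(s, p). (s, realization_rel X `` {p}))"
    using quotient_map_prod_right[OF _ _ quotient_map_realization] Z by blast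
  have c: "continuous_map (prod_topology Z (simplex_coproduct X)) Y g"
    unfolding simplex_coproduct_def
    by (rule continuous_map_from_prod_sum_topology) (use cont in \<open>auto simp: g_def\<close>)
  have e: "g z = g z'"
    if zz: "z \<in> topspace (prod_topology Z (simplex_coproduct X))"
      "z' \<in> topspace (prod_topology Z (simplex_coproduct X))"
      "(\<lambda>(s, p). (s, realization_rel X `` {p})) z = (\<lambda>(s, p). (s, realization_rel X `` {p})) z'"
    for z z'
  proof -
    obtain s p q where z: "z = (s, p)" "z' = (s, q)" "s \<in> topspace Z"
      "q \<in> topspace (simplex_coproduct X)" "realization_rel X `` {p} = realization_rel X `` {q}"
      using zz by auto
    then have "(p, q) \<in> realization_rel X"
      by (meson equiv_realization_rel eq_equiv_class)
    then have "g (s, p) = g (s, q)"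
      by (rule realization_rel_invariant[rotated, where g = "\<lambda>p. g (s, p)"])
        (use compat z(3) in \<open>simp add: g_def\<close>)
    then show ?thesis by (simp add: z)
  qed
  obtain k where k: "continuous_map (prod_topology Z (realization X)) Y k"
    "\<And>z. z \<in> topspace (prod_topology Z (simplex_coproduct X)) \<Longrightarrow>
      k ((\<lambda>(s, p). (s, realization_rel X `` {p})) z) = g z"
  proof (rule quotient_map_lift_exists[OF q c e])
    fix k assume "continuous_map (prod_topology Z (realization X)) Y k"
      "\<And>z. z \<in> topspace (prod_topology Z (simplex_coproduct X)) \<Longrightarrow>
        k ((\<lambda>(s, p). (s, realization_rel X `` {p})) z) = g z"
    then show thesis
      by (rule that)
  qed
  show thesis
  proof (rule that[OF k(1)])
    fix s n x t assume "s \<in> topspace Z" "x \<in> simplices X n" "t \<in> standard_simplex n"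
    then show "k (s, simplex_point X n x t) = h s n x t"
      using k(2)[of "(s, ((n, x), t))"]
      by (simp add: topspace_simplex_coproduct simplex_point_def g_def)
  qed
qed

text \<open>\<open>realization_map\<close> saturates the image of a whole class, so the point is
  that this image meets only one class. The class \<open>g\<close> of an image point is constant
  along the relation, hence the union of these classes over \<open>simplex_point X n x t\<close> is
  a single one.\<close>

lemma realization_map_simplex_point:
  assumes "closed_under_act Y"
    and \<phi>: "\<And>n x. x \<in> simplices X n \<Longrightarrow> \<phi> n x \<in> simplices Y n"
    and nat: "\<And>m n \<theta> x. \<theta> \<in> mono_maps m n \<Longrightarrow> x \<in> simplices X n \<Longrightarrow>
        \<phi> m (act X m \<theta> x) = act Y m \<theta> (\<phi> n x)"
    and xt: "x \<in> simplices X n" "t \<in> standard_simplex n"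
  shows "realization_map Y \<phi> (simplex_point X n x t) = simplex_point Y n (\<phi> n x) t"
proof -
  define g where "g = (\<lambda>((n, x), t). simplex_point Y n (\<phi> n x) t)"
  have rel: "g p = g q" if "(p, q) \<in> realization_rel X" for p q
    by (rule realization_rel_invariant[OF _ that])
      (use assms(1) in \<open>simp add: g_def nat simplex_point_act \<phi>\<close>)
  have "((n, x), t) \<in> simplex_point X n x t"
    unfolding simplex_point_def
    by (rule equiv_class_self[OF equiv_realization_rel]) (simp add: topspace_simplex_coproduct xt)
  moreover have "realization_map Y \<phi> c = (\<Union>p\<in>c. g p)" for c
    by (force simp: realization_map_def g_def simplex_point_def)
  moreover have "g p = g ((n, x), t)" if "p \<in> simplex_point X n x t" for p
    using that rel[of "((n, x), t)" p] by (simp add: simplex_point_def)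
  ultimately have "realization_map Y \<phi> (simplex_point X n x t) = g ((n, x), t)"
    by blast
  then show ?thesis by (simp add: g_def)
qed

section \<open>Nerves and natural transformations\<close>

lemma ord_cat_simps [simp]:
  "Ob (ord_cat n) = {..n}" "(i, j) \<in> Ar (ord_cat n) \<longleftrightarrow> i \<le> j \<and> j \<le> n"
  "Src (ord_cat n) = fst" "Tgt (ord_cat n) = snd" "Idt (ord_cat n) i = (i, i)"
  "Cmp (ord_cat n) g f = (fst f, snd g)"
  by (simp_all add: ord_cat_def)

lemma ord_functorI:
  assumes "\<And>i. i \<le> n \<Longrightarrow> u i \<in> Ob C"
    and "\<And>i j. i \<le> j \<Longrightarrow> j \<le> n \<Longrightarrow> a i j \<in> Ar C"
    and "\<And>i j. i \<le> j \<Longrightarrow> j \<le> n \<Longrightarrow> Src C (a i j) = u i"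
    and "\<And>i j. i \<le> j \<Longrightarrow> j \<le> n \<Longrightarrow> Tgt C (a i j) = u j"
    and "\<And>i. i \<le> n \<Longrightarrow> a i i = Idt C (u i)"
    and "\<And>i j k. i \<le> j \<Longrightarrow> j \<le> k \<Longrightarrow> k \<le> n \<Longrightarrow> a i k = Cmp C (a j k) (a i j)"
  shows "is_functor (ord_cat n) C
    \<lparr>fob = restrict u {..n}, far = restrict (\<lambda>(i, j). a i j) (Ar (ord_cat n))\<rparr>"
    (is "is_functor _ _ ?x")
proof -
  have r: "restrict (\<lambda>(i, j). a i j) (Ar (ord_cat n)) \<in> Ar (ord_cat n) \<rightarrow>\<^sub>E Ar C"
    using assms(2) by auto
  have c: "far ?x (Cmp (ord_cat n) g f) = Cmp C (far ?x g) (far ?x f)"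
    if "f \<in> Ar (ord_cat n)" "g \<in> Ar (ord_cat n)" "snd f = fst g" for f g
  proof -
    obtain i j k where "f = (i, j)" "g = (j, k)"
      using \<open>snd f = fst g\<close> by (metis prod.collapse)
    then show ?thesis
      using that assms(6)[of i j k] by simp
  qed
  show ?thesis
    unfolding is_functor_def
  proof (intro conjI ballI impI)
    show "far ?x (Cmp (ord_cat n) g f) = Cmp C (far ?x g) (far ?x f)"
      if "f \<in> Ar (ord_cat n)" "g \<in> Ar (ord_cat n)" "Tgt (ord_cat n) f = Src (ord_cat n) g" for f g
      using c that by simp
  qed (use assms(1,3-5) r in auto)
qed

lemma ord_functorD:
  assumes "is_functor (ord_cat n) C x"
  shows "i \<le> n \<Longrightarrow> fob x i \<in> Ob C"
    and "i \<le> j \<Longrightarrow> j \<le> n \<Longrightarrow> far x (i, j) \<in> Ar C"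
    and "i \<le> j \<Longrightarrow> j \<le> n \<Longrightarrow> Src C (far x (i, j)) = fob x i"
    and "i \<le> j \<Longrightarrow> j \<le> n \<Longrightarrow> Tgt C (far x (i, j)) = fob x j"
    and "i \<le> n \<Longrightarrow> far x (i, i) = Idt C (fob x i)"
    and "i \<le> j \<Longrightarrow> j \<le> k \<Longrightarrow> k \<le> n \<Longrightarrow> Cmp C (far x (j, k)) (far x (i, j)) = far x (i, k)"
proof -
  note x_def = assms[unfolded is_functor_def ord_cat_simps]
  have x: "fob x \<in> {..n} \<rightarrow>\<^sub>E Ob C" "far x \<in> Ar (ord_cat n) \<rightarrow>\<^sub>E Ar C"
    "\<And>f. f \<in> Ar (ord_cat n) \<Longrightarrow> Src C (far x f) = fob x (fst f) \<and> Tgt C (far x f) = fob x (snd f)"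
    "\<And>a. a \<le> n \<Longrightarrow> far x (a, a) = Idt C (fob x a)"
    "\<And>f g. f \<in> Ar (ord_cat n) \<Longrightarrow> g \<in> Ar (ord_cat n) \<Longrightarrow> snd f = fst g \<Longrightarrow>
        far x (fst f, snd g) = Cmp C (far x g) (far x f)"
    using x_def by blast+
  show "i \<le> n \<Longrightarrow> fob x i \<in> Ob C" using x(1) by (auto simp: PiE_iff)
  show "i \<le> j \<Longrightarrow> j \<le> n \<Longrightarrow> far x (i, j) \<in> Ar C" using x(2) by (auto simp: PiE_iff)
  show "i \<le> j \<Longrightarrow> j \<le> n \<Longrightarrow> Src C (far x (i, j)) = fob x i" using x(3)[of "(i, j)"] by simp
  show "i \<le> j \<Longrightarrow> j \<le> n \<Longrightarrow> Tgt C (far x (i, j)) = fob x j" using x(3)[of "(i, j)"] by simp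
  show "i \<le> n \<Longrightarrow> far x (i, i) = Idt C (fob x i)" using x(4) by simp
  show "i \<le> j \<Longrightarrow> j \<le> k \<Longrightarrow> k \<le> n \<Longrightarrow> Cmp C (far x (j, k)) (far x (i, j)) = far x (i, k)"
    using x(5)[of "(i, j)" "(j, k)"] by simp
qed

lemma functorD:
  assumes "is_functor C D F"
  shows "a \<in> Ob C \<Longrightarrow> fob F a \<in> Ob D"
    and "f \<in> Ar C \<Longrightarrow> far F f \<in> Ar D"
    and "f \<in> Ar C \<Longrightarrow> Src D (far F f) = fob F (Src C f)"
    and "f \<in> Ar C \<Longrightarrow> Tgt D (far F f) = fob F (Tgt C f)"
    and "a \<in> Ob C \<Longrightarrow> far F (Idt C a) = Idt D (fob F a)"
    and "f \<in> Ar C \<Longrightarrow> g \<in> Ar C \<Longrightarrow> Tgt C f = Src C g \<Longrightarrow>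
        far F (Cmp C g f) = Cmp D (far F g) (far F f)"
  using assms by (auto simp: is_functor_def)

lemma comp_functor_ord:
  "comp_functor (ord_cat n) F x =
     \<lparr>fob = (\<lambda>i\<in>{..n}. fob F (fob x i)), far = restrict (\<lambda>(i, j). far F (far x (i, j))) (Ar (ord_cat n))\<rparr>"
  by (auto simp: comp_functor_def compose_def fun_eq_iff)

lemma act_nerve:
  assumes "\<theta> \<in> mono_maps m n"
  shows "act (nerve C) m \<theta> x =
     \<lparr>fob = (\<lambda>i\<in>{..m}. fob x (\<theta> i)), far = restrict (\<lambda>(i, j). far x (\<theta> i, \<theta> j)) (Ar (ord_cat m))\<rparr>"
  by (auto simp: nerve_def comp_functor_def ord_functor_def compose_def fun_eq_iff)

lemma mono_mapsD:
  assumes "\<theta> \<in> mono_maps m n"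
  shows "i \<le> m \<Longrightarrow> \<theta> i \<le> n" "i \<le> j \<Longrightarrow> j \<le> m \<Longrightarrow> \<theta> i \<le> \<theta> j"
  using assms by (auto simp: mono_maps_def mono_on_def)

lemma simplices_nerve: "x \<in> simplices (nerve C) n \<longleftrightarrow> is_functor (ord_cat n) C x"
  by (simp add: nerve_def)

lemma closed_under_act_nerve: "closed_under_act (nerve C)"
  unfolding closed_under_act_def simplices_nerve
proof (intro allI impI)
  fix m n \<theta> x assume \<theta>: "\<theta> \<in> mono_maps m n" and x: "is_functor (ord_cat n) C x"
  show "is_functor (ord_cat m) C (act (nerve C) m \<theta> x)"
    unfolding act_nerve[OF \<theta>]
    by (rule ord_functorI) (use ord_functorD[OF x] mono_mapsD[OF \<theta>] in auto)
qed

lemma comp_functor_ord_functor: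
  assumes x: "is_functor (ord_cat n) C x" and F: "is_functor C D F"
  shows "is_functor (ord_cat n) D (comp_functor (ord_cat n) F x)"
  unfolding comp_functor_ord
proof (rule ord_functorI)
  fix i j k assume "i \<le> j" "j \<le> k" "k \<le> n"
  then show "far F (far x (i, k)) = Cmp D (far F (far x (j, k))) (far F (far x (i, j)))"
    using functorD(6)[OF F, of "far x (i, j)" "far x (j, k)"] ord_functorD[OF x] by simp
qed (use ord_functorD[OF x] functorD[OF F] in simp_all)

lemma classifying_map_simplex_point:
  assumes F: "is_functor C D F" and x: "is_functor (ord_cat n) C x" and t: "t \<in> standard_simplex n"
  shows "classifying_map D F (simplex_point (nerve C) n x t) =
    simplex_point (nerve D) n (comp_functor (ord_cat n) F x) t"
  unfolding classifying_map_def
proof (rule realization_map_simplex_point[OF closed_under_act_nerve])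
  fix m n \<theta> x assume \<theta>: "\<theta> \<in> mono_maps m n" and "x \<in> simplices (nerve C) n"
  show "comp_functor (ord_cat m) F (act (nerve C) m \<theta> x) =
      act (nerve D) m \<theta> (comp_functor (ord_cat n) F x)"
    unfolding act_nerve[OF \<theta>] comp_functor_ord
    by (auto simp: fun_eq_iff mono_mapsD[OF \<theta>])
qed (use comp_functor_ord_functor[OF _ F] x t in \<open>auto simp: simplices_nerve\<close>)

definition nat_trans ::
    "('o, 'm) cat \<Rightarrow> ('p, 'n) cat \<Rightarrow> ('o, 'm, 'p, 'n) fctr \<Rightarrow> ('o, 'm, 'p, 'n) fctr \<Rightarrow> ('o \<Rightarrow> 'n) \<Rightarrow> bool"
  where
  "nat_trans C D F G \<alpha> \<longleftrightarrow>
     (\<forall>a\<in>Ob C. \<alpha> a \<in> Ar D \<and> Src D (\<alpha> a) = fob F a \<and> Tgt D (\<alpha> a) = fob G a) \<and>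
     (\<forall>f\<in>Ar C. Cmp D (\<alpha> (Tgt C f)) (far F f) = Cmp D (far G f) (\<alpha> (Src C f)))"

text \<open>A transformation from \<open>F\<close> to \<open>G\<close> is a functor on \<open>C \<times> [1]\<close>; this is its restriction to the chain
  \<open>k \<mapsto> (x (fst (p k)), snd (p k))\<close>, with \<open>False\<close> and \<open>True\<close> standing for the objects \<open>0\<close> and
  \<open>1\<close> of \<open>[1]\<close>.\<close>

definition cylinder_simplex ::
    "('p, 'n) cat \<Rightarrow> ('o, 'm, 'p, 'n) fctr \<Rightarrow> ('o, 'm, 'p, 'n) fctr \<Rightarrow> ('o \<Rightarrow> 'n) \<Rightarrow>
     (nat, nat \<times> nat, 'o, 'm) fctr \<Rightarrow> nat \<Rightarrow> (nat \<Rightarrow> nat \<times> bool) \<Rightarrow> (nat, nat \<times> nat, 'p, 'n) fctr" where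
  "cylinder_simplex D F G \<alpha> x N p =
     \<lparr>fob = (\<lambda>i\<in>{..N}. fob (if snd (p i) then G else F) (fob x (fst (p i)))),
      far = restrict (\<lambda>(i, j). let f = far x (fst (p i), fst (p j)) in
              if snd (p i) then far G f
              else if snd (p j) then Cmp D (\<alpha> (fob x (fst (p j)))) (far F f)
              else far F f) (Ar (ord_cat N))\<rparr>"

lemma cylinder_simplex_cong:
  assumes "\<And>i. i \<le> N \<Longrightarrow> p i = q i"
  shows "cylinder_simplex D F G \<alpha> x N p = cylinder_simplex D F G \<alpha> x N q"
  unfolding cylinder_simplex_def using assms by (auto simp: fun_eq_iff Let_def)

lemma act_cylinder_simplex:
  assumes "\<theta> \<in> mono_maps M N"
  shows "act (nerve D) M \<theta> (cylinder_simplex D F G \<alpha> x N p) = cylinder_simplex D F G \<alpha> x M (p \<circ> \<theta>)"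
  unfolding act_nerve[OF assms] cylinder_simplex_def
  by (auto simp: fun_eq_iff Let_def mono_mapsD[OF assms])

text \<open>Acting on \<open>x\<close> moves the first coordinates of the chain, whereas acting on
  the resulting simplex reindexes the chain, by \<open>act_cylinder_simplex\<close>. Comparing the
  two actions thus reduces to an equation between vertices,
  \<open>prism_vertex_prism_map\<close>.\<close>

lemma cylinder_simplex_act:
  assumes \<theta>: "\<theta> \<in> mono_maps m n" and p: "\<And>i j. i \<le> j \<Longrightarrow> j \<le> N \<Longrightarrow> fst (p i) \<le> fst (p j) \<and> fst (p j) \<le> m"
  shows "cylinder_simplex D F G \<alpha> (act (nerve C) m \<theta> x) N p =
    cylinder_simplex D F G \<alpha> x N (map_prod \<theta> id \<circ> p)"
  unfolding act_nerve[OF \<theta>] cylinder_simplex_def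
  using p by (auto simp: fun_eq_iff Let_def)

lemma cylinder_simplex_ends:
  "cylinder_simplex D F G \<alpha> x n (\<lambda>i. (i, False)) = comp_functor (ord_cat n) F x"
  "cylinder_simplex D F G \<alpha> x n (\<lambda>i. (i, True)) = comp_functor (ord_cat n) G x"
  by (simp_all add: cylinder_simplex_def comp_functor_ord)

lemma is_functor_cylinder_simplex:
  assumes D: "is_category D" and F: "is_functor C D F" and G: "is_functor C D G"
    and \<alpha>: "nat_trans C D F G \<alpha>" and x: "is_functor (ord_cat n) C x"
    and p: "\<And>i j. i \<le> j \<Longrightarrow> j \<le> N \<Longrightarrow> fst (p i) \<le> fst (p j) \<and> fst (p j) \<le> n \<and> (snd (p i) \<longrightarrow> snd (p j))"
  shows "is_functor (ord_cat N) D (cylinder_simplex D F G \<alpha> x N p)"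
proof -
  have comp: "Cmp D g f \<in> Ar D \<and> Src D (Cmp D g f) = Src D f \<and> Tgt D (Cmp D g f) = Tgt D g"
    if "f \<in> Ar D" "g \<in> Ar D" "Tgt D f = Src D g" for f g
    using D that by (auto simp: is_category_def)
  have assoc: "Cmp D h (Cmp D g f) = Cmp D (Cmp D h g) f"
    if "f \<in> Ar D" "g \<in> Ar D" "h \<in> Ar D" "Tgt D f = Src D g" "Tgt D g = Src D h" for f g h
    using D that by (auto simp: is_category_def)
  have a: "a \<in> Ob C \<Longrightarrow> \<alpha> a \<in> Ar D \<and> Src D (\<alpha> a) = fob F a \<and> Tgt D (\<alpha> a) = fob G a" for a
    using \<alpha> by (auto simp: nat_trans_def)
  have nat: "f \<in> Ar C \<Longrightarrow> Cmp D (\<alpha> (Tgt C f)) (far F f) = Cmp D (far G f) (\<alpha> (Src C f))" for f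
    using \<alpha> by (auto simp: nat_trans_def)
  let ?a = "\<lambda>i j. let f = far x (fst (p i), fst (p j)) in
    if snd (p i) then far G f
    else if snd (p j) then Cmp D (\<alpha> (fob x (fst (p j)))) (far F f) else far F f"
  let ?u = "\<lambda>i. fob (if snd (p i) then G else F) (fob x (fst (p i)))"
  have ar: "?a i j \<in> Ar D \<and> Src D (?a i j) = ?u i \<and> Tgt D (?a i j) = ?u j"
    if ij: "i \<le> j" "j \<le> N" for i j
  proof -
    define f where "f = far x (fst (p i), fst (p j))"
    have f: "f \<in> Ar C" "Src C f = fob x (fst (p i))" "Tgt C f = fob x (fst (p j))"
      "fob x (fst (p j)) \<in> Ob C"
      using ord_functorD[OF x] p[OF ij] by (simp_all add: f_def)
    show ?thesis
      unfolding f_def[symmetric] Let_def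
      using p[OF ij] f functorD(2-4)[OF F f(1)] functorD(2-4)[OF G f(1)] a[OF f(4)]
        comp[of "far F f" "\<alpha> (fob x (fst (p j)))"] by auto
  qed
  show ?thesis
    unfolding cylinder_simplex_def
  proof (rule ord_functorI)
    show "?u i \<in> Ob D" if "i \<le> N" for i
      using p[of i i] that ord_functorD(1)[OF x] functorD(1)[OF F] functorD(1)[OF G] by simp
    show "?a i i = Idt D (?u i)" if "i \<le> N" for i
      using p[of i i] that ord_functorD(1,5)[OF x] functorD(5)[OF F] functorD(5)[OF G]
      by (simp add: Let_def)
  next
    fix i j k assume ijk: "i \<le> j" "j \<le> k" "k \<le> N"
    let ?i = "fst (p i)" and ?j = "fst (p j)" and ?k = "fst (p k)"
    define f where "f = far x (?i, ?j)"
    define g where "g = far x (?j, ?k)"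
    have le: "?i \<le> ?j" "?j \<le> ?k" "?k \<le> n" "snd (p i) \<longrightarrow> snd (p j)" "snd (p j) \<longrightarrow> snd (p k)"
      using p ijk by (meson le_trans)+
    have fg: "f \<in> Ar C" "g \<in> Ar C" "Src C f = fob x ?i" "Tgt C f = fob x ?j" "Src C g = fob x ?j"
      "Tgt C g = fob x ?k" "far x (?i, ?k) = Cmp C g f"
      "fob x ?i \<in> Ob C" "fob x ?j \<in> Ob C" "fob x ?k \<in> Ob C"
      using ord_functorD[OF x] le by (simp_all add: f_def g_def)
    have F': "far F (Cmp C g f) = Cmp D (far F g) (far F f)" "far G (Cmp C g f) = Cmp D (far G g) (far G f)"
      using functorD(6)[OF F, of f g] functorD(6)[OF G, of f g] fg by simp_all
    note ar = functorD(2-4)[OF F fg(1)] functorD(2-4)[OF F fg(2)]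
      functorD(2-4)[OF G fg(1)] functorD(2-4)[OF G fg(2)] a[OF fg(8)] a[OF fg(9)] a[OF fg(10)]
    have e1: "Cmp D (\<alpha> (fob x ?k)) (Cmp D (far F g) (far F f)) = Cmp D (Cmp D (\<alpha> (fob x ?k)) (far F g)) (far F f)"
      by (rule assoc) (use ar fg in simp_all)
    have e2: "Cmp D (far G g) (Cmp D (\<alpha> (fob x ?j)) (far F f)) = Cmp D (Cmp D (far G g) (\<alpha> (fob x ?j))) (far F f)"
      by (rule assoc) (use ar fg in simp_all)
    \<comment> \<open>The chain passes from \<open>F\<close> to \<open>G\<close> at most once. A
      passage between \<open>i\<close> and \<open>j\<close> calls for naturality at
      \<open>g\<close>; one between \<open>j\<close> and \<open>k\<close> needs only
      associativity.\<close>
    consider "snd (p i)" "snd (p j)" "snd (p k)" | "\<not> snd (p i)" "snd (p j)" "snd (p k)"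
      | "\<not> snd (p i)" "\<not> snd (p j)" "snd (p k)" | "\<not> snd (p i)" "\<not> snd (p j)" "\<not> snd (p k)"
      using le by blast
    then show "?a i k = Cmp D (?a j k) (?a i j)"
    proof cases
      case 2
      then show ?thesis
        unfolding fg(7) f_def[symmetric] g_def[symmetric] Let_def
        using e1 e2 nat[OF fg(2)] by (simp only: fg F' if_True if_False)
    next
      case 3
      then show ?thesis
        unfolding fg(7) f_def[symmetric] g_def[symmetric] Let_def
        using e1 by (simp only: F' if_True if_False)
    qed (simp_all add: fg(7) f_def[symmetric] g_def[symmetric] Let_def F')
  qed (use ar in blast)+
qed

section \<open>The prism decomposition\<close>

text \<open>A point \<open>t\<close> of the simplex subdivides \<open>[0, 1]\<close> into consecutive intervals of length
  \<open>t k\<close>; \<open>below s t k\<close> is the length of the part of the \<open>k\<close>-th interval that lies below \<open>s\<close>.\<close>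

definition below :: "real \<Rightarrow> (nat \<Rightarrow> real) \<Rightarrow> nat \<Rightarrow> real" where
  "below s t k = min s (\<Sum>j<Suc k. t j) - min s (\<Sum>j<k. t j)"

text \<open>The point of \<open>[n] \<times> [1]\<close> with weights \<open>below s t\<close> on \<open>(k, 0)\<close> and \<open>t - below s t\<close> on
  \<open>(k, 1)\<close> lies on the \<open>i\<close>-th prism simplex \<open>(0, 0) < \<dots> < (i, 0) < (i, 1) < \<dots> < (n, 1)\<close> if \<open>s\<close> lies
  in the \<open>i\<close>-th interval.\<close>

definition prism_vertex :: "nat \<Rightarrow> nat \<Rightarrow> nat \<times> bool" where
  "prism_vertex i k = (if k \<le> i then (k, False) else (k - 1, True))"

definition prism_weight :: "nat \<Rightarrow> real \<Rightarrow> (nat \<Rightarrow> real) \<Rightarrow> nat \<Rightarrow> real" where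
  "prism_weight i s t k = (if k \<le> i then below s t k else t (k - 1) - below s t (k - 1))"

definition in_interval :: "nat \<Rightarrow> real \<Rightarrow> (nat \<Rightarrow> real) \<Rightarrow> bool" where
  "in_interval i s t \<longleftrightarrow> (\<Sum>j<i. t j) \<le> s \<and> s \<le> (\<Sum>j<Suc i. t j)"

lemma sum_below:
  assumes "0 \<le> s"
  shows "(\<Sum>k<n. below s t k) = min s (\<Sum>k<n. t k)"
  unfolding below_def by (subst sum_lessThan_telescope) (use assms in simp)

context
  fixes n :: nat and t :: "nat \<Rightarrow> real"
  assumes t: "t \<in> standard_simplex n"
begin

lemma standard_simplex_nonneg: "0 \<le> t k"
  using t by (simp add: standard_simplex_def)

lemma sum_standard_simplex: "k > n \<Longrightarrow> (\<Sum>j<k. t j) = 1"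
proof -
  assume "k > n"
  then have "(\<Sum>j<k. t j) = (\<Sum>j\<le>n. t j)"
    using t by (intro sum.mono_neutral_right) (auto simp: standard_simplex_def)
  then show ?thesis using t by (simp add: standard_simplex_def)
qed

lemma partial_sums_mono: "i \<le> j \<Longrightarrow> (\<Sum>k<i. t k) \<le> (\<Sum>k<j. t k)"
  by (intro sum_mono2) (auto simp: standard_simplex_nonneg)

lemma below_bounds: "0 \<le> below s t k" "below s t k \<le> t k"
  using standard_simplex_nonneg[of k] by (auto simp: below_def)

lemma in_interval_exists:
  assumes "0 \<le> s" "s \<le> 1"
  obtains i where "i \<le> n" "in_interval i s t"
proof -
  define i where "i = (LEAST i. s \<le> (\<Sum>j<Suc i. t j))"
  have n: "s \<le> (\<Sum>j<Suc n. t j)"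
    using assms sum_standard_simplex[of "Suc n"] by simp
  have "s \<le> (\<Sum>j<Suc i. t j)" "i \<le> n"
    unfolding i_def
    using LeastI[of "\<lambda>i. s \<le> (\<Sum>j<Suc i. t j)", OF n] Least_le[of "\<lambda>i. s \<le> (\<Sum>j<Suc i. t j)", OF n]
    by blast+
  moreover have "(\<Sum>j<i. t j) \<le> s"
  proof (cases i)
    case (Suc l)
    then show ?thesis
      using not_less_Least[of l "\<lambda>i. s \<le> (\<Sum>j<Suc i. t j)"] by (simp add: i_def)
  qed (simp add: assms)
  ultimately show thesis
    using that by (simp add: in_interval_def)
qed

text \<open>A boundary point lies in several intervals, possibly including some of length zero. They
  are consecutive, so independence of the chosen interval need only be checked for
  neighbours.\<close>

lemma in_interval_between:
  "\<lbrakk>in_interval i s t; in_interval j s t; i \<le> k; k \<le> j\<rbrakk> \<Longrightarrow> in_interval k s t"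
  unfolding in_interval_def
  using partial_sums_mono[of "Suc i" "Suc k"] partial_sums_mono[of k j] by linarith

lemma below_in_interval:
  assumes "in_interval i s t"
  shows "k > i \<Longrightarrow> below s t k = 0" "k < i \<Longrightarrow> below s t k = t k"
proof -
  show "below s t k = 0" if "k > i"
  proof -
    have "s \<le> (\<Sum>j<k. t j)" "s \<le> (\<Sum>j<Suc k. t j)"
      using assms partial_sums_mono[of "Suc i" k] partial_sums_mono[of "Suc i" "Suc k"] that
      by (auto simp: in_interval_def)
    then show ?thesis by (simp add: below_def)
  qed
  show "below s t k = t k" if "k < i"
  proof -
    have "(\<Sum>j<k. t j) \<le> s" "(\<Sum>j<Suc k. t j) \<le> s"
      using assms partial_sums_mono[of k i] partial_sums_mono[of "Suc k" i] that
      by (auto simp: in_interval_def)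
    then have "below s t k = (\<Sum>j<Suc k. t j) - (\<Sum>j<k. t j)"
      by (simp only: below_def min.absorb2)
    then show ?thesis by simp
  qed
qed

text \<open>The lower level carries total weight \<open>s\<close> and the upper level
  \<open>1 - s\<close>.\<close>

lemma prism_weight_in_simplex:
  assumes "0 \<le> s" "i \<le> n" "in_interval i s t"
  shows "prism_weight i s t \<in> standard_simplex (Suc n)"
proof (rule standard_simplexI)
  show "0 \<le> prism_weight i s t k" for k
    using below_bounds by (simp add: prism_weight_def)
  show "prism_weight i s t k = 0" if "k > Suc n" for k
  proof -
    have "t (k - 1) = 0"
      using t that by (simp add: standard_simplex_def)
    moreover from this have "below s t (k - 1) = 0"
      using below_bounds[of s "k - 1"] by simp
    ultimately show ?thesis using that assms by (simp add: prism_weight_def)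
  qed
  have "(\<Sum>k\<le>Suc n. prism_weight i s t k) =
      (\<Sum>k<Suc i. prism_weight i s t k) + (\<Sum>k\<in>{Suc i..<Suc (Suc n)}. prism_weight i s t k)"
  proof -
    have "{..Suc n} = {..<Suc i} \<union> {Suc i..<Suc (Suc n)}"
      using assms by auto
    then show ?thesis
      by (simp only:) (rule sum.union_disjoint, auto)
  qed
  also have "(\<Sum>k<Suc i. prism_weight i s t k) = (\<Sum>k<Suc i. below s t k)"
    by (intro sum.cong) (auto simp: prism_weight_def)
  also have "\<dots> = s"
    using assms(3) unfolding sum_below[OF assms(1)] in_interval_def by simp
  also have "(\<Sum>k\<in>{Suc i..<Suc (Suc n)}. prism_weight i s t k) = (\<Sum>k\<in>{i..<Suc n}. t k - below s t k)"
    by (subst sum.shift_bounds_Suc_ivl) (intro sum.cong, auto simp: prism_weight_def)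
  \<comment> \<open>The added terms vanish, because the intervals before the \<open>i\<close>-th lie
    entirely below \<open>s\<close>.\<close>
  also have "\<dots> = (\<Sum>k<Suc n. t k - below s t k)"
    by (rule sum.mono_neutral_left) (use below_in_interval(2)[OF assms(3)] in auto)
  also have "\<dots> = 1 - min s 1"
    unfolding sum_subtractf sum_below[OF assms(1)] by (simp only: sum_standard_simplex[OF lessI])
  also have "min s 1 = s"
    using assms(3) partial_sums_mono[of "Suc i" "Suc n"] \<open>i \<le> n\<close>
    unfolding in_interval_def sum_standard_simplex[OF lessI] by simp
  finally show "(\<Sum>k\<le>Suc n. prism_weight i s t k) = 1" by simp
qed

end

section \<open>Compatibility of the subdivision with monotone maps\<close>

lemma sum_simplex_push:
  "(\<Sum>l\<in>L. simplex_push m \<theta> t l) = (\<Sum>i | i \<le> m \<and> \<theta> i \<in> L. t i)" if "finite L"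
proof -
  have "(\<Sum>l\<in>L. sum t {i \<in> {i. i \<le> m \<and> \<theta> i \<in> L}. \<theta> i = l}) = sum t {i. i \<le> m \<and> \<theta> i \<in> L}"
    by (rule sum.group) (use that in auto)
  moreover have "{i \<in> {i. i \<le> m \<and> \<theta> i \<in> L}. \<theta> i = l} = {i. i \<le> m \<and> \<theta> i = l}" if "l \<in> L" for l
    using that by auto
  ultimately show ?thesis
    by (simp add: simplex_push_def)
qed

lemma initial_segment:
  assumes "\<theta> \<in> mono_maps m n"
  obtains c where "c \<le> Suc m" "{i. i \<le> m \<and> \<theta> i < l} = {..<c}"
proof -
  \<comment> \<open>The disjunct \<open>c > m\<close> guarantees a least element also when every
    index is sent below \<open>l\<close>; then \<open>c\<close> is \<open>Suc m\<close>.\<close>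
  define c where "c = (LEAST c. c > m \<or> \<theta> c \<ge> l)"
  have "Suc m > m \<or> \<theta> (Suc m) \<ge> l" by simp
  from LeastI[where P = "\<lambda>c. c > m \<or> \<theta> c \<ge> l", OF this] Least_le[where P = "\<lambda>c. c > m \<or> \<theta> c \<ge> l", OF this]
  have c: "c > m \<or> \<theta> c \<ge> l" "c \<le> Suc m" by (simp_all add: c_def)
  have "i \<le> m \<and> \<theta> i < l \<longleftrightarrow> i < c" for i
  proof
    assume "i < c"
    then show "i \<le> m \<and> \<theta> i < l"
      using not_less_Least[of i "\<lambda>c. c > m \<or> \<theta> c \<ge> l"] by (auto simp: c_def)
  next
    assume i: "i \<le> m \<and> \<theta> i < l"
    show "i < c"
    proof (rule ccontr)
      assume "\<not> i < c"
      then have "\<theta> c \<le> \<theta> i" "c \<le> m"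
        using i mono_mapsD(2)[OF assms, of c i] by auto
      then show False using c i by linarith
    qed
  qed
  with c(2) show thesis using that[of c] by auto
qed

text \<open>Since monotone maps pull initial segments back to initial segments, subdividing at \<open>s\<close>
  commutes with pushing forward.\<close>

lemma simplex_push_below:
  assumes \<theta>: "\<theta> \<in> mono_maps m n" and s: "0 \<le> s"
  shows "simplex_push m \<theta> (below s t) = below s (simplex_push m \<theta> t)"
proof
  fix l
  have *: "(\<Sum>i | i \<le> m \<and> \<theta> i < l. below s t i) = min s (\<Sum>j<l. simplex_push m \<theta> t j)" for l
  proof -
    obtain c where c: "c \<le> Suc m" "{i. i \<le> m \<and> \<theta> i < l} = {..<c}"
      by (rule initial_segment[OF \<theta>])
    have "(\<Sum>j<l. simplex_push m \<theta> t j) = (\<Sum>j<c. t j)"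
      by (simp add: sum_simplex_push flip: c(2))
    then show ?thesis
      by (simp add: c(2) sum_below[OF s])
  qed
  have "(\<Sum>i | i \<le> m \<and> \<theta> i < Suc l. below s t i) =
      (\<Sum>i | i \<le> m \<and> \<theta> i < l. below s t i) + simplex_push m \<theta> (below s t) l"
    unfolding simplex_push_def by (subst sum.union_disjoint[symmetric]) (auto intro!: sum.cong)
  then show "simplex_push m \<theta> (below s t) l = below s (simplex_push m \<theta> t) l"
    unfolding * below_def[of s "simplex_push m \<theta> t"] by linarith
qed

text \<open>Pushing forward merges the intervals whose indices form a fibre of
  \<open>\<theta>\<close>, so the interval of \<open>\<theta> i\<close> contains that of
  \<open>i\<close>.\<close>

lemma in_interval_simplex_push:
  assumes \<theta>: "\<theta> \<in> mono_maps m n" and t: "t \<in> standard_simplex m" and "i \<le> m" "in_interval i s t"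
  shows "in_interval (\<theta> i) s (simplex_push m \<theta> t)"
proof -
  note nonneg = standard_simplex_nonneg[OF t]
  have "j < i" if "j \<le> m" "\<theta> j < \<theta> i" for j
    using mono_mapsD(2)[OF \<theta>, of i j] that by linarith
  then have "{j. j \<le> m \<and> \<theta> j < \<theta> i} \<subseteq> {..<i}"
    by blast
  then have "(\<Sum>j | j \<le> m \<and> \<theta> j < \<theta> i. t j) \<le> (\<Sum>j<i. t j)"
    by (intro sum_mono2) (simp_all add: nonneg)
  moreover have "\<theta> j < Suc (\<theta> i)" if "j < Suc i" for j
    using mono_mapsD(2)[OF \<theta>, of j i] that \<open>i \<le> m\<close> by simp
  then have "(\<Sum>j<Suc i. t j) \<le> (\<Sum>j | j \<le> m \<and> \<theta> j < Suc (\<theta> i). t j)"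
    using \<open>i \<le> m\<close> by (intro sum_mono2) (auto simp: nonneg)
  ultimately show ?thesis
    using assms(4) unfolding in_interval_def sum_simplex_push[OF finite_lessThan] lessThan_iff
    by linarith
qed

text \<open>The map that \<open>\<theta>\<close> times the identity of \<open>[1]\<close> induces
  from the \<open>i\<close>-th prism simplex over \<open>[m]\<close> to the
  \<open>\<theta> i\<close>-th one over \<open>[n]\<close>. The shift is there because the upper
  vertex \<open>(j, 1)\<close> sits at position \<open>Suc j\<close>.\<close>

definition prism_map :: "nat \<Rightarrow> (nat \<Rightarrow> nat) \<Rightarrow> nat \<Rightarrow> nat" where
  "prism_map i \<theta> k = (if k \<le> i then \<theta> k else Suc (\<theta> (k - 1)))"

lemma prism_map_mono:
  assumes "\<theta> \<in> mono_maps m n" "i \<le> m"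
  shows "prism_map i \<theta> \<in> mono_maps (Suc m) (Suc n)"
proof -
  have "prism_map i \<theta> j \<le> prism_map i \<theta> k" if "j \<le> k" "k \<le> Suc m" for j k
    using that assms mono_mapsD(2)[OF assms(1), of j k] mono_mapsD(2)[OF assms(1), of j "k - 1"]
      mono_mapsD(2)[OF assms(1), of "j - 1" "k - 1"]
    by (auto simp: prism_map_def le_SucI)
  moreover have "prism_map i \<theta> k \<le> Suc n" if "k \<le> Suc m" for k
    using that assms mono_mapsD(1)[OF assms(1), of k] mono_mapsD(1)[OF assms(1), of "k - 1"]
    by (auto simp: prism_map_def)
  ultimately show ?thesis
    by (auto simp: mono_maps_def mono_on_def)
qed

lemma prism_vertex_prism_map:
  assumes "\<theta> \<in> mono_maps m n" "i \<le> m" "k \<le> Suc m"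
  shows "prism_vertex (\<theta> i) (prism_map i \<theta> k) = map_prod \<theta> id (prism_vertex i k)"
proof (cases "k \<le> i")
  case True
  then have "\<theta> k \<le> \<theta> i" using mono_mapsD(2)[OF assms(1)] assms by simp
  with True show ?thesis by (simp add: prism_vertex_def prism_map_def)
next
  case False
  then have "\<theta> i \<le> \<theta> (k - 1)" using mono_mapsD(2)[OF assms(1), of i "k - 1"] assms by simp
  with False show ?thesis by (simp add: prism_vertex_def prism_map_def)
qed

text \<open>On the lower level the push-forward adds \<open>below s t\<close> over the part of a
  fibre of \<open>\<theta>\<close> up to \<open>i\<close>, on the upper level the complementary
  weights over the part from \<open>i\<close> on. The remaining indices of the fibre carry no
  weight, since \<open>s\<close> lies in the \<open>i\<close>-th interval. So both sums extend to
  whole fibres, where \<open>simplex_push_below\<close> applies.\<close>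

lemma simplex_push_prism_map:
  assumes \<theta>: "\<theta> \<in> mono_maps m n" and t: "t \<in> standard_simplex m" and i: "i \<le> m" "in_interval i s t"
    and s: "0 \<le> s"
  shows "simplex_push (Suc m) (prism_map i \<theta>) (prism_weight i s t) =
    prism_weight (\<theta> i) s (simplex_push m \<theta> t)"
proof
  fix l
  show "simplex_push (Suc m) (prism_map i \<theta>) (prism_weight i s t) l =
    prism_weight (\<theta> i) s (simplex_push m \<theta> t) l"
  proof (cases "l \<le> \<theta> i")
    case True
    have gt: "prism_map i \<theta> k > \<theta> i" if "k > i" "k \<le> Suc m" for k
    proof -
      have "\<theta> i \<le> \<theta> (k - 1)"
        using that by (intro mono_mapsD(2)[OF \<theta>]) auto
      with that show ?thesis by (simp add: prism_map_def)
    qed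
    have "{k. k \<le> Suc m \<and> prism_map i \<theta> k = l} = {k. k \<le> i \<and> \<theta> k = l}"
    proof (rule Collect_cong)
      fix k
      show "k \<le> Suc m \<and> prism_map i \<theta> k = l \<longleftrightarrow> k \<le> i \<and> \<theta> k = l"
        using True i(1) gt[of k] by (cases "k \<le> i") (auto simp: prism_map_def)
    qed
    then have "simplex_push (Suc m) (prism_map i \<theta>) (prism_weight i s t) l =
        (\<Sum>k | k \<le> i \<and> \<theta> k = l. below s t k)"
      unfolding simplex_push_def by (auto simp: prism_weight_def intro!: sum.cong)
    also have "\<dots> = (\<Sum>k | k \<le> m \<and> \<theta> k = l. below s t k)"
    proof (rule sum.mono_neutral_left)
      have "k \<le> i" if "below s t k \<noteq> 0" for k
        using below_in_interval(1)[OF t i(2), of k] that by linarith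
      then show "\<forall>k\<in>{k. k \<le> m \<and> \<theta> k = l} - {k. k \<le> i \<and> \<theta> k = l}. below s t k = 0"
        by auto
    qed (use i in auto)
    also have "\<dots> = below s (simplex_push m \<theta> t) l"
      unfolding simplex_push_below[OF \<theta> s, symmetric] by (simp add: simplex_push_def)
    finally show ?thesis
      using True by (simp add: prism_weight_def)
  next
    case False
    have le: "\<theta> k \<le> \<theta> i" if "k \<le> i" for k
      using that mono_mapsD(2)[OF \<theta>, of k i] i by simp
    have "{k. k \<le> Suc m \<and> prism_map i \<theta> k = l} = Suc ` {k. i \<le> k \<and> k \<le> m \<and> \<theta> k = l - 1}"
      (is "?A = ?B")
    proof (rule Set.set_eqI)
      fix k
      show "k \<in> ?A \<longleftrightarrow> k \<in> ?B"
        using False le[of k] by (cases k) (auto simp: prism_map_def)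
    qed
    then have "simplex_push (Suc m) (prism_map i \<theta>) (prism_weight i s t) l =
        (\<Sum>k | i \<le> k \<and> k \<le> m \<and> \<theta> k = l - 1. prism_weight i s t (Suc k))"
      by (simp add: simplex_push_def sum.reindex)
    also have "\<dots> = (\<Sum>k | i \<le> k \<and> k \<le> m \<and> \<theta> k = l - 1. t k - below s t k)"
      by (intro sum.cong) (auto simp: prism_weight_def)
    also have "\<dots> = (\<Sum>k | k \<le> m \<and> \<theta> k = l - 1. t k - below s t k)"
    proof (rule sum.mono_neutral_left)
      have "i \<le> k" if "t k - below s t k \<noteq> 0" for k
        using below_in_interval(2)[OF t i(2), of k] that by linarith
      then show "\<forall>k\<in>{k. k \<le> m \<and> \<theta> k = l - 1} - {k. i \<le> k \<and> k \<le> m \<and> \<theta> k = l - 1}. t k - below s t k = 0"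
        by auto
    qed auto
    also have "\<dots> = simplex_push m \<theta> t (l - 1) - below s (simplex_push m \<theta> t) (l - 1)"
      unfolding simplex_push_below[OF \<theta> s, symmetric] by (simp add: simplex_push_def sum_subtractf)
    finally show ?thesis
      using False by (simp add: prism_weight_def)
  qed
qed

section \<open>The homotopy of a natural transformation\<close>

definition prism_point ::
    "('p, 'n) cat \<Rightarrow> ('o, 'm, 'p, 'n) fctr \<Rightarrow> ('o, 'm, 'p, 'n) fctr \<Rightarrow> ('o \<Rightarrow> 'n) \<Rightarrow>
     nat \<Rightarrow> real \<Rightarrow> nat \<Rightarrow> (nat, nat \<times> nat, 'o, 'm) fctr \<Rightarrow> (nat \<Rightarrow> real) \<Rightarrow>
     ((nat \<times> (nat, nat \<times> nat, 'p, 'n) fctr) \<times> (nat \<Rightarrow> real)) set" where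
  "prism_point D F G \<alpha> i s n x t =
     simplex_point (nerve D) (Suc n) (cylinder_simplex D F G \<alpha> x (Suc n) (prism_vertex i))
       (prism_weight i s t)"

text \<open>Any interval containing \<open>s\<close> may serve: the value is independent of the
  choice by \<open>prism_point_unique\<close>, and for \<open>s\<close> between 0 and 1 one exists
  by \<open>in_interval_exists\<close>.\<close>

definition prism_homotopy ::
    "('p, 'n) cat \<Rightarrow> ('o, 'm, 'p, 'n) fctr \<Rightarrow> ('o, 'm, 'p, 'n) fctr \<Rightarrow> ('o \<Rightarrow> 'n) \<Rightarrow>
     real \<Rightarrow> nat \<Rightarrow> (nat, nat \<times> nat, 'o, 'm) fctr \<Rightarrow> (nat \<Rightarrow> real) \<Rightarrow>
     ((nat \<times> (nat, nat \<times> nat, 'p, 'n) fctr) \<times> (nat \<Rightarrow> real)) set" where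
  "prism_homotopy D F G \<alpha> s n x t =
     prism_point D F G \<alpha> (SOME i. i \<le> n \<and> in_interval i s t) s n x t"

lemma prism_vertex_bounds:
  assumes "i \<le> n" "j \<le> k" "k \<le> Suc n"
  shows "fst (prism_vertex i j) \<le> fst (prism_vertex i k) \<and> fst (prism_vertex i k) \<le> n \<and>
    (snd (prism_vertex i j) \<longrightarrow> snd (prism_vertex i k))"
  using assms by (auto simp: prism_vertex_def)

context
  fixes C :: "('o, 'm) cat" and D :: "('p, 'n) cat" and F G :: "('o, 'm, 'p, 'n) fctr" and \<alpha>
  assumes D: "is_category D" and F: "is_functor C D F" and G: "is_functor C D G"
    and \<alpha>: "nat_trans C D F G \<alpha>"
begin

lemma prism_simplex_in_nerve:
  assumes "is_functor (ord_cat n) C x" "i \<le> n"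
  shows "cylinder_simplex D F G \<alpha> x (Suc n) (prism_vertex i) \<in> simplices (nerve D) (Suc n)"
  unfolding simplices_nerve
  by (rule is_functor_cylinder_simplex[OF D F G \<alpha> assms(1)]) (rule prism_vertex_bounds[OF assms(2)])

text \<open>The \<open>i\<close>-th prism simplex of the simplex obtained from \<open>x\<close>
  along \<open>\<theta>\<close> is itself obtained, along \<open>prism_map i \<theta>\<close>, from
  the \<open>\<theta> i\<close>-th prism simplex of \<open>x\<close>. Hence a generating relation of
  the realization identifies the two points.\<close>

lemma prism_point_act:
  assumes \<theta>: "\<theta> \<in> mono_maps m n" and x: "is_functor (ord_cat n) C x" and t: "t \<in> standard_simplex m"
    and i: "i \<le> m" "in_interval i s t" and s: "0 \<le> s"
  shows "prism_point D F G \<alpha> i s m (act (nerve C) m \<theta> x) t =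
    prism_point D F G \<alpha> (\<theta> i) s n x (simplex_push m \<theta> t)"
proof -
  let ?c = "cylinder_simplex D F G \<alpha> x"
  have "cylinder_simplex D F G \<alpha> (act (nerve C) m \<theta> x) (Suc m) (prism_vertex i) =
      ?c (Suc m) (map_prod \<theta> id \<circ> prism_vertex i)"
    by (rule cylinder_simplex_act[OF \<theta>]) (use prism_vertex_bounds[OF i(1)] in blast)
  also have "\<dots> = ?c (Suc m) (prism_vertex (\<theta> i) \<circ> prism_map i \<theta>)"
    by (rule cylinder_simplex_cong) (simp add: prism_vertex_prism_map[OF \<theta> i(1)])
  also have "\<dots> = act (nerve D) (Suc m) (prism_map i \<theta>) (?c (Suc n) (prism_vertex (\<theta> i)))"
    by (rule act_cylinder_simplex[OF prism_map_mono[OF \<theta> i(1)], symmetric])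
  finally have "cylinder_simplex D F G \<alpha> (act (nerve C) m \<theta> x) (Suc m) (prism_vertex i) = \<dots>" .
  moreover have "simplex_point (nerve D) (Suc m)
      (act (nerve D) (Suc m) (prism_map i \<theta>) (?c (Suc n) (prism_vertex (\<theta> i)))) (prism_weight i s t) =
    simplex_point (nerve D) (Suc n) (?c (Suc n) (prism_vertex (\<theta> i)))
      (simplex_push (Suc m) (prism_map i \<theta>) (prism_weight i s t))"
    by (rule simplex_point_act[OF closed_under_act_nerve prism_map_mono[OF \<theta> i(1)]
          prism_simplex_in_nerve[OF x mono_mapsD(1)[OF \<theta> i(1)]] prism_weight_in_simplex[OF t s i]])
  ultimately show ?thesis
    unfolding prism_point_def simplex_push_prism_map[OF \<theta> t i s] by simp
qed

text \<open>Adjacent prism simplices meet in the common face that omits the vertex \<open>Suc i\<close> of both.\<close>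

lemma prism_point_Suc:
  assumes x: "is_functor (ord_cat n) C x" and t: "t \<in> standard_simplex n" and s: "0 \<le> s"
    and i: "Suc i \<le> n" "in_interval i s t" "in_interval (Suc i) s t"
  shows "prism_point D F G \<alpha> i s n x t = prism_point D F G \<alpha> (Suc i) s n x t"
proof -
  let ?c = "cylinder_simplex D F G \<alpha> x"
  define \<delta> where "\<delta> k = (if k \<le> i then k else Suc k)" for k
  define u where "u k = (if k \<le> i then below s t k else t k - below s t k)" for k
  have \<delta>: "\<delta> \<in> mono_maps n (Suc n)"
    by (auto simp: mono_maps_def mono_on_def \<delta>_def)
  \<comment> \<open>Here \<open>s\<close> is the common endpoint of two adjacent intervals. Both
    prism simplices then give weight zero to their vertex \<open>Suc i\<close>, which is
    \<open>(i, 1)\<close> in the first and \<open>(i + 1, 0)\<close> in the second.\<close>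
  have b: "below s t (Suc i) = 0" "below s t i = t i"
    using below_in_interval[OF t i(2)] below_in_interval[OF t i(3)] by auto
  have push: "simplex_push n \<delta> u k = (if k \<le> i then u k else if k = Suc i then 0 else u (k - 1))"
    if "k \<le> Suc n" for k
  proof -
    have "{j. j \<le> n \<and> \<delta> j = k} = (if k \<le> i then {k} else if k = Suc i then {} else {k - 1})"
      using that i(1) by (auto simp: \<delta>_def)
    then show ?thesis by (simp add: simplex_push_def)
  qed
  have zero: "simplex_push n \<delta> u k = 0" if "k > Suc n" for k
  proof -
    have "{j. j \<le> n \<and> \<delta> j = k} = {}"
      using that by (auto simp: \<delta>_def)
    then show ?thesis by (simp only: simplex_push_def sum.empty)
  qed
  have w: "prism_weight i s t \<in> standard_simplex (Suc n)" "prism_weight (Suc i) s t \<in> standard_simplex (Suc n)"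
    using prism_weight_in_simplex[OF t s] i by simp_all
  have e: "simplex_push n \<delta> u = prism_weight i s t" "simplex_push n \<delta> u = prism_weight (Suc i) s t"
  proof -
    have "simplex_push n \<delta> u k = prism_weight i s t k" for k
      using push[of k] zero[of k] w(1) b
      by (cases "k \<le> Suc n") (auto simp: u_def prism_weight_def standard_simplex_def)
    moreover have "simplex_push n \<delta> u k = prism_weight (Suc i) s t k" for k
      using push[of k] zero[of k] w(2) b
      by (cases "k \<le> Suc n") (auto simp: u_def prism_weight_def standard_simplex_def le_Suc_eq)
    ultimately show "simplex_push n \<delta> u = prism_weight i s t" "simplex_push n \<delta> u = prism_weight (Suc i) s t"
      by auto
  qed
  have u: "u \<in> standard_simplex n"
  proof (rule standard_simplexI)
    show "0 \<le> u k" for k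
      using below_bounds[OF t] by (simp add: u_def)
    show "u k = 0" if "k > n" for k
    proof -
      have "t k = 0" using t that by (simp add: standard_simplex_def)
      with below_bounds[OF t, of s k] show ?thesis by (simp add: u_def)
    qed
    \<comment> \<open>Pushing forward preserves the total weight, and the push-forward of
      \<open>u\<close> is already known to be a point of the simplex.\<close>
    have "(\<Sum>k\<le>Suc n. simplex_push n \<delta> u k) = (\<Sum>k | k \<le> n \<and> \<delta> k \<in> {..Suc n}. u k)"
      by (rule sum_simplex_push) simp
    also have "{k. k \<le> n \<and> \<delta> k \<in> {..Suc n}} = {..n}"
      using mono_mapsD(1)[OF \<delta>] by auto
    finally show "(\<Sum>k\<le>n. u k) = 1"
      unfolding e(1) using w(1) by (simp add: standard_simplex_def)
  qed
  have face: "prism_point D F G \<alpha> j s n x t = simplex_point (nerve D) n (?c n (prism_vertex j \<circ> \<delta>)) u"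
    if "j \<le> n" "simplex_push n \<delta> u = prism_weight j s t" for j
    unfolding prism_point_def that(2)[symmetric] act_cylinder_simplex[OF \<delta>, symmetric]
    by (rule simplex_point_act[OF closed_under_act_nerve \<delta> prism_simplex_in_nerve[OF x that(1)] u, symmetric])
  have "prism_vertex i \<circ> \<delta> = prism_vertex (Suc i) \<circ> \<delta>"
    by (auto simp: fun_eq_iff \<delta>_def prism_vertex_def)
  then show ?thesis
    using face[of i] face[of "Suc i"] e i(1) by simp
qed

lemma prism_point_unique:
  assumes x: "is_functor (ord_cat n) C x" and t: "t \<in> standard_simplex n" and s: "0 \<le> s"
    and "i \<le> n" "in_interval i s t" "j \<le> n" "in_interval j s t"
  shows "prism_point D F G \<alpha> i s n x t = prism_point D F G \<alpha> j s n x t"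
proof -
  have "prism_point D F G \<alpha> i s n x t = prism_point D F G \<alpha> j s n x t"
    if "i \<le> j" "j \<le> n" "in_interval i s t" "in_interval j s t" for i j
    using that
  proof (induction rule: dec_induct)
    case (step k)
    have "in_interval k s t"
      using in_interval_between[OF t step.prems(2,3)] step.hyps by simp
    then show ?case
      using step prism_point_Suc[OF x t s, of k] by simp
  qed simp
  from this[of i j] this[of j i] assms show ?thesis
    by (metis nle_le)
qed

lemma prism_homotopy_eq:
  assumes "is_functor (ord_cat n) C x" "t \<in> standard_simplex n" "0 \<le> s" "i \<le> n" "in_interval i s t"
  shows "prism_homotopy D F G \<alpha> s n x t = prism_point D F G \<alpha> i s n x t"
proof -
  have "(SOME i. i \<le> n \<and> in_interval i s t) \<le> n \<and> in_interval (SOME i. i \<le> n \<and> in_interval i s t) s t"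
    by (rule someI[of _ i]) (use assms in simp)
  then show ?thesis
    unfolding prism_homotopy_def using prism_point_unique assms by blast
qed

lemma prism_homotopy_act:
  assumes \<theta>: "\<theta> \<in> mono_maps m n" and x: "is_functor (ord_cat n) C x" and t: "t \<in> standard_simplex m"
    and s: "0 \<le> s" "s \<le> 1"
  shows "prism_homotopy D F G \<alpha> s m (act (nerve C) m \<theta> x) t =
    prism_homotopy D F G \<alpha> s n x (simplex_push m \<theta> t)"
proof -
  obtain i where i: "i \<le> m" "in_interval i s t"
    by (rule in_interval_exists[OF t s])
  have "is_functor (ord_cat m) C (act (nerve C) m \<theta> x)"
    using closed_under_act_nerve[of C] \<theta> x by (auto simp: closed_under_act_def simplices_nerve)
  then show ?thesis
    using prism_homotopy_eq[OF _ t s(1) i] prism_point_act[OF \<theta> x t i s(1)]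
      prism_homotopy_eq[OF x simplex_push_in[OF \<theta> t] s(1) mono_mapsD(1)[OF \<theta> i(1)]
        in_interval_simplex_push[OF \<theta> t i]] by simp
qed

text \<open>At time 1 all weight lies below \<open>s\<close>, that is, on the level of
  \<open>F\<close>. The last interval contains 1, and \<open>id\<close> is the face map omitting the
  only upper vertex \<open>(n, 1)\<close> of the last prism simplex.\<close>

lemma prism_homotopy_1:
  assumes x: "is_functor (ord_cat n) C x" and t: "t \<in> standard_simplex n"
  shows "prism_homotopy D F G \<alpha> 1 n x t = simplex_point (nerve D) n (comp_functor (ord_cat n) F x) t"
proof -
  have i: "in_interval n 1 t"
    using sum_standard_simplex[OF t lessI] partial_sums_mono[OF t, of n "Suc n"]
    by (simp add: in_interval_def)
  have id: "id \<in> mono_maps n (Suc n)"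
    by (auto simp: mono_maps_def mono_on_def)
  have w: "simplex_push n id t = prism_weight n 1 t"
  proof
    fix k
    have b: "below 1 t l = t l" if "l \<le> n" for l
      using partial_sums_mono[OF t, of l "Suc n"] partial_sums_mono[OF t, of "Suc l" "Suc n"]
        sum_standard_simplex[OF t lessI] that by (simp add: below_def)
    consider "k \<le> n" | "k = Suc n" | "k > Suc n" by linarith
    then show "simplex_push n id t k = prism_weight n 1 t k"
    proof cases
      case 1
      then have "{i. i \<le> n \<and> id i = k} = {k}" by auto
      with 1 b show ?thesis by (simp add: simplex_push_def prism_weight_def)
    next
      case 2
      then have "{i. i \<le> n \<and> id i = k} = {}" by auto
      then have "simplex_push n id t k = 0" by (simp only: simplex_push_def sum.empty)
      with 2 b show ?thesis by (simp add: prism_weight_def)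
    next
      case 3
      then have "{i. i \<le> n \<and> id i = k} = {}" by auto
      then have "simplex_push n id t k = 0" by (simp only: simplex_push_def sum.empty)
      with 3 prism_weight_in_simplex[OF t _ order_refl i] show ?thesis
        by (simp add: standard_simplex_def)
    qed
  qed
  have "cylinder_simplex D F G \<alpha> x n (prism_vertex n \<circ> id) = comp_functor (ord_cat n) F x"
    unfolding cylinder_simplex_ends(1)[symmetric, where D = D and G = G and \<alpha> = \<alpha>]
    by (rule cylinder_simplex_cong) (simp add: prism_vertex_def)
  then show ?thesis
    using simplex_point_act[OF closed_under_act_nerve id prism_simplex_in_nerve[OF x order_refl] t]
    by (simp add: prism_homotopy_eq[OF x t _ order_refl i] prism_point_def w act_cylinder_simplex[OF id])
qed

text \<open>At time 0 all weight lies on the level of \<open>G\<close>, and \<open>Suc\<close> is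
  the face map omitting the only lower vertex \<open>(0, 0)\<close> of the prism simplex of index
  0.\<close>

lemma prism_homotopy_0:
  assumes x: "is_functor (ord_cat n) C x" and t: "t \<in> standard_simplex n"
  shows "prism_homotopy D F G \<alpha> 0 n x t = simplex_point (nerve D) n (comp_functor (ord_cat n) G x) t"
proof -
  have i: "in_interval 0 0 t"
    using standard_simplex_nonneg[OF t] by (simp add: in_interval_def)
  have Suc: "Suc \<in> mono_maps n (Suc n)"
    by (auto simp: mono_maps_def mono_on_def)
  have w: "simplex_push n Suc t = prism_weight 0 0 t"
  proof
    fix k
    have b: "below 0 t l = 0" for l
      using partial_sums_mono[OF t, of 0 l] partial_sums_mono[OF t, of 0 "Suc l"]
      by (simp add: below_def)
    show "simplex_push n Suc t k = prism_weight 0 0 t k"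
    proof (cases "k = 0 \<or> k > Suc n")
      case True
      then have "{i. i \<le> n \<and> Suc i = k} = {}" by auto
      then have "simplex_push n Suc t k = 0" by (simp only: simplex_push_def sum.empty)
      with True b prism_weight_in_simplex[OF t _ _ i] show ?thesis
        by (auto simp: standard_simplex_def prism_weight_def)
    next
      case False
      then have "{i. i \<le> n \<and> Suc i = k} = {k - 1}" by auto
      with False b show ?thesis by (simp add: simplex_push_def prism_weight_def)
    qed
  qed
  have "cylinder_simplex D F G \<alpha> x n (prism_vertex 0 \<circ> Suc) = comp_functor (ord_cat n) G x"
    unfolding cylinder_simplex_ends(2)[symmetric, where D = D and F = F and \<alpha> = \<alpha>]
    by (rule cylinder_simplex_cong) (simp add: prism_vertex_def)
  then show ?thesis
    using simplex_point_act[OF closed_under_act_nerve Suc prism_simplex_in_nerve[OF x le0] t]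
    by (simp add: prism_homotopy_eq[OF x t _ le0 i] prism_point_def w act_cylinder_simplex[OF Suc])
qed

text \<open>The interval selected by \<open>SOME\<close> need not vary continuously. But the sets on
  which \<open>s\<close> lies in the \<open>i\<close>-th interval form a finite closed cover; on
  each of them a single prism simplex with continuous weights is used, and on overlaps the values
  agree.\<close>

lemma continuous_map_prism_homotopy:
  assumes x: "is_functor (ord_cat n) C x"
  shows "continuous_map (prod_topology (top_of_set {0..1}) (simplex_space n)) (classifying_space D)
    (\<lambda>(s, t). prism_homotopy D F G \<alpha> s n x t)"
proof -
  let ?X = "prod_topology (top_of_set {0..1::real}) (simplex_space n)"
  let ?T = "\<lambda>i. {z \<in> topspace ?X. in_interval i (fst z) (snd z)}"
  have s: "continuous_map ?X euclideanreal fst"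
    using continuous_map_fst continuous_map_into_fulltopology by blast
  have "continuous_map ?X (powertop_real UNIV) snd"
    using continuous_map_snd continuous_map_into_fulltopology by blast
  then have t: "continuous_map ?X euclideanreal (\<lambda>z. snd z k)" for k
    unfolding continuous_map_componentwise_UNIV by blast
  have T: "continuous_map ?X euclideanreal (\<lambda>z. \<Sum>j<k. snd z j)" for k
    by (intro continuous_map_sum t) simp
  have closed_le: "closedin ?X {z \<in> topspace ?X. f z \<le> g z}"
    if "continuous_map ?X euclideanreal f" "continuous_map ?X euclideanreal g"
    for f g :: "real \<times> (nat \<Rightarrow> real) \<Rightarrow> real"
    using closedin_continuous_map_preimage[OF continuous_map_diff[OF that], of "{..0}"] by simp
  have below: "continuous_map ?X euclideanreal (\<lambda>z. below (fst z) (snd z) k)" for k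
    unfolding below_def by (intro continuous_map_diff continuous_map_real_min s T)
  have "continuous_map ?X euclideanreal (\<lambda>z. prism_weight i (fst z) (snd z) k)" for i k
    unfolding prism_weight_def by (cases "k \<le> i") (simp_all add: below t continuous_map_diff)
  then have weight: "continuous_map ?X (powertop_real UNIV) (\<lambda>z. prism_weight i (fst z) (snd z))" for i
    by (simp add: continuous_map_componentwise_UNIV)
  show ?thesis
  proof (rule pasting_lemma_closed[of "{..n}" _ ?T])
    fix i assume "i \<in> {..n}"
    have "?T i = {z \<in> topspace ?X. (\<Sum>j<i. snd z j) \<le> fst z} \<inter> {z \<in> topspace ?X. fst z \<le> (\<Sum>j<Suc i. snd z j)}"
      by (auto simp: in_interval_def)
    then show "closedin ?X (?T i)"
      using closed_le[OF T s] closed_le[OF s T] by (simp only:) (rule closedin_Int)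
    have "continuous_map (subtopology ?X (?T i)) (simplex_space (Suc n)) (\<lambda>z. prism_weight i (fst z) (snd z))"
      unfolding continuous_map_in_subtopology
      using \<open>i \<in> {..n}\<close> continuous_map_from_subtopology[OF weight]
      by (auto intro!: prism_weight_in_simplex)
    then show "continuous_map (subtopology ?X (?T i)) (classifying_space D)
        ((\<lambda>i (s, t). prism_point D F G \<alpha> i s n x t) i)"
      unfolding classifying_space_def prism_point_def case_prod_unfold
      using continuous_map_compose[OF _ continuous_map_simplex_point[OF prism_simplex_in_nerve[OF x]]]
        \<open>i \<in> {..n}\<close> by (auto simp: o_def)
  next
    fix i j z assume "i \<in> {..n}" "j \<in> {..n}" "z \<in> topspace ?X \<inter> ?T i \<inter> ?T j"
    then show "(\<lambda>i (s, t). prism_point D F G \<alpha> i s n x t) i z = (\<lambda>i (s, t). prism_point D F G \<alpha> i s n x t) j z"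
      using prism_point_unique[OF x, of "snd z" "fst z" i j] by (auto simp: case_prod_unfold)
  next
    fix z assume "z \<in> topspace ?X"
    then obtain s :: real and t where z: "z = (s, t)" "0 \<le> s" "s \<le> 1" "t \<in> standard_simplex n"
      by auto
    obtain i where "i \<le> n" "in_interval i s t"
      by (rule in_interval_exists[OF z(4,2,3)])
    then show "\<exists>j. j \<in> {..n} \<and> z \<in> ?T j \<and>
        (case z of (s, t) \<Rightarrow> prism_homotopy D F G \<alpha> s n x t) = (\<lambda>i (s, t). prism_point D F G \<alpha> i s n x t) j z"
      using z prism_homotopy_eq[OF x] by auto
  qed simp
qed

proposition homotopic_classifying_maps:
  "homotopic_with (\<lambda>_. True) (classifying_space C) (classifying_space D)
    (classifying_map D F) (classifying_map D G)"
proof -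
  obtain k where k: "continuous_map (prod_topology (top_of_set {0..1}) (classifying_space C)) (classifying_space D) k"
    "\<And>s n x t. \<lbrakk>s \<in> topspace (top_of_set {0..1}); x \<in> simplices (nerve C) n; t \<in> standard_simplex n\<rbrakk> \<Longrightarrow>
      k (s, simplex_point (nerve C) n x t) = prism_homotopy D F G \<alpha> s n x t"
    unfolding classifying_space_def[of C]
  proof (rule realization_parametrized_lift[of "top_of_set {0..1::real}" "nerve C" "classifying_space D" "prism_homotopy D F G \<alpha>"])
    show "locally_compact_space (top_of_set {0..1::real})"
      by (simp add: compact_imp_locally_compact_space compact_space_subtopology)
    show "Hausdorff_space (top_of_set {0..1::real})"
      by (simp add: Hausdorff_space_subtopology)
  qed (auto simp: simplices_nerve continuous_map_prism_homotopy prism_homotopy_act)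
  have k': "k (s, simplex_point (nerve C) n x t) = prism_homotopy D F G \<alpha> s n x t"
    if "s \<in> {0..1}" "is_functor (ord_cat n) C x" "t \<in> standard_simplex n" for s n x t
    using k(2) that by (simp add: simplices_nerve)
  \<comment> \<open>The homotopy \<open>k\<close> runs from \<open>G\<close> to \<open>F\<close>,
    because \<open>s\<close> measures the weight on the level of \<open>F\<close>.\<close>
  have "homotopic_with (\<lambda>_. True) (classifying_space C) (classifying_space D)
      (classifying_map D G) (classifying_map D F)"
    unfolding homotopic_with[where P = "\<lambda>_. True", simplified]
  proof (intro exI[of _ k] conjI ballI k(1))
    fix c assume "c \<in> topspace (classifying_space C)"
    then obtain n x t where c: "is_functor (ord_cat n) C x" "t \<in> standard_simplex n"
      "c = simplex_point (nerve C) n x t"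
      unfolding classifying_space_def simplices_nerve[symmetric] by (rule topspace_realization_cases)
    show "k (0, c) = classifying_map D G c" "k (1, c) = classifying_map D F c"
      using c by (simp_all add: k' prism_homotopy_0 prism_homotopy_1
          classifying_map_simplex_point[OF F] classifying_map_simplex_point[OF G])
  qed
  then show ?thesis
    by (rule homotopic_with_symD)
qed

end

section \<open>Homotopy equivalences of classifying spaces\<close>

definition id_functor :: "('o, 'm) cat \<Rightarrow> ('o, 'm, 'o, 'm) fctr" where
  "id_functor C = \<lparr>fob = restrict id (Ob C), far = restrict id (Ar C)\<rparr>"

lemma id_functor_simps [simp]:
  "a \<in> Ob C \<Longrightarrow> fob (id_functor C) a = a" "f \<in> Ar C \<Longrightarrow> far (id_functor C) f = f"
  by (simp_all add: id_functor_def)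

lemma comp_functor_simps [simp]:
  "a \<in> Ob C \<Longrightarrow> fob (comp_functor C G F) a = fob G (fob F a)"
  "f \<in> Ar C \<Longrightarrow> far (comp_functor C G F) f = far G (far F f)"
  by (simp_all add: comp_functor_def compose_def)

lemma functor_eqI:
  assumes F: "is_functor C D F" and G: "is_functor C D G"
    and "\<And>a. a \<in> Ob C \<Longrightarrow> fob F a = fob G a" "\<And>f. f \<in> Ar C \<Longrightarrow> far F f = far G f"
  shows "F = G"
proof -
  have "fob F = fob G"
    by (rule extensionalityI[of _ "Ob C"]) (use assms in \<open>auto simp: is_functor_def PiE_def\<close>)
  moreover have "far F = far G"
    by (rule extensionalityI[of _ "Ar C"]) (use assms in \<open>auto simp: is_functor_def PiE_def\<close>)
  ultimately show ?thesis by simp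
qed

lemma is_functor_id_functor:
  assumes "is_category C"
  shows "is_functor C C (id_functor C)"
  using assms by (auto simp: is_functor_def is_category_def id_functor_def)

lemma is_functor_comp_functor:
  assumes C: "is_category C" and F: "is_functor C D F" and G: "is_functor D E G"
  shows "is_functor C E (comp_functor C G F)"
proof -
  have C': "\<And>f. f \<in> Ar C \<Longrightarrow> Src C f \<in> Ob C \<and> Tgt C f \<in> Ob C" "\<And>a. a \<in> Ob C \<Longrightarrow> Idt C a \<in> Ar C"
    "\<And>f g. f \<in> Ar C \<Longrightarrow> g \<in> Ar C \<Longrightarrow> Tgt C f = Src C g \<Longrightarrow> Cmp C g f \<in> Ar C"
    using C by (auto simp: is_category_def)
  have "fob (comp_functor C G F) \<in> Ob C \<rightarrow>\<^sub>E Ob E" "far (comp_functor C G F) \<in> Ar C \<rightarrow>\<^sub>E Ar E"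
    using functorD(1,2)[OF F] functorD(1,2)[OF G]
    by (auto simp: comp_functor_def compose_def)
  then show ?thesis
    unfolding is_functor_def using functorD[OF F] functorD[OF G] C' by simp
qed

lemma nat_trans_refl:
  assumes D: "is_category D" and F: "is_functor C D F"
  shows "nat_trans C D F F (\<lambda>a. Idt D (fob F a))"
proof -
  have "Cmp D (Idt D (fob F (Tgt C f))) (far F f) = Cmp D (far F f) (Idt D (fob F (Src C f)))"
    if "f \<in> Ar C" for f
    using D functorD(2-4)[OF F that] by (auto simp: is_category_def)
  then show ?thesis
    using D functorD(1)[OF F] by (auto simp: nat_trans_def is_category_def)
qed

text \<open>The identity transformation of \<open>F\<close> gives a homotopy from the classifying
  map to itself, and its ends are continuous.\<close>

lemma continuous_map_classifying_map:
  assumes "is_category D" "is_functor C D F"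
  shows "continuous_map (classifying_space C) (classifying_space D) (classifying_map D F)"
  using homotopic_classifying_maps[OF assms(1,2,2) nat_trans_refl[OF assms]]
  by (simp add: homotopic_with_imp_continuous_maps)

lemma topspace_classifying_space_cases:
  assumes "c \<in> topspace (classifying_space C)"
  obtains n x t where "is_functor (ord_cat n) C x" "t \<in> standard_simplex n" "c = simplex_point (nerve C) n x t"
  using assms unfolding classifying_space_def simplices_nerve[symmetric] by (rule topspace_realization_cases)

lemma classifying_map_comp_functor:
  assumes C: "is_category C" and F: "is_functor C D F" and G: "is_functor D E G"
    and c: "c \<in> topspace (classifying_space C)"
  shows "classifying_map E (comp_functor C G F) c = classifying_map E G (classifying_map D F c)"
  using c
proof (rule topspace_classifying_space_cases)
  fix n x t assume x: "is_functor (ord_cat n) C x" and t: "t \<in> standard_simplex n"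
    and c: "c = simplex_point (nerve C) n x t"
  have "comp_functor (ord_cat n) (comp_functor C G F) x =
      comp_functor (ord_cat n) G (comp_functor (ord_cat n) F x)"
    unfolding comp_functor_ord by (auto simp: fun_eq_iff ord_functorD[OF x])
  then show ?thesis
    by (simp add: c classifying_map_simplex_point[OF is_functor_comp_functor[OF C F G] x t]
        classifying_map_simplex_point[OF F x t]
        classifying_map_simplex_point[OF G comp_functor_ord_functor[OF x F] t])
qed

lemma classifying_map_id_functor:
  assumes C: "is_category C" and c: "c \<in> topspace (classifying_space C)"
  shows "classifying_map C (id_functor C) c = c"
  using c
proof (rule topspace_classifying_space_cases)
  fix n x t assume x: "is_functor (ord_cat n) C x" and t: "t \<in> standard_simplex n"
    and c: "c = simplex_point (nerve C) n x t"
  have "is_functor (ord_cat n) C (comp_functor (ord_cat n) (id_functor C) x)"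
    by (rule comp_functor_ord_functor[OF x is_functor_id_functor[OF C]])
  then have "comp_functor (ord_cat n) (id_functor C) x = x"
    by (rule functor_eqI[OF _ x]) (auto simp: ord_functorD[OF x])
  then show ?thesis
    by (simp add: c classifying_map_simplex_point[OF is_functor_id_functor[OF C] x t])
qed

text \<open>The common form of both equivalences of the theorem. One composite is the identity on
  the nose, the other is joined to the identity through \<open>T\<close>. For graphs
  \<open>T\<close> is \<open>disjoint_complete\<close>; for finite sets it is the identity functor
  and \<open>\<beta>\<close> the identity transformation.\<close>

proposition homotopy_equivalence_classifying_map:
  assumes C: "is_category C" and D: "is_category D"
    and V: "is_functor C D V" and K: "is_functor D C K" and T: "is_functor C C T"
    and VK: "comp_functor D V K = id_functor D"
    and \<alpha>: "nat_trans C C (comp_functor C K V) T \<alpha>" and \<beta>: "nat_trans C C (id_functor C) T \<beta>"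
  shows "homotopy_equivalence_map (classifying_space C) (classifying_space D) (classifying_map D V)"
proof -
  let ?BV = "classifying_map D V" and ?BK = "classifying_map C K"
  let ?BC = "classifying_space C"
  have BV: "continuous_map ?BC (classifying_space D) ?BV" and BK: "continuous_map (classifying_space D) ?BC ?BK"
    by (rule continuous_map_classifying_map[OF D V], rule continuous_map_classifying_map[OF C K])
  note [trans] = homotopic_with_trans
  note KV = is_functor_comp_functor[OF C V K]
  have "homotopic_with (\<lambda>_. True) ?BC ?BC (?BK \<circ> ?BV) (classifying_map C (comp_functor C K V))"
    using classifying_map_comp_functor[OF C V K] continuous_map_compose[OF BV BK]
    by (intro homotopic_with_equal) simp_all
  also have "homotopic_with (\<lambda>_. True) ?BC ?BC \<dots> (classifying_map C T)"
    by (rule homotopic_classifying_maps[OF C KV T \<alpha>])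
  also have "homotopic_with (\<lambda>_. True) ?BC ?BC \<dots> (classifying_map C (id_functor C))"
    by (rule homotopic_with_symD[OF homotopic_classifying_maps[OF C is_functor_id_functor[OF C] T \<beta>]])
  also have "homotopic_with (\<lambda>_. True) ?BC ?BC \<dots> id"
    using classifying_map_id_functor[OF C] continuous_map_classifying_map[OF C is_functor_id_functor[OF C]]
    by (intro homotopic_with_equal) simp_all
  finally have "homotopic_with (\<lambda>_. True) ?BC ?BC (?BK \<circ> ?BV) id" .
  moreover have "?BV (?BK c) = c" if "c \<in> topspace (classifying_space D)" for c
    using classifying_map_comp_functor[OF D K V that] classifying_map_id_functor[OF D that] VK by simp
  then have "homotopic_with (\<lambda>_. True) (classifying_space D) (classifying_space D) (?BV \<circ> ?BK) id"
    by (rule homotopic_with_id2)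
  ultimately show ?thesis
    unfolding homotopy_equivalence_map_def using BV BK by blast
qed

section \<open>Labellings and codes\<close>

declare One_nat_def [simp del] \<comment> \<open>otherwise the simplifier turns \<open>r + 1\<close> into \<open>Suc r\<close>\<close>

text \<open>A chosen enumeration for each finite set, starting at 1 to match
  \<open>sym_group\<close>. It serves twice: to name the added half-edges and to compare bijections
  with permutations.\<close>

definition labelling :: "'v set \<Rightarrow> nat \<Rightarrow> 'v" where
  "labelling A = (SOME f. bij_betw f {1..card A} A)"

definition label :: "'v set \<Rightarrow> 'v \<Rightarrow> nat" where
  "label A = inv_into {1..card A} (labelling A)"

lemma bij_betw_labelling:
  assumes "finite A"
  shows "bij_betw (labelling A) {1..card A} A"
  unfolding labelling_def by (rule someI_ex[OF ex_bij_betw_nat_finite_1[OF assms]])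

lemma bij_betw_label: "finite A \<Longrightarrow> bij_betw (label A) A {1..card A}"
  unfolding label_def by (rule bij_betw_inv_into[OF bij_betw_labelling])

lemma labelling_label: "\<lbrakk>finite A; a \<in> A\<rbrakk> \<Longrightarrow> labelling A (label A a) = a"
  unfolding label_def by (rule bij_betw_inv_into_right[OF bij_betw_labelling])

lemma label_labelling: "\<lbrakk>finite A; i \<in> {1..card A}\<rbrakk> \<Longrightarrow> label A (labelling A i) = i"
  unfolding label_def by (rule bij_betw_inv_into_left[OF bij_betw_labelling])

lemma labelling_in: "\<lbrakk>finite A; i \<in> {1..card A}\<rbrakk> \<Longrightarrow> labelling A i \<in> A"
  using bij_betwE[OF bij_betw_labelling] by blast

lemma label_in: "\<lbrakk>finite A; a \<in> A\<rbrakk> \<Longrightarrow> label A a \<in> {1..card A}"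
  using bij_betwE[OF bij_betw_label] by blast

text \<open>The bijection \<open>f\<close> read in the labellings of its source and target. The
  identity value outside the labels is what \<open>permutes\<close> asks for, and it makes
  \<open>relabel_id\<close> and \<open>relabel_comp\<close> equations between functions on all of
  \<open>nat\<close>.\<close>

definition relabel :: "'v set \<Rightarrow> ('v \<Rightarrow> 'v) \<Rightarrow> 'v set \<Rightarrow> nat \<Rightarrow> nat" where
  "relabel A f B i = (if i \<in> {1..card A} then label B (f (labelling A i)) else i)"

lemma relabel_permutes:
  assumes "finite A" "bij_betw f A B"
  shows "relabel A f B permutes {1..card A}"
proof (rule bij_imp_permutes)
  have B: "finite B" "card B = card A"
    using assms bij_betw_finite bij_betw_same_card by (blast, metis)
  have "bij_betw (label B \<circ> f \<circ> labelling A) {1..card A} {1..card A}"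
    using bij_betw_trans[OF bij_betw_labelling[OF assms(1)] bij_betw_trans[OF assms(2) bij_betw_label[OF B(1)]]]
    by (simp add: B(2) comp_assoc)
  then show "bij_betw (relabel A f B) {1..card A} {1..card A}"
    by (rule bij_betw_cong[THEN iffD1, rotated]) (simp add: relabel_def)
qed (auto simp: relabel_def)

lemma relabel_in:
  assumes "finite A" "bij_betw f A B"
  shows "relabel A f B i \<in> {1..card A} \<longleftrightarrow> i \<in> {1..card A}"
  by (rule permutes_in_image[OF relabel_permutes[OF assms]])

lemma relabel_inject:
  assumes "finite A" "bij_betw f A B"
  shows "relabel A f B i = relabel A f B j \<longleftrightarrow> i = j"
  using permutes_inj[OF relabel_permutes[OF assms]] by (simp add: inj_eq)

lemma labelling_relabel:
  assumes "finite A" "bij_betw f A B" "i \<in> {1..card A}"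
  shows "labelling B (relabel A f B i) = f (labelling A i)"
  using assms bij_betw_finite[OF assms(2)] bij_betwE[OF assms(2)]
  by (simp add: relabel_def labelling_label labelling_in)

lemma relabel_cong:
  assumes "finite A" "\<And>a. a \<in> A \<Longrightarrow> f a = g a"
  shows "relabel A f B = relabel A g B"
  using assms by (auto simp: relabel_def fun_eq_iff labelling_in)

lemma relabel_id: "finite A \<Longrightarrow> relabel A id A = id"
  by (auto simp: relabel_def fun_eq_iff label_labelling)

lemma relabel_comp:
  assumes "finite A" "bij_betw f A B"
  shows "relabel A (g \<circ> f) C = relabel B g C \<circ> relabel A f B"
proof
  fix i
  have "card B = card A"
    using bij_betw_same_card[OF assms(2)] by simp
  then show "relabel A (g \<circ> f) C i = (relabel B g C \<circ> relabel A f B) i"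
    using relabel_in[OF assms, of i] labelling_relabel[OF assms, of i]
    by (auto simp: relabel_def[of A "g \<circ> f"] relabel_def[of B g] relabel_def[of A f])
qed

section \<open>Room for new cells in an infinite type\<close>

definition code :: "'a + nat \<times> nat \<Rightarrow> 'a::infinite" where
  "code = (SOME f. inj f)"

definition decode :: "'a::infinite \<Rightarrow> 'a + nat \<times> nat" where
  "decode = inv_into UNIV code"

text \<open>An infinite cardinal absorbs a countable summand. The constant is polymorphic and is
  used for edges and for half-edges alike.\<close>

lemma inj_code: "inj (code :: 'a + nat \<times> nat \<Rightarrow> 'a::infinite)"
proof -
  have "|UNIV :: (nat \<times> nat) set| \<le>o |UNIV :: nat set|"
    by (rule card_of_ordLeqI[of to_nat]) auto
  also have "|UNIV :: nat set| \<le>o |UNIV :: 'a set|"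
    using infinite_UNIV[where ?'a = 'a] by (simp add: infinite_iff_card_of_nat)
  finally have "|UNIV :: (nat \<times> nat) set| \<le>o |UNIV :: 'a set|" .
  then have "|UNIV <+> UNIV :: ('a + nat \<times> nat) set| =o |UNIV :: 'a set|"
    using card_of_Plus_infinite1[OF infinite_UNIV] by blast
  then have "|UNIV :: ('a + nat \<times> nat) set| \<le>o |UNIV :: 'a set|"
    by (simp add: ordIso_imp_ordLeq)
  then have "\<exists>f :: 'a + nat \<times> nat \<Rightarrow> 'a. inj f"
    by (simp flip: card_of_ordLeq)
  then show ?thesis
    unfolding code_def by (rule someI_ex)
qed

lemma code_inject [simp]: "code x = code y \<longleftrightarrow> x = y"
  using inj_code by (auto dest: injD)

lemma decode_code [simp]: "decode (code x) = x"
  unfolding decode_def by (rule inv_into_f_f[OF inj_code UNIV_I])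

text \<open>A third half-edge on the same edge would make a fibre of \<open>cover\<close> larger
  than two. The fibre is finite because its cardinality is nonzero.\<close>

lemma other_half_eqI:
  assumes G: "is_graph G" and h: "h \<in> halfs G" "h' \<in> halfs G" "cover G h' = cover G h" "h' \<noteq> h"
  shows "other_half G h = h'"
proof (rule ccontr)
  let ?S = "{x \<in> halfs G. cover G x = cover G h}"
  assume ne: "other_half G h \<noteq> h'"
  have "cover G h \<in> edges G"
    using G h by (auto simp: is_graph_def)
  then have 2: "card ?S = 2"
    using G by (simp add: is_graph_def)
  have "{h, h', other_half G h} \<subseteq> ?S"
    using h other_half_in[OF G h(1)] by auto
  then have "card {h, h', other_half G h} \<le> card ?S"
    using 2 by (intro card_mono) (auto intro: card_ge_0_finite)
  moreover have "card {h, h', other_half G h} = 3"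
    using ne h other_half_in(3)[OF G h(1)] by simp
  ultimately show False using 2 by simp
qed

section \<open>Adding a complete graph\<close>

definition map_cells :: "('v, 'e, 'h) graph \<Rightarrow> ('v \<Rightarrow> 'v) \<Rightarrow> ('h \<Rightarrow> 'h) \<Rightarrow> 'v + 'h \<Rightarrow> 'v + 'h" where
  "map_cells G \<phi> \<psi> = restrict (map_sum \<phi> \<psi>) (cells G)"

definition vert_map :: "('v + 'h \<Rightarrow> 'v + 'h) \<Rightarrow> 'v \<Rightarrow> 'v" where
  "vert_map f v = projl (f (Inl v))"

definition half_map :: "('v + 'h \<Rightarrow> 'v + 'h) \<Rightarrow> 'h \<Rightarrow> 'h" where
  "half_map f h = projr (f (Inr h))"

text \<open>A graph monomorphism in components: bijective on vertices, as its image is spanning, but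
  only injective on half-edges. \<open>graph_mono_map_cells\<close> and \<open>graph_monoD\<close>
  translate in the two directions.\<close>

definition mono_pair ::
    "('v, 'e, 'h) graph \<Rightarrow> ('v, 'e, 'h) graph \<Rightarrow> ('v \<Rightarrow> 'v) \<Rightarrow> ('h \<Rightarrow> 'h) \<Rightarrow> bool" where
  "mono_pair G G' \<phi> \<psi> \<longleftrightarrow>
     bij_betw \<phi> (verts G) (verts G') \<and> inj_on \<psi> (halfs G) \<and>
     (\<forall>h\<in>halfs G. \<psi> h \<in> halfs G' \<and> \<psi> (other_half G h) = other_half G' (\<psi> h) \<and>
        \<phi> (inc G h) = inc G' (\<psi> h))"

lemma Inl_in_cells [simp]: "Inl v \<in> cells G \<longleftrightarrow> v \<in> verts G"
  and Inr_in_cells [simp]: "Inr h \<in> cells G \<longleftrightarrow> h \<in> halfs G"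
  by (auto simp: cells_def)

lemma map_cells_simps [simp]:
  "v \<in> verts G \<Longrightarrow> map_cells G \<phi> \<psi> (Inl v) = Inl (\<phi> v)"
  "h \<in> halfs G \<Longrightarrow> map_cells G \<phi> \<psi> (Inr h) = Inr (\<psi> h)"
  by (simp_all add: map_cells_def)

lemma map_cells_cong:
  assumes "\<And>v. v \<in> verts G \<Longrightarrow> \<phi> v = \<phi>' v" "\<And>h. h \<in> halfs G \<Longrightarrow> \<psi> h = \<psi>' h"
  shows "map_cells G \<phi> \<psi> = map_cells G \<phi>' \<psi>'"
  unfolding map_cells_def by (rule restrict_ext) (use assms in \<open>auto simp: cells_def\<close>)

lemma map_cells_id: "map_cells G id id = restrict id (cells G)"
  by (simp add: map_cells_def sum.map_id0)

lemma compose_map_cells: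
  assumes "mono_pair G G' \<phi> \<psi>"
  shows "compose (cells G) (map_cells G' \<phi>' \<psi>') (map_cells G \<phi> \<psi>) = map_cells G (\<phi>' \<circ> \<phi>) (\<psi>' \<circ> \<psi>)"
proof
  fix c
  have "\<phi> v \<in> verts G'" if "v \<in> verts G" for v
    using assms that by (auto simp: mono_pair_def dest: bij_betwE)
  moreover have "\<psi> h \<in> halfs G'" if "h \<in> halfs G" for h
    using assms that by (auto simp: mono_pair_def)
  ultimately show "compose (cells G) (map_cells G' \<phi>' \<psi>') (map_cells G \<phi> \<psi>) c =
      map_cells G (\<phi>' \<circ> \<phi>) (\<psi>' \<circ> \<psi>) c"
    by (cases c) (auto simp: compose_def map_cells_def)
qed

lemma graph_mono_map_cells:
  assumes G: "is_graph G" and m: "mono_pair G G' \<phi> \<psi>"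
  shows "graph_mono G G' (map_cells G \<phi> \<psi>)"
proof -
  have \<phi>: "\<phi> ` verts G = verts G'" "inj_on \<phi> (verts G)"
    using m by (auto simp: mono_pair_def bij_betw_def)
  have \<psi>: "inj_on \<psi> (halfs G)"
    and h: "\<And>h. h \<in> halfs G \<Longrightarrow> \<psi> h \<in> halfs G' \<and> \<psi> (other_half G h) = other_half G' (\<psi> h) \<and>
      \<phi> (inc G h) = inc G' (\<psi> h)"
    using m by (auto simp: mono_pair_def)
  have inc: "inc G h \<in> verts G" if "h \<in> halfs G" for h
    using G that by (auto simp: is_graph_def)
  have "map_cells G \<phi> \<psi> c \<in> cells G' \<and> map_cells G \<phi> \<psi> (tau G c) = tau G' (map_cells G \<phi> \<psi> c) \<and>
      map_cells G \<phi> \<psi> (bd G c) = bd G' (map_cells G \<phi> \<psi> c)" if "c \<in> cells G" for c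
  proof (cases c)
    case (Inl v)
    with that have "v \<in> verts G" "\<phi> v \<in> verts G'"
      using \<phi>(1) by auto
    then show ?thesis by (simp add: Inl)
  next
    case (Inr x)
    with that have "x \<in> halfs G" by simp
    with h[OF this] inc[OF this] other_half_in(1)[OF G this] show ?thesis by (simp add: Inr)
  qed
  moreover have "map_cells G \<phi> \<psi> \<in> extensional (cells G)"
    by (simp add: map_cells_def)
  moreover have "inj_on (map_cells G \<phi> \<psi>) (cells G)"
  proof (rule inj_onI)
    fix c d assume "c \<in> cells G" "d \<in> cells G" "map_cells G \<phi> \<psi> c = map_cells G \<phi> \<psi> d"
    then show "c = d"
      by (cases c; cases d) (simp_all add: inj_on_eq_iff[OF \<phi>(2)] inj_on_eq_iff[OF \<psi>])
  qed
  moreover have "map_cells G \<phi> \<psi> ` Inl ` verts G = Inl ` verts G'"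
    unfolding \<phi>(1)[symmetric] image_image by (rule image_cong) simp_all
  moreover have "map_cells G \<phi> \<psi> ` Inr ` halfs G \<subseteq> Inr ` halfs G'"
    using h by auto
  ultimately show ?thesis
    unfolding graph_mono_def graph_morphism_def PiE_def Pi_def by blast
qed

lemma graph_monoD:
  assumes G: "is_graph G" and f: "graph_mono G G' f"
  shows "f = map_cells G (vert_map f) (half_map f)" "mono_pair G G' (vert_map f) (half_map f)"
proof -
  have ext: "f \<in> extensional (cells G)" and inj: "inj_on f (cells G)"
    and V: "f ` Inl ` verts G = Inl ` verts G'" and H: "f ` Inr ` halfs G \<subseteq> Inr ` halfs G'"
    and comm: "\<And>c. c \<in> cells G \<Longrightarrow> f (tau G c) = tau G' (f c) \<and> f (bd G c) = bd G' (f c)"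
    using f by (simp_all only: graph_mono_def graph_morphism_def PiE_def Int_iff Ball_def)
  have v: "f (Inl v) = Inl (vert_map f v)" if "v \<in> verts G" for v
  proof -
    have "f (Inl v) \<in> Inl ` verts G'" using V that by blast
    then show ?thesis by (auto simp: vert_map_def)
  qed
  have h: "f (Inr h) = Inr (half_map f h)" "half_map f h \<in> halfs G'" if "h \<in> halfs G" for h
  proof -
    have "f (Inr h) \<in> Inr ` halfs G'" using H that by blast
    then show "f (Inr h) = Inr (half_map f h)" "half_map f h \<in> halfs G'" by (auto simp: half_map_def)
  qed
  show "f = map_cells G (vert_map f) (half_map f)"
  proof (rule extensionalityI[OF ext])
    fix c assume "c \<in> cells G"
    then show "f c = map_cells G (vert_map f) (half_map f) c"
      by (cases c) (simp_all add: v h(1))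
  qed (simp add: map_cells_def)
  have "vert_map f ` verts G = verts G'"
  proof -
    have "Inl ` vert_map f ` verts G = f ` Inl ` verts G"
      unfolding image_image by (rule image_cong) (simp_all add: v)
    then show ?thesis
      unfolding V by (simp add: inj_image_eq_iff)
  qed
  moreover have "inj_on (vert_map f) (verts G)"
  proof (rule inj_onI)
    fix u w assume uw: "u \<in> verts G" "w \<in> verts G" "vert_map f u = vert_map f w"
    then have "f (Inl u) = f (Inl w)"
      using v[OF uw(1)] v[OF uw(2)] by simp
    then show "u = w"
      using inj_onD[OF inj, of "Inl u" "Inl w"] uw by simp
  qed
  moreover have "inj_on (half_map f) (halfs G)"
  proof (rule inj_onI)
    fix x y assume xy: "x \<in> halfs G" "y \<in> halfs G" "half_map f x = half_map f y"
    then have "f (Inr x) = f (Inr y)"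
      using h(1)[OF xy(1)] h(1)[OF xy(2)] by simp
    then show "x = y"
      using inj_onD[OF inj, of "Inr x" "Inr y"] xy by simp
  qed
  moreover have "half_map f (other_half G x) = other_half G' (half_map f x) \<and>
      vert_map f (inc G x) = inc G' (half_map f x)" if "x \<in> halfs G" for x
  proof -
    have "inc G x \<in> verts G" using G that by (auto simp: is_graph_def)
    then show ?thesis
      using comm[of "Inr x"] that other_half_in(1)[OF G that] h(1)[OF that] h(1)[of "other_half G x"]
        v[of "inc G x"] by simp
  qed
  ultimately show "mono_pair G G' (vert_map f) (half_map f)"
    using h(2) unfolding mono_pair_def bij_betw_def by blast
qed

lemma mono_pair_card: "mono_pair G G' \<phi> \<psi> \<Longrightarrow> card (verts G) = card (verts G')"
  by (auto simp: mono_pair_def intro: bij_betw_same_card)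

text \<open>The complete graph on \<open>A\<close> is obtained as
  \<open>thicken (discrete_graph A)\<close>. So one construction serves both functors, and the
  inclusion of the complete graph into \<open>thicken G\<close> is the thickening of the inclusion
  of a discrete graph into \<open>G\<close>.\<close>

definition discrete_graph :: "'v set \<Rightarrow> ('v, 'e, 'h) graph" where
  "discrete_graph A = \<lparr>verts = A, edges = {}, halfs = {}, cover = (\<lambda>_. undefined), inc = (\<lambda>_. undefined)\<rparr>"

lemma discrete_graph_simps [simp]: "verts (discrete_graph A) = A" "halfs (discrete_graph A) = {}"
  by (simp_all add: discrete_graph_def)

lemma is_graph_discrete_graph: "finite A \<Longrightarrow> is_graph (discrete_graph A)"
  by (simp add: is_graph_def discrete_graph_def)

lemma mono_pair_discrete_graph: "bij_betw \<phi> A (verts G) \<Longrightarrow> mono_pair (discrete_graph A) G \<phi> \<psi>"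
  by (simp add: mono_pair_def)

text \<open>The pair \<open>(i, j)\<close> stands for the half-edge at vertex \<open>i\<close> of
  the edge joining \<open>i\<close> and \<open>j\<close>. The edge itself is represented by the pair
  with \<open>i < j\<close>.\<close>

definition off_diagonal :: "nat \<Rightarrow> (nat \<times> nat) set" where
  "off_diagonal n = {(i, j). i \<in> {1..n} \<and> j \<in> {1..n} \<and> i \<noteq> j}"

text \<open>The half-edges of the added complete graph are pairs of labels rather than pairs of vertices,
  since the latter need not embed into the type of half-edges.\<close>

definition thicken :: "('v, 'e::infinite, 'h::infinite) graph \<Rightarrow> ('v, 'e, 'h) graph" where
  "thicken G =
    (let n = card (verts G); H = code ` (halfs G <+> off_diagonal n) in
     \<lparr>verts = verts G,
      edges = code ` (edges G <+> {(i, j) \<in> off_diagonal n. i < j}),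
      halfs = H,
      cover = restrict (\<lambda>h. case decode h of
          Inl h \<Rightarrow> code (Inl (cover G h))
        | Inr (i, j) \<Rightarrow> code (Inr (min i j, max i j))) H,
      inc = restrict (\<lambda>h. case decode h of
          Inl h \<Rightarrow> inc G h
        | Inr (i, j) \<Rightarrow> labelling (verts G) i) H\<rparr>)"

lemma verts_thicken [simp]: "verts (thicken G) = verts G"
  by (simp add: thicken_def Let_def)

lemma halfs_thicken: "halfs (thicken G) = code ` (halfs G <+> off_diagonal (card (verts G)))"
  by (simp add: thicken_def Let_def)

lemma edges_thicken:
  "edges (thicken G) = code ` (edges G <+> {(i, j) \<in> off_diagonal (card (verts G)). i < j})"
  by (simp add: thicken_def Let_def)

lemma code_in_halfs_thicken [simp]:
  "code (Inl h) \<in> halfs (thicken G) \<longleftrightarrow> h \<in> halfs G"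
  "code (Inr p) \<in> halfs (thicken G) \<longleftrightarrow> p \<in> off_diagonal (card (verts G))"
  by (auto simp: halfs_thicken)

lemma cover_thicken [simp]:
  "h \<in> halfs G \<Longrightarrow> cover (thicken G) (code (Inl h)) = code (Inl (cover G h))"
  "(i, j) \<in> off_diagonal (card (verts G)) \<Longrightarrow>
     cover (thicken G) (code (Inr (i, j))) = code (Inr (min i j, max i j))"
  by (auto simp: thicken_def Let_def)

lemma inc_thicken [simp]:
  "h \<in> halfs G \<Longrightarrow> inc (thicken G) (code (Inl h)) = inc G h"
  "(i, j) \<in> off_diagonal (card (verts G)) \<Longrightarrow>
     inc (thicken G) (code (Inr (i, j))) = labelling (verts G) i"
  by (auto simp: thicken_def Let_def)

lemma halfs_thicken_cases:
  assumes "h \<in> halfs (thicken G)"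
  obtains k where "k \<in> halfs G" "h = code (Inl k)"
  | i j where "(i, j) \<in> off_diagonal (card (verts G))" "h = code (Inr (i, j))"
  using assms by (auto simp: halfs_thicken)

lemma off_diagonal_commute: "(j, i) \<in> off_diagonal n \<longleftrightarrow> (i, j) \<in> off_diagonal n"
  by (auto simp: off_diagonal_def)

lemma is_graph_thicken:
  assumes G: "is_graph G"
  shows "is_graph (thicken G)"
proof -
  let ?n = "card (verts G)"
  have fin: "finite (verts G)" "finite (edges G)"
    and GI: "\<And>h. h \<in> halfs G \<Longrightarrow> cover G h \<in> edges G" "\<And>h. h \<in> halfs G \<Longrightarrow> inc G h \<in> verts G"
    and two: "\<And>e. e \<in> edges G \<Longrightarrow> card {h \<in> halfs G. cover G h = e} = 2"
    using G unfolding is_graph_def PiE_def Pi_def by blast+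
  have "finite (off_diagonal ?n)"
    by (rule finite_subset[of _ "{1..?n} \<times> {1..?n}"]) (auto simp: off_diagonal_def)
  then have "finite {(i, j) \<in> off_diagonal ?n. i < j}"
    by (rule rev_finite_subset) blast
  then have edges: "finite (edges (thicken G))"
    using fin(2) by (simp add: edges_thicken)
  have maps: "cover (thicken G) h \<in> edges (thicken G) \<and> inc (thicken G) h \<in> verts (thicken G)"
    if "h \<in> halfs (thicken G)" for h
    using that
  proof (cases rule: halfs_thicken_cases)
    case (1 k)
    then show ?thesis using GI[of k] by (simp add: edges_thicken InlI)
  next
    case (2 i j)
    then have "(min i j, max i j) \<in> {(i, j) \<in> off_diagonal ?n. i < j}"
      by (simp add: off_diagonal_def min_def max_def)
    moreover have "labelling (verts G) i \<in> verts G"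
      using 2 by (intro labelling_in fin(1)) (simp add: off_diagonal_def)
    ultimately show ?thesis using 2 by (simp add: edges_thicken InrI)
  qed
  have fibre: "card {h \<in> halfs (thicken G). cover (thicken G) h = e} = 2" if "e \<in> edges (thicken G)" for e
  proof -
    from that consider e' where "e' \<in> edges G" "e = code (Inl e')"
      | i j where "(i, j) \<in> off_diagonal ?n" "i < j" "e = code (Inr (i, j))"
      unfolding edges_thicken by blast
    then show ?thesis
    proof cases
      case 1
      have "{h \<in> halfs (thicken G). cover (thicken G) h = e} =
          (\<lambda>h. code (Inl h)) ` {h \<in> halfs G. cover G h = e'}" (is "?A = ?B")
      proof
        show "?A \<subseteq> ?B"
        proof
          fix h assume "h \<in> ?A"
          then have h: "h \<in> halfs (thicken G)" "cover (thicken G) h = e" by simp_all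
          from h(1) show "h \<in> ?B"
            by (cases rule: halfs_thicken_cases) (use h(2) 1(2) in simp_all)
        qed
        show "?B \<subseteq> ?A"
          using 1(2) by (simp add: image_subset_iff)
      qed
      moreover have "card ?B = card {h \<in> halfs G. cover G h = e'}"
        by (rule card_image) (simp add: inj_on_def)
      ultimately show ?thesis
        using two[OF 1(1)] by simp
    next
      case 2
      have "{h \<in> halfs (thicken G). cover (thicken G) h = e} = {code (Inr (i, j)), code (Inr (j, i))}"
        (is "?A = ?B")
      proof
        show "?A \<subseteq> ?B"
        proof
          fix h assume "h \<in> ?A"
          then have h: "h \<in> halfs (thicken G)" "cover (thicken G) h = e" by simp_all
          from h(1) show "h \<in> ?B"
            by (cases rule: halfs_thicken_cases)
              (use h(2) 2(2,3) in \<open>simp_all add: min_def max_def split: if_splits\<close>)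
        qed
        show "?B \<subseteq> ?A"
          using 2 by (simp add: off_diagonal_commute[of j i] min_def max_def)
      qed
      then show ?thesis using 2(2) by simp
    qed
  qed
  have "cover (thicken G) \<in> extensional (halfs (thicken G))"
    "inc (thicken G) \<in> extensional (halfs (thicken G))"
    by (simp_all add: thicken_def Let_def)
  with fin(1) edges maps fibre show ?thesis
    unfolding is_graph_def PiE_def Pi_def by simp
qed

lemma other_half_thicken:
  assumes G: "is_graph G"
  shows "h \<in> halfs G \<Longrightarrow> other_half (thicken G) (code (Inl h)) = code (Inl (other_half G h))"
    and "(i, j) \<in> off_diagonal (card (verts G)) \<Longrightarrow>
      other_half (thicken G) (code (Inr (i, j))) = code (Inr (j, i))"
proof -
  show "other_half (thicken G) (code (Inl h)) = code (Inl (other_half G h))" if "h \<in> halfs G"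
    by (rule other_half_eqI[OF is_graph_thicken[OF G]])
      (use that other_half_in[OF G that] in simp_all)
  show "other_half (thicken G) (code (Inr (i, j))) = code (Inr (j, i))"
    if "(i, j) \<in> off_diagonal (card (verts G))"
  proof -
    have "(j, i) \<in> off_diagonal (card (verts G))" "i \<noteq> j"
      using that by (auto simp: off_diagonal_def)
    with that show ?thesis
      by (intro other_half_eqI[OF is_graph_thicken[OF G]]) (simp_all add: min.commute max.commute)
  qed
qed

text \<open>Distinct vertices are adjacent in the added complete graph, so this covers the
  thickening of a discrete graph too.\<close>

lemma connected_graph_thicken:
  assumes G: "is_graph G" and "verts G \<noteq> {}"
  shows "connected_graph (thicken G)"
proof -
  let ?E = "{(inc (thicken G) h, inc (thicken G) (other_half (thicken G) h)) | h. h \<in> halfs (thicken G)}"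
  have fin: "finite (verts G)" using G by (simp add: is_graph_def)
  have "(u, v) \<in> ?E\<^sup>*" if uv: "u \<in> verts G" "v \<in> verts G" for u v
  proof (cases "u = v")
    case False
    let ?i = "label (verts G) u" and ?j = "label (verts G) v"
    have l: "labelling (verts G) ?i = u" "labelling (verts G) ?j = v"
      using labelling_label[OF fin] uv by auto
    then have "(?i, ?j) \<in> off_diagonal (card (verts G))" "(?j, ?i) \<in> off_diagonal (card (verts G))"
      using False label_in[OF fin] uv by (auto simp: off_diagonal_def)
    then have "(u, v) \<in> ?E"
      using l by (auto intro!: exI[of _ "code (Inr (?i, ?j))"] simp: other_half_thicken[OF G])
    then show ?thesis by blast
  qed simp
  then show ?thesis
    using assms(2) by (simp add: connected_graph_def)
qed

definition thicken_half :: "(nat \<Rightarrow> nat) \<Rightarrow> ('h::infinite \<Rightarrow> 'h) \<Rightarrow> 'h \<Rightarrow> 'h" where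
  "thicken_half \<pi> \<psi> h = code (map_sum \<psi> (map_prod \<pi> \<pi>) (decode h))"

definition thicken_map ::
    "('v, 'e, 'h::infinite) graph \<Rightarrow> ('v, 'e, 'h) graph \<Rightarrow> ('v \<Rightarrow> 'v) \<Rightarrow> ('h \<Rightarrow> 'h) \<Rightarrow> 'h \<Rightarrow> 'h" where
  "thicken_map G G' \<phi> \<psi> = thicken_half (relabel (verts G) \<phi> (verts G')) \<psi>"

lemma thicken_map_code [simp]:
  "thicken_map G G' \<phi> \<psi> (code (Inl h)) = code (Inl (\<psi> h))"
  "thicken_map G G' \<phi> \<psi> (code (Inr (i, j))) =
     code (Inr (relabel (verts G) \<phi> (verts G') i, relabel (verts G) \<phi> (verts G') j))"
  by (simp_all add: thicken_map_def thicken_half_def)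

text \<open>Here bijectivity on vertices is essential: the relabelling is then a permutation, so it
  is injective on the new half-edges and preserves \<open>off_diagonal\<close>. Compatibility with
  incidence is \<open>labelling_relabel\<close>.\<close>

lemma mono_pair_thicken:
  assumes G: "is_graph G" and G': "is_graph G'" and m: "mono_pair G G' \<phi> \<psi>"
  shows "mono_pair (thicken G) (thicken G') \<phi> (thicken_map G G' \<phi> \<psi>)"
proof -
  let ?\<pi> = "relabel (verts G) \<phi> (verts G')"
  have fin: "finite (verts G)" using G by (simp add: is_graph_def)
  have bij: "bij_betw \<phi> (verts G) (verts G')" and inj: "inj_on \<psi> (halfs G)"
    and h: "\<And>h. h \<in> halfs G \<Longrightarrow> \<psi> h \<in> halfs G' \<and> \<psi> (other_half G h) = other_half G' (\<psi> h) \<and>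
      \<phi> (inc G h) = inc G' (\<psi> h)"
    using m by (auto simp: mono_pair_def)
  note r = relabel_in[OF fin bij] relabel_inject[OF fin bij] labelling_relabel[OF fin bij]
  have off: "(?\<pi> i, ?\<pi> j) \<in> off_diagonal (card (verts G')) \<longleftrightarrow> (i, j) \<in> off_diagonal (card (verts G))" for i j
    unfolding off_diagonal_def mono_pair_card[OF m, symmetric] mem_Collect_eq prod.case r ..
  have "inj_on (thicken_map G G' \<phi> \<psi>) (halfs (thicken G))"
    using inj by (intro inj_onI) (auto elim!: halfs_thicken_cases simp: r(2) dest: inj_onD)
  moreover have "thicken_map G G' \<phi> \<psi> x \<in> halfs (thicken G') \<and>
      thicken_map G G' \<phi> \<psi> (other_half (thicken G) x) = other_half (thicken G') (thicken_map G G' \<phi> \<psi> x) \<and>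
      \<phi> (inc (thicken G) x) = inc (thicken G') (thicken_map G G' \<phi> \<psi> x)"
    if "x \<in> halfs (thicken G)" for x
    using that
  proof (cases rule: halfs_thicken_cases)
    case (1 k)
    then show ?thesis using h by (simp add: other_half_thicken[OF G] other_half_thicken[OF G'])
  next
    case (2 i j)
    then have "i \<in> {1..card (verts G)}" by (auto simp: off_diagonal_def)
    with 2 show ?thesis
      using r(3)[of i] off[of i j] by (simp add: other_half_thicken[OF G] other_half_thicken[OF G'])
  qed
  ultimately show ?thesis
    using bij by (simp add: mono_pair_def)
qed

text \<open>An equation on the whole type, and not only on half-edges, because
  \<open>relabel_comp\<close> holds for all numbers.\<close>

lemma thicken_map_comp:
  assumes "is_graph G" "mono_pair G G' \<phi> \<psi>"
  shows "thicken_map G' G'' \<phi>' \<psi>' \<circ> thicken_map G G' \<phi> \<psi> = thicken_map G G'' (\<phi>' \<circ> \<phi>) (\<psi>' \<circ> \<psi>)"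
proof -
  have "relabel (verts G) (\<phi>' \<circ> \<phi>) (verts G'') =
      relabel (verts G') \<phi>' (verts G'') \<circ> relabel (verts G) \<phi> (verts G')"
    by (rule relabel_comp) (use assms in \<open>auto simp: is_graph_def mono_pair_def\<close>)
  then show ?thesis
    by (intro ext) (simp add: thicken_map_def thicken_half_def sum.map_comp map_prod.comp)
qed

lemma thicken_map_id: "is_graph G \<Longrightarrow> verts G' = verts G \<Longrightarrow> h \<in> halfs (thicken G) \<Longrightarrow> thicken_map G G' id id h = h"
  by (auto elim!: halfs_thicken_cases simp: relabel_id is_graph_def)

lemma thicken_map_cong:
  assumes "is_graph G" "\<And>v. v \<in> verts G \<Longrightarrow> \<phi> v = \<phi>' v" "\<And>h. h \<in> halfs G \<Longrightarrow> \<psi> h = \<psi>' h"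
    and "verts G' = verts G''" "h \<in> halfs (thicken G)"
  shows "thicken_map G G' \<phi> \<psi> h = thicken_map G G'' \<phi>' \<psi>' h"
proof -
  have "relabel (verts G) \<phi> (verts G') = relabel (verts G) \<phi>' (verts G'')"
    unfolding assms(4) by (rule relabel_cong) (use assms in \<open>auto simp: is_graph_def\<close>)
  with assms show ?thesis
    by (auto elim!: halfs_thicken_cases)
qed

section \<open>The functors T (\<open>disjoint_complete\<close>) and K
  (\<open>complete_graph_functor\<close>), and their natural transformations\<close>

definition disjoint_complete ::
    "nat \<Rightarrow> (('v, 'e::infinite, 'h::infinite) graph, ('v, 'e, 'h) graph_arrow,
      ('v, 'e, 'h) graph, ('v, 'e, 'h) graph_arrow) fctr" where
  "disjoint_complete r =
     \<lparr>fob = restrict thicken (Ob (mono_graph_cat r)),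
      far = restrict (\<lambda>(G, f, G'). (thicken G,
          map_cells (thicken G) (vert_map f) (thicken_map G G' (vert_map f) (half_map f)), thicken G'))
        (Ar (mono_graph_cat r))\<rparr>"

text \<open>The half-edge map \<open>id\<close> is a placeholder, since a discrete graph has no
  half-edges.\<close>

definition complete_graph_functor ::
    "nat \<Rightarrow> ('v set, 'v set \<times> ('v \<Rightarrow> 'v) \<times> 'v set,
      ('v, 'e::infinite, 'h::infinite) graph, ('v, 'e, 'h) graph_arrow) fctr" where
  "complete_graph_functor n =
     \<lparr>fob = restrict (\<lambda>A. thicken (discrete_graph A)) (Ob (bij_cat n)),
      far = restrict (\<lambda>(A, f, B). (thicken (discrete_graph A),
          map_cells (thicken (discrete_graph A :: ('v, 'e, 'h) graph)) f
            (thicken_map (discrete_graph A :: ('v, 'e, 'h) graph) (discrete_graph B) f id),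
          thicken (discrete_graph B))) (Ar (bij_cat n))\<rparr>"

lemma bij_cat_arrowD:
  assumes "(A, f, B) \<in> Ar (bij_cat n)"
  shows "finite A" "card A = n" "finite B" "card B = n" "f \<in> extensional A" "bij_betw f A B"
    "A \<in> Ob (bij_cat n)" "B \<in> Ob (bij_cat n)"
  using assms by (simp_all add: bij_cat_simps)

lemma mono_graph_cat_objectD:
  assumes "G \<in> Ob (mono_graph_cat r)"
  shows "is_graph G" "finite (verts G)" "card (verts G) = r + 1" "verts G \<in> Ob (bij_cat (r + 1))"
  using assms by (simp_all add: mono_graph_cat_simps bij_cat_simps is_graph_def)

lemma thicken_in_mono_graph_cat:
  assumes "is_graph G" "card (verts G) = r + 1"
  shows "thicken G \<in> Ob (mono_graph_cat r)"
proof -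
  have "verts G \<noteq> {}" using assms(2) by auto
  then show ?thesis
    using assms by (simp add: mono_graph_cat_simps is_graph_thicken connected_graph_thicken)
qed

lemma mono_graph_cat_arrowE:
  assumes "a \<in> Ar (mono_graph_cat r)"
  obtains G G' \<phi> \<psi> where "a = (G, map_cells G \<phi> \<psi>, G')" "mono_pair G G' \<phi> \<psi>"
    "G \<in> Ob (mono_graph_cat r)" "G' \<in> Ob (mono_graph_cat r)"
proof -
  obtain G f G' where a: "a = (G, f, G')" by (cases a)
  with assms have "G \<in> Ob (mono_graph_cat r)" "G' \<in> Ob (mono_graph_cat r)" "graph_mono G G' f"
    by (simp_all add: mono_graph_cat_simps(2))
  with graph_monoD[OF mono_graph_cat_objectD(1) this(3)] that show thesis
    unfolding a by metis
qed

lemma map_cells_in_mono_graph_cat: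
  assumes "mono_pair G G' \<phi> \<psi>" "G \<in> Ob (mono_graph_cat r)" "G' \<in> Ob (mono_graph_cat r)"
  shows "(G, map_cells G \<phi> \<psi>, G') \<in> Ar (mono_graph_cat r)"
  unfolding mono_graph_cat_simps(2)
  using assms graph_mono_map_cells[OF mono_graph_cat_objectD(1)] by blast

lemma vert_map_map_cells [simp]: "v \<in> verts G \<Longrightarrow> vert_map (map_cells G \<phi> \<psi>) v = \<phi> v"
  and half_map_map_cells [simp]: "h \<in> halfs G \<Longrightarrow> half_map (map_cells G \<phi> \<psi>) h = \<psi> h"
  by (simp_all add: vert_map_def half_map_def)

lemma Cmp_map_cells:
  assumes "mono_pair G G' \<phi> \<psi>"
  shows "Cmp (mono_graph_cat r) (G', map_cells G' \<phi>' \<psi>', G'') (G, map_cells G \<phi> \<psi>, H) =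
    (G, map_cells G (\<phi>' \<circ> \<phi>) (\<psi>' \<circ> \<psi>), G'')"
  by (simp add: mono_graph_cat_simps compose_map_cells[OF assms])

lemma mono_pair_comp:
  assumes "mono_pair G G' \<phi> \<psi>" "mono_pair G' G'' \<phi>' \<psi>'"
  shows "mono_pair G G'' (\<phi>' \<circ> \<phi>) (\<psi>' \<circ> \<psi>)"
proof -
  have "inj_on \<psi>' (\<psi> ` halfs G)"
    by (rule inj_on_subset[of _ "halfs G'"]) (use assms in \<open>auto simp: mono_pair_def\<close>)
  then show ?thesis
    using assms bij_betw_trans[of \<phi> "verts G" "verts G'" \<phi>' "verts G''"]
    by (simp add: mono_pair_def comp_inj_on)
qed

lemma map_cells_thicken_cong:
  assumes "is_graph G" "\<And>v. v \<in> verts G \<Longrightarrow> \<phi> v = \<phi>' v" "\<And>h. h \<in> halfs G \<Longrightarrow> \<psi> h = \<psi>' h"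
    "verts G' = verts G''"
  shows "map_cells (thicken G) \<phi> (thicken_map G G' \<phi> \<psi>) = map_cells (thicken G) \<phi>' (thicken_map G G'' \<phi>' \<psi>')"
  by (rule map_cells_cong) (use assms thicken_map_cong[OF assms] in simp_all)

text \<open>\<open>vert_map\<close> and \<open>half_map\<close> recover the pair behind an arrow
  only on the cells of its source. Passing to an arbitrary representing pair reduces functoriality
  to composition of plain functions.\<close>

lemma far_disjoint_complete:
  assumes "mono_pair G G' \<phi> \<psi>" "G \<in> Ob (mono_graph_cat r)" "G' \<in> Ob (mono_graph_cat r)"
  shows "far (disjoint_complete r) (G, map_cells G \<phi> \<psi>, G') =
    (thicken G, map_cells (thicken G) \<phi> (thicken_map G G' \<phi> \<psi>), thicken G')"
proof -
  have "map_cells (thicken G) (vert_map (map_cells G \<phi> \<psi>))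
      (thicken_map G G' (vert_map (map_cells G \<phi> \<psi>)) (half_map (map_cells G \<phi> \<psi>))) =
    map_cells (thicken G) \<phi> (thicken_map G G' \<phi> \<psi>)"
    by (rule map_cells_thicken_cong) (simp_all add: mono_graph_cat_objectD[OF assms(2)])
  then show ?thesis
    using map_cells_in_mono_graph_cat[OF assms] by (simp add: disjoint_complete_def)
qed

lemma is_functor_disjoint_complete:
  "is_functor (mono_graph_cat r) (mono_graph_cat r)
     (disjoint_complete r :: (('v, 'e::infinite, 'h::infinite) graph, _, _, _) fctr)"
proof -
  let ?C = "mono_graph_cat r :: (('v, 'e, 'h) graph, _) cat"
  let ?T = "disjoint_complete r :: (('v, 'e, 'h) graph, _, ('v, 'e, 'h) graph, _) fctr"
  have ob: "fob ?T G = thicken G \<and> thicken G \<in> Ob ?C" if "G \<in> Ob ?C" for G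
    using that thicken_in_mono_graph_cat[of G r] mono_graph_cat_objectD[OF that]
    by (simp add: disjoint_complete_def)
  have ar: "far ?T a \<in> Ar ?C \<and> Src ?C (far ?T a) = fob ?T (Src ?C a) \<and> Tgt ?C (far ?T a) = fob ?T (Tgt ?C a)"
    if "a \<in> Ar ?C" for a
    using that
  proof (rule mono_graph_cat_arrowE)
    fix G G' \<phi> \<psi> assume a: "a = (G, map_cells G \<phi> \<psi>, G')" and m: "mono_pair G G' \<phi> \<psi>"
      and G: "G \<in> Ob ?C" and G': "G' \<in> Ob ?C"
    show ?thesis
      unfolding a far_disjoint_complete[OF m G G'] mono_graph_cat_simps(3,4)
      using ob[OF G] ob[OF G'] map_cells_in_mono_graph_cat[OF mono_pair_thicken[OF _ _ m]]
        mono_graph_cat_objectD(1)[OF G] mono_graph_cat_objectD(1)[OF G'] by simp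
  qed
  have idt: "far ?T (Idt ?C G) = Idt ?C (fob ?T G)" if "G \<in> Ob ?C" for G
  proof -
    have "mono_pair G G id id" by (simp add: mono_pair_def)
    moreover have "map_cells (thicken G) id (thicken_map G G id id) = map_cells (thicken G) id id"
      by (rule map_cells_cong) (simp_all add: thicken_map_id mono_graph_cat_objectD[OF that])
    ultimately show ?thesis
      using far_disjoint_complete[of G G id id r] that ob[OF that]
      by (simp add: mono_graph_cat_simps(5) flip: map_cells_id)
  qed
  have cmp: "far ?T (Cmp ?C b a) = Cmp ?C (far ?T b) (far ?T a)"
    if ab: "a \<in> Ar ?C" "b \<in> Ar ?C" "Tgt ?C a = Src ?C b" for a b
    using ab(1)
  proof (rule mono_graph_cat_arrowE)
    fix G G' \<phi> \<psi> assume a: "a = (G, map_cells G \<phi> \<psi>, G')" and m: "mono_pair G G' \<phi> \<psi>"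
      and G: "G \<in> Ob ?C" and G': "G' \<in> Ob ?C"
    show ?thesis
      using ab(2)
    proof (rule mono_graph_cat_arrowE)
      fix H H' \<phi>' \<psi>' assume b: "b = (H, map_cells H \<phi>' \<psi>', H')" and m': "mono_pair H H' \<phi>' \<psi>'"
        and H: "H \<in> Ob ?C" and H': "H' \<in> Ob ?C"
      have [simp]: "H = G'" using ab(3) by (simp add: a b mono_graph_cat_simps(3,4))
      note g = mono_graph_cat_objectD(1)[OF G] mono_graph_cat_objectD(1)[OF G']
      have m': "mono_pair G' H' \<phi>' \<psi>'" using m' by simp
      show ?thesis
        by (simp add: a b Cmp_map_cells[OF m] far_disjoint_complete[OF m G G'] far_disjoint_complete[OF m' G' H']
            far_disjoint_complete[OF mono_pair_comp[OF m m'] G H'] Cmp_map_cells[OF mono_pair_thicken[OF g m]]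
            thicken_map_comp[OF g(1) m])
    qed
  qed
  have "fob ?T \<in> extensional (Ob ?C)" "far ?T \<in> extensional (Ar ?C)"
    by (simp_all add: disjoint_complete_def)
  then show ?thesis
    unfolding is_functor_def PiE_def Pi_def using ob ar idt cmp by simp
qed

lemma far_complete_graph_functor:
  assumes "(A, f, B) \<in> Ar (bij_cat n)"
  shows "far (complete_graph_functor n) (A, f, B) = (thicken (discrete_graph A :: ('v, 'e, 'h) graph),
    map_cells (thicken (discrete_graph A :: ('v, 'e, 'h) graph)) f
      (thicken_map (discrete_graph A :: ('v, 'e::infinite, 'h::infinite) graph) (discrete_graph B) f id),
    thicken (discrete_graph B))"
  using assms by (simp add: complete_graph_functor_def)

lemma is_functor_complete_graph_functor:
  "is_functor (bij_cat (r + 1)) (mono_graph_cat r)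
     (complete_graph_functor (r + 1) :: ('v set, _, ('v, 'e::infinite, 'h::infinite) graph, _) fctr)"
proof -
  let ?D = "bij_cat (r + 1) :: ('v set, _) cat"
  let ?C = "mono_graph_cat r :: (('v, 'e, 'h) graph, _) cat"
  let ?K = "complete_graph_functor (r + 1) :: ('v set, _, ('v, 'e, 'h) graph, _) fctr"
  let ?d = "discrete_graph :: 'v set \<Rightarrow> ('v, 'e, 'h) graph"
  have ob: "fob ?K A = thicken (?d A) \<and> thicken (?d A) \<in> Ob ?C \<and> is_graph (?d A)" if "A \<in> Ob ?D" for A
    using that by (simp add: complete_graph_functor_def bij_cat_simps thicken_in_mono_graph_cat is_graph_discrete_graph)
  have ar: "far ?K a \<in> Ar ?C \<and> Src ?C (far ?K a) = fob ?K (Src ?D a) \<and> Tgt ?C (far ?K a) = fob ?K (Tgt ?D a)"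
    if "a \<in> Ar ?D" for a
  proof -
    obtain A f B where a: "a = (A, f, B)" by (cases a)
    note f = bij_cat_arrowD[OF that[unfolded a]]
    have "mono_pair (?d A) (?d B) f id"
      using f by (simp add: mono_pair_discrete_graph)
    then have "(thicken (?d A), map_cells (thicken (?d A)) f (thicken_map (?d A) (?d B) f id), thicken (?d B)) \<in> Ar ?C"
      using ob[OF f(7)] ob[OF f(8)] by (intro map_cells_in_mono_graph_cat mono_pair_thicken) simp_all
    then show ?thesis
      using ob[OF f(7)] ob[OF f(8)]
      by (simp add: a far_complete_graph_functor[OF that[unfolded a]] mono_graph_cat_simps(3,4) bij_cat_simps(3,4))
  qed
  have idt: "far ?K (Idt ?D A) = Idt ?C (fob ?K A)" if A: "A \<in> Ob ?D" for A
  proof -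
    have arr: "(A, restrict id A, A) \<in> Ar ?D"
      using A by (auto simp: bij_cat_simps bij_betw_def inj_on_def)
    have "map_cells (thicken (?d A)) (restrict id A) (thicken_map (?d A) (?d A) (restrict id A) id) =
        map_cells (thicken (?d A)) id (thicken_map (?d A) (?d A) id id)"
      by (rule map_cells_thicken_cong) (use ob[OF A] in simp_all)
    also have "\<dots> = map_cells (thicken (?d A)) id id"
      by (rule map_cells_cong) (use ob[OF A] in \<open>simp_all add: thicken_map_id\<close>)
    finally show ?thesis
      using ob[OF A] by (simp add: bij_cat_simps(5) mono_graph_cat_simps(5) far_complete_graph_functor[OF arr] map_cells_id)
  qed
  have cmp: "far ?K (Cmp ?D b a) = Cmp ?C (far ?K b) (far ?K a)"
    if ab: "a \<in> Ar ?D" "b \<in> Ar ?D" "Tgt ?D a = Src ?D b" for a b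
  proof -
    obtain A f B where a: "a = (A, f, B)" by (cases a)
    obtain B' g C where b: "b = (B', g, C)" by (cases b)
    have [simp]: "B' = B" using ab(3) by (simp add: a b bij_cat_simps(3,4))
    have f: "(A, f, B) \<in> Ar ?D" and g: "(B, g, C) \<in> Ar ?D" using ab a b by simp_all
    note fD = bij_cat_arrowD[OF f] and gD = bij_cat_arrowD[OF g]
    have gf: "(A, compose A g f, C) \<in> Ar ?D"
      using fD gD by (auto simp: bij_cat_simps intro: bij_betw_compose)
    have m: "mono_pair (?d A) (?d B) f id"
      using fD by (simp add: mono_pair_discrete_graph)
    have gr: "is_graph (?d A)" "is_graph (?d B)" using ob[OF fD(7)] ob[OF fD(8)] by simp_all
    have "map_cells (thicken (?d A)) (compose A g f) (thicken_map (?d A) (?d C) (compose A g f) id) =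
        map_cells (thicken (?d A)) (g \<circ> f) (thicken_map (?d A) (?d C) (g \<circ> f) (id \<circ> id))"
      by (rule map_cells_thicken_cong) (use gr in \<open>simp_all add: compose_eq\<close>)
    then show ?thesis
      by (simp add: a b bij_cat_simps(6) far_complete_graph_functor[OF gf] far_complete_graph_functor[OF f]
          far_complete_graph_functor[OF g] Cmp_map_cells[OF mono_pair_thicken[OF gr m]] thicken_map_comp[OF gr(1) m])
  qed
  have "fob ?K \<in> extensional (Ob ?D)" "far ?K \<in> extensional (Ar ?D)"
    by (simp_all add: complete_graph_functor_def)
  then show ?thesis
    unfolding is_functor_def PiE_def Pi_def using ob ar idt cmp by simp
qed

lemma far_vertex_functor:
  assumes "(G, f, G') \<in> Ar (mono_graph_cat r)"
  shows "far (vertex_functor r) (G, f, G') = (verts G, restrict (vert_map f) (verts G), verts G')"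
  using assms by (simp add: vertex_functor_def vert_map_def[abs_def])

text \<open>Equality rather than mere isomorphism holds because \<open>thicken\<close> keeps the
  vertex set itself and arrows of \<open>bij_cat\<close> are extensional.\<close>

lemma vertex_complete_graph_functor:
  "comp_functor (bij_cat (r + 1)) (vertex_functor r)
     (complete_graph_functor (r + 1) :: ('v set, _, ('v, 'e::infinite, 'h::infinite) graph, _) fctr) =
   id_functor (bij_cat (r + 1))"
proof (rule functor_eqI)
  let ?D = "bij_cat (r + 1) :: ('v set, _) cat"
  let ?K = "complete_graph_functor (r + 1) :: ('v set, _, ('v, 'e, 'h) graph, _) fctr"
  note K = functorD[OF is_functor_complete_graph_functor[of r, where ?'v = 'v and ?'e = 'e and ?'h = 'h]]
  show "is_functor ?D ?D (comp_functor ?D (vertex_functor r) ?K)"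
    by (rule is_functor_comp_functor[OF is_category_bij_cat is_functor_complete_graph_functor is_functor_vertex_functor])
  show "is_functor ?D ?D (id_functor ?D)"
    by (rule is_functor_id_functor[OF is_category_bij_cat])
  show "fob (comp_functor ?D (vertex_functor r) ?K) A = fob (id_functor ?D) A" if "A \<in> Ob ?D" for A
  proof -
    have "fob ?K A = thicken (discrete_graph A)"
      using that by (simp add: complete_graph_functor_def)
    then show ?thesis
      using K(1)[OF that] that by (simp add: vertex_functor_def)
  qed
  show "far (comp_functor ?D (vertex_functor r) ?K) a = far (id_functor ?D) a" if a': "a \<in> Ar ?D" for a
  proof -
    obtain A f B where a: "a = (A, f, B)" by (cases a)
    note f = a'[unfolded a]
    have "restrict (vert_map (map_cells (thicken (discrete_graph A :: ('v, 'e, 'h) graph)) f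
        (thicken_map (discrete_graph A :: ('v, 'e, 'h) graph) (discrete_graph B) f id))) A = restrict f A"
      by (rule restrict_ext) simp
    also have "\<dots> = f"
      by (rule extensional_restrict[OF bij_cat_arrowD(5)[OF f]])
    finally show ?thesis
      using K(2)[OF f] f by (simp add: a far_complete_graph_functor[OF f] far_vertex_functor)
  qed
qed

text \<open>The naturality square is the thickening of a square of maps out of a discrete graph.
  With no half-edges at its source, such a square commutes as soon as it does on vertices.\<close>

lemma nat_trans_complete_graph:
  "nat_trans (mono_graph_cat r) (mono_graph_cat r)
     (comp_functor (mono_graph_cat r) (complete_graph_functor (r + 1)) (vertex_functor r))
     (disjoint_complete r :: (('v, 'e::infinite, 'h::infinite) graph, _, _, _) fctr)
     (\<lambda>G. (thicken (discrete_graph (verts G) :: ('v, 'e, 'h) graph),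
        map_cells (thicken (discrete_graph (verts G) :: ('v, 'e, 'h) graph)) id
          (thicken_map (discrete_graph (verts G) :: ('v, 'e, 'h) graph) G id id), thicken G))"
proof -
  let ?C = "mono_graph_cat r :: (('v, 'e, 'h) graph, _) cat"
  let ?d = "discrete_graph :: 'v set \<Rightarrow> ('v, 'e, 'h) graph"
  let ?K = "complete_graph_functor (r + 1) :: ('v set, _, ('v, 'e, 'h) graph, _) fctr"
  let ?KV = "comp_functor ?C ?K (vertex_functor r)"
  let ?T = "disjoint_complete r :: (('v, 'e, 'h) graph, _, ('v, 'e, 'h) graph, _) fctr"
  let ?\<alpha> = "\<lambda>G. (thicken (?d (verts G)), map_cells (thicken (?d (verts G))) id (thicken_map (?d (verts G)) G id id), thicken G)"
  have m: "mono_pair (?d (verts G)) G id id" for G :: "('v, 'e, 'h) graph"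
    by (simp add: mono_pair_discrete_graph)
  have ob: "is_graph (?d (verts G)) \<and> thicken (?d (verts G)) \<in> Ob ?C \<and> thicken G \<in> Ob ?C \<and>
      fob ?KV G = thicken (?d (verts G)) \<and> fob ?T G = thicken G"
    if "G \<in> Ob ?C" for G
    using that mono_graph_cat_objectD[OF that]
    by (simp add: is_graph_discrete_graph thicken_in_mono_graph_cat complete_graph_functor_def
        vertex_functor_def disjoint_complete_def)
  have "?\<alpha> G \<in> Ar ?C \<and> Src ?C (?\<alpha> G) = fob ?KV G \<and> Tgt ?C (?\<alpha> G) = fob ?T G" if "G \<in> Ob ?C" for G
    using ob[OF that] map_cells_in_mono_graph_cat[OF mono_pair_thicken[OF _ mono_graph_cat_objectD(1)[OF that] m]]
    by (simp add: mono_graph_cat_simps(3,4))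
  moreover have "Cmp ?C (?\<alpha> (Tgt ?C a)) (far ?KV a) = Cmp ?C (far ?T a) (?\<alpha> (Src ?C a))" if a': "a \<in> Ar ?C" for a
    using a'
  proof (rule mono_graph_cat_arrowE)
    fix G G' \<phi> \<psi> assume a: "a = (G, map_cells G \<phi> \<psi>, G')" and mp: "mono_pair G G' \<phi> \<psi>"
      and G: "G \<in> Ob ?C" and G': "G' \<in> Ob ?C"
    let ?d1 = "?d (verts G)" and ?d2 = "?d (verts G')"
    note gr = mono_graph_cat_objectD(1)[OF G] mono_graph_cat_objectD(1)[OF G'] ob[OF G] ob[OF G']
    define \<phi>' where "\<phi>' = restrict (vert_map (map_cells G \<phi> \<psi>)) (verts G)"
    have \<phi>': "\<phi>' v = \<phi> v" if "v \<in> verts G" for v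
      using that by (simp add: \<phi>'_def)
    have V: "far (vertex_functor r) a = (verts G, \<phi>', verts G')"
      using a' unfolding a \<phi>'_def by (rule far_vertex_functor)
    have "(verts G, \<phi>', verts G') \<in> Ar (bij_cat (r + 1))"
      using functorD(2)[OF is_functor_vertex_functor a'] unfolding V .
    then have KV: "far ?KV a = (thicken ?d1, map_cells (thicken ?d1) \<phi>' (thicken_map ?d1 ?d2 \<phi>' id), thicken ?d2)"
      using a' by (simp add: V far_complete_graph_functor)
    have d: "mono_pair ?d1 ?d2 \<phi>' id"
      using \<open>(verts G, \<phi>', verts G') \<in> _\<close> by (simp add: mono_pair_discrete_graph bij_cat_simps)
    have T: "far ?T a = (thicken G, map_cells (thicken G) \<phi> (thicken_map G G' \<phi> \<psi>), thicken G')"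
      unfolding a by (rule far_disjoint_complete[OF mp G G'])
    have g1: "is_graph ?d1" and g2: "is_graph ?d2"
      using gr by blast+
    have "map_cells (thicken ?d1) (id \<circ> \<phi>') (thicken_map ?d1 G' (id \<circ> \<phi>') (id \<circ> id)) =
        map_cells (thicken ?d1) (\<phi> \<circ> id) (thicken_map ?d1 G' (\<phi> \<circ> id) (\<psi> \<circ> id))"
      by (rule map_cells_thicken_cong[OF g1]) (simp_all add: \<phi>')
    then have "Cmp ?C (?\<alpha> G') (far ?KV a) = Cmp ?C (far ?T a) (?\<alpha> G)"
      unfolding KV T Cmp_map_cells[OF mono_pair_thicken[OF g1 g2 d]] thicken_map_comp[OF g1 d]
        Cmp_map_cells[OF mono_pair_thicken[OF g1 gr(1) m]] thicken_map_comp[OF g1 m] by simp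
    then show ?thesis
      by (simp add: a mono_graph_cat_simps(3,4))
  qed
  ultimately show ?thesis
    unfolding nat_trans_def by blast
qed

text \<open>On codes of old half-edges \<open>thicken_map\<close> acts by \<open>\<psi>\<close>, so
  both ways around the square send \<open>h\<close> to \<open>code (Inl (\<psi> h))\<close>.\<close>

lemma nat_trans_thicken:
  "nat_trans (mono_graph_cat r) (mono_graph_cat r) (id_functor (mono_graph_cat r))
     (disjoint_complete r :: (('v, 'e::infinite, 'h::infinite) graph, _, _, _) fctr)
     (\<lambda>G. (G, map_cells G id (\<lambda>h. code (Inl h)), thicken G))"
proof -
  let ?C = "mono_graph_cat r :: (('v, 'e, 'h) graph, _) cat"
  let ?T = "disjoint_complete r :: (('v, 'e, 'h) graph, _, ('v, 'e, 'h) graph, _) fctr"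
  let ?\<beta> = "\<lambda>G :: ('v, 'e, 'h) graph. (G, map_cells G id (\<lambda>h. code (Inl h)), thicken G)"
  have m: "mono_pair G (thicken G) id (\<lambda>h. code (Inl h))" if "is_graph G" for G :: "('v, 'e, 'h) graph"
    using that by (simp add: mono_pair_def inj_on_def other_half_thicken)
  have "?\<beta> G \<in> Ar ?C \<and> Src ?C (?\<beta> G) = fob (id_functor ?C) G \<and> Tgt ?C (?\<beta> G) = fob ?T G" if "G \<in> Ob ?C" for G
    using that mono_graph_cat_objectD[OF that] map_cells_in_mono_graph_cat[OF m that]
    by (simp add: mono_graph_cat_simps(3,4) disjoint_complete_def thicken_in_mono_graph_cat)
  moreover have "Cmp ?C (?\<beta> (Tgt ?C a)) (far (id_functor ?C) a) = Cmp ?C (far ?T a) (?\<beta> (Src ?C a))"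
    if a': "a \<in> Ar ?C" for a
    using a'
  proof (rule mono_graph_cat_arrowE)
    fix G G' \<phi> \<psi> assume a: "a = (G, map_cells G \<phi> \<psi>, G')" and mp: "mono_pair G G' \<phi> \<psi>"
      and G: "G \<in> Ob ?C" and G': "G' \<in> Ob ?C"
    have "Cmp ?C (?\<beta> G') a = Cmp ?C (far ?T a) (?\<beta> G)"
      unfolding a far_disjoint_complete[OF mp G G'] Cmp_map_cells[OF mp]
        Cmp_map_cells[OF m[OF mono_graph_cat_objectD(1)[OF G]]]
      by (simp add: o_def)
    then show ?thesis
      using a' by (simp add: a mono_graph_cat_simps(3,4))
  qed
  ultimately show ?thesis
    unfolding nat_trans_def by blast
qed

section \<open>Finite sets and the symmetric group\<close>

definition permutation_functor ::
    "nat \<Rightarrow> ('v set, 'v set \<times> ('v \<Rightarrow> 'v) \<times> 'v set, unit, nat \<Rightarrow> nat) fctr" where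
  "permutation_functor n =
     \<lparr>fob = restrict (\<lambda>_. ()) (Ob (bij_cat n)),
      far = restrict (\<lambda>(A, f, B). relabel A f B) (Ar (bij_cat n))\<rparr>"

text \<open>The symmetric group as the automorphism group of the single object \<open>A\<close>,
  through the chosen labelling of \<open>A\<close>.\<close>

definition permutation_action ::
    "'v set \<Rightarrow> (unit, nat \<Rightarrow> nat, 'v set, 'v set \<times> ('v \<Rightarrow> 'v) \<times> 'v set) fctr" where
  "permutation_action A =
     \<lparr>fob = (\<lambda>_. A),
      far = restrict (\<lambda>p. (A, \<lambda>a\<in>A. labelling A (p (label A a)), A)) (carrier (sym_group (card A)))\<rparr>"

lemma one_object_cat_simps [simp]:
  "Ob (one_object_cat G) = UNIV" "Ar (one_object_cat G) = carrier G"
  "Src (one_object_cat G) p = ()" "Tgt (one_object_cat G) p = ()" "Idt (one_object_cat G) u = one G"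
  "Cmp (one_object_cat G) = mult G"
  by (auto simp: one_object_cat_def)

lemma is_category_sym_group_cat: "is_category (one_object_cat (sym_group n))"
  by (rule is_category_one_object_cat[OF Group.group.is_monoid[OF sym_group_is_group]])

lemma is_functor_permutation_functor:
  "is_functor (bij_cat n) (one_object_cat (sym_group n)) (permutation_functor n :: ('v set, _, _, _) fctr)"
proof -
  let ?D = "bij_cat n :: ('v set, _) cat"
  let ?R = "permutation_functor n :: ('v set, _, _, _) fctr"
  have ar: "far ?R a \<in> carrier (sym_group n)" if "a \<in> Ar ?D" for a
  proof -
    obtain A f B where a: "a = (A, f, B)" by (cases a)
    show ?thesis
      using that relabel_permutes[of A f B] bij_cat_arrowD[OF that[unfolded a]]
      by (simp add: a permutation_functor_def sym_group_carrier)
  qed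
  have idt: "far ?R (Idt ?D A) = one (sym_group n)" if A: "A \<in> Ob ?D" for A
  proof -
    have "(A, restrict id A, A) \<in> Ar ?D" "finite A"
      using A by (auto simp: bij_cat_simps bij_betw_def inj_on_def)
    moreover have "relabel A (restrict id A) A = relabel A id A"
      by (rule relabel_cong) (use \<open>finite A\<close> in simp_all)
    ultimately show ?thesis
      by (simp add: bij_cat_simps(5) permutation_functor_def sym_group_one relabel_id)
  qed
  have cmp: "far ?R (Cmp ?D b a) = mult (sym_group n) (far ?R b) (far ?R a)"
    if ab: "a \<in> Ar ?D" "b \<in> Ar ?D" "Tgt ?D a = Src ?D b" for a b
  proof -
    obtain A f B where a: "a = (A, f, B)" by (cases a)
    obtain B' g C where b: "b = (B', g, C)" by (cases b)
    have [simp]: "B' = B" using ab(3) by (simp add: a b bij_cat_simps(3,4))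
    have f: "(A, f, B) \<in> Ar ?D" and g: "(B, g, C) \<in> Ar ?D" using ab a b by simp_all
    note fD = bij_cat_arrowD[OF f] and gD = bij_cat_arrowD[OF g]
    have gf: "(A, compose A g f, C) \<in> Ar ?D"
      using fD gD by (auto simp: bij_cat_simps intro: bij_betw_compose)
    have "relabel A (compose A g f) C = relabel A (g \<circ> f) C"
      by (rule relabel_cong) (simp_all add: fD compose_eq)
    then show ?thesis
      using f g gf by (simp add: a b bij_cat_simps(6) permutation_functor_def sym_group_mult relabel_comp[OF fD(1,6)])
  qed
  have "far ?R \<in> extensional (Ar ?D)" "fob ?R \<in> extensional (Ob ?D)"
    by (simp_all add: permutation_functor_def)
  then show ?thesis
    unfolding is_functor_def PiE_def Pi_def using ar idt cmp by simp
qed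

lemma far_permutation_action_in:
  assumes A: "finite A" and p: "p permutes {1..card A}"
  shows "(A, \<lambda>a\<in>A. labelling A (p (label A a)), A) \<in> Ar (bij_cat (card A))"
proof -
  have "bij_betw (labelling A \<circ> p \<circ> label A) A A"
    by (rule bij_betw_trans[OF bij_betw_label[OF A]
          bij_betw_trans[OF permutes_imp_bij[OF p] bij_betw_labelling[OF A]]])
  then have "bij_betw (\<lambda>a\<in>A. labelling A (p (label A a))) A A"
    by (rule bij_betw_cong[THEN iffD1, rotated]) simp
  then show ?thesis
    using A by (simp add: bij_cat_simps)
qed

lemma is_functor_permutation_action:
  assumes A: "finite A"
  shows "is_functor (one_object_cat (sym_group (card A))) (bij_cat (card A)) (permutation_action A)"
proof -
  let ?n = "card A"
  let ?I = "permutation_action A"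
  have "far ?I p \<in> Ar (bij_cat ?n) \<and> Src (bij_cat ?n) (far ?I p) = A \<and> Tgt (bij_cat ?n) (far ?I p) = A"
    if "p \<in> carrier (sym_group ?n)" for p
    using that far_permutation_action_in[OF A, of p]
    by (simp add: permutation_action_def sym_group_carrier bij_cat_simps(3,4))
  moreover have "far ?I (one (sym_group ?n)) = Idt (bij_cat ?n) A"
    by (auto simp: permutation_action_def sym_group_one sym_group_carrier permutes_id bij_cat_simps(5)
        labelling_label[OF A])
  moreover have "far ?I (mult (sym_group ?n) q p) = Cmp (bij_cat ?n) (far ?I q) (far ?I p)"
    if "p \<in> carrier (sym_group ?n)" "q \<in> carrier (sym_group ?n)" for p q
  proof -
    have pq: "p permutes {1..?n}" "q permutes {1..?n}"
      using that by (simp_all add: sym_group_carrier)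
    have "p (label A a) \<in> {1..?n}" if "a \<in> A" for a
      using permutes_in_image[OF pq(1)] label_in[OF A that] by blast
    then have "(\<lambda>a\<in>A. labelling A ((q \<circ> p) (label A a))) =
        compose A (\<lambda>a\<in>A. labelling A (q (label A a))) (\<lambda>a\<in>A. labelling A (p (label A a)))"
      by (auto simp: compose_def fun_eq_iff labelling_in[OF A] label_labelling[OF A])
    then show ?thesis
      using pq by (simp add: permutation_action_def sym_group_carrier sym_group_mult permutes_compose bij_cat_simps(6))
  qed
  moreover have "far ?I \<in> extensional (carrier (sym_group ?n))" "fob ?I u = A" for u
    by (simp_all add: permutation_action_def)
  ultimately show ?thesis
    unfolding is_functor_def PiE_def Pi_def using A by (simp add: bij_cat_simps(1))
qed

text \<open>Both functors use the same labelling of \<open>A\<close>, so reading a permutation as a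
  bijection of \<open>A\<close> and back changes nothing.\<close>

lemma permutation_functor_action:
  assumes A: "finite A"
  shows "comp_functor (one_object_cat (sym_group (card A))) (permutation_functor (card A)) (permutation_action A) =
    id_functor (one_object_cat (sym_group (card A)))"
proof (rule functor_eqI)
  let ?G = "one_object_cat (sym_group (card A))"
  show "is_functor ?G ?G (comp_functor ?G (permutation_functor (card A)) (permutation_action A))"
    by (rule is_functor_comp_functor[OF is_category_sym_group_cat is_functor_permutation_action[OF A]
          is_functor_permutation_functor])
  show "is_functor ?G ?G (id_functor ?G)"
    by (rule is_functor_id_functor[OF is_category_sym_group_cat])
  show "far (comp_functor ?G (permutation_functor (card A)) (permutation_action A)) p = far (id_functor ?G) p"
    if "p \<in> Ar ?G" for p
  proof -
    have p: "p permutes {1..card A}" using that by (simp add: sym_group_carrier)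
    have "relabel A (\<lambda>a\<in>A. labelling A (p (label A a))) A = p"
    proof
      fix i
      show "relabel A (\<lambda>a\<in>A. labelling A (p (label A a))) A i = p i"
      proof (cases "i \<in> {1..card A}")
        case True
        then have "p i \<in> {1..card A}" using permutes_in_image[OF p] by blast
        with True show ?thesis
          by (simp add: relabel_def labelling_in[OF A] label_labelling[OF A])
      next
        case False
        show ?thesis
          unfolding relabel_def if_not_P[OF False] permutes_not_in[OF p False] ..
      qed
    qed
    then show ?thesis
      using that far_permutation_action_in[OF A p]
      by (simp add: permutation_action_def permutation_functor_def)
  qed
qed simp

text \<open>The component at \<open>B\<close> matches the elements of \<open>A\<close> and
  \<open>B\<close> that have the same label. Naturality is then
  \<open>labelling_relabel\<close>.\<close>

lemma nat_trans_permutation_action: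
  assumes A: "finite A"
  shows "nat_trans (bij_cat (card A)) (bij_cat (card A))
    (comp_functor (bij_cat (card A)) (permutation_action A) (permutation_functor (card A)))
    (id_functor (bij_cat (card A))) (\<lambda>B. (A, \<lambda>a\<in>A. labelling B (label A a), B))"
proof -
  let ?D = "bij_cat (card A) :: ('a set, _) cat"
  let ?\<gamma> = "\<lambda>B. (A, \<lambda>a\<in>A. labelling B (label A a), B)"
  let ?IR = "comp_functor ?D (permutation_action A) (permutation_functor (card A))"
  have "?\<gamma> B \<in> Ar ?D \<and> Src ?D (?\<gamma> B) = fob ?IR B \<and> Tgt ?D (?\<gamma> B) = fob (id_functor ?D) B"
    if "B \<in> Ob ?D" for B
  proof -
    have B: "finite B" "card B = card A" using that by (simp_all add: bij_cat_simps)
    have "bij_betw (labelling B \<circ> label A) A B"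
      by (rule bij_betw_trans[OF bij_betw_label[OF A]]) (use bij_betw_labelling[OF B(1)] B(2) in simp)
    then have "bij_betw (\<lambda>a\<in>A. labelling B (label A a)) A B"
      by (rule bij_betw_cong[THEN iffD1, rotated]) simp
    then show ?thesis
      using A B by (simp add: bij_cat_simps permutation_action_def)
  qed
  moreover have "Cmp ?D (?\<gamma> (Tgt ?D a)) (far ?IR a) = Cmp ?D (far (id_functor ?D) a) (?\<gamma> (Src ?D a))"
    if a': "a \<in> Ar ?D" for a
  proof -
    obtain B f C where a: "a = (B, f, C)" by (cases a)
    note f = bij_cat_arrowD[OF a'[unfolded a]]
    let ?p = "relabel B f C"
    have p: "?p permutes {1..card A}"
      using relabel_permutes[OF f(1,6)] f(2) by simp
    have "labelling C (label A (labelling A (?p (label A x)))) = f (labelling B (label A x))" if x: "x \<in> A" for x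
    proof -
      have i: "label A x \<in> {1..card A}" by (rule label_in[OF A x])
      then have "?p (label A x) \<in> {1..card A}" using permutes_in_image[OF p] by blast
      then show ?thesis
        using labelling_relabel[OF f(1,6), of "label A x"] i f(2) by (simp add: label_labelling[OF A])
    qed
    moreover have "labelling A (?p (label A x)) \<in> A" if "x \<in> A" for x
      using label_in[OF A that] permutes_in_image[OF p] by (intro labelling_in[OF A]) blast
    ultimately have "compose A (\<lambda>a\<in>A. labelling C (label A a)) (\<lambda>a\<in>A. labelling A (?p (label A a))) =
        compose A f (\<lambda>a\<in>A. labelling B (label A a))"
      by (simp add: compose_def fun_eq_iff)
    then show ?thesis
      using a' p by (simp add: a bij_cat_simps(3,4,6) permutation_action_def permutation_functor_def sym_group_carrier)
  qed
  ultimately show ?thesis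
    unfolding nat_trans_def by blast
qed

theorem theorem4p5:
  fixes r :: nat
  shows "homotopy_equivalence_map
           (classifying_space (mono_graph_cat r ::
              (('v::infinite, 'e::infinite, 'h::infinite) graph, ('v, 'e, 'h) graph_arrow) cat))
           (classifying_space (bij_cat (r + 1)))
           (classifying_map (bij_cat (r + 1)) (vertex_functor r))
       \<and> classifying_space
             (bij_cat (r + 1) :: ('v set, 'v set \<times> ('v \<Rightarrow> 'v) \<times> 'v set) cat)
           homotopy_equivalent_space
         classifying_space (one_object_cat (sym_group (r + 1)))"
proof
  show "homotopy_equivalence_map
      (classifying_space (mono_graph_cat r :: (('v, 'e, 'h) graph, ('v, 'e, 'h) graph_arrow) cat))
      (classifying_space (bij_cat (r + 1))) (classifying_map (bij_cat (r + 1)) (vertex_functor r))"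
    by (rule homotopy_equivalence_classifying_map[OF is_category_mono_graph_cat is_category_bij_cat
          is_functor_vertex_functor is_functor_complete_graph_functor is_functor_disjoint_complete
          vertex_complete_graph_functor nat_trans_complete_graph nat_trans_thicken])
next
  \<comment> \<open>The base object for the inverse functor exists because \<open>'v\<close> is
    infinite.\<close>
  obtain A :: "'v set" where A: "finite A" "card A = r + 1"
    using infinite_arbitrarily_large[OF infinite_UNIV] by blast
  let ?D = "bij_cat (r + 1) :: ('v set, _) cat"
  have "homotopy_equivalence_map (classifying_space ?D) (classifying_space (one_object_cat (sym_group (r + 1))))
      (classifying_map (one_object_cat (sym_group (r + 1))) (permutation_functor (r + 1)))"
    using homotopy_equivalence_classifying_map[OF is_category_bij_cat is_category_sym_group_cat
        is_functor_permutation_functor is_functor_permutation_action[OF A(1)]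
        is_functor_id_functor[OF is_category_bij_cat] permutation_functor_action[OF A(1)]
        nat_trans_permutation_action[OF A(1)]
        nat_trans_refl[OF is_category_bij_cat is_functor_id_functor[OF is_category_bij_cat]]]
    by (simp add: A(2))
  then show "classifying_space ?D homotopy_equivalent_space classifying_space (one_object_cat (sym_group (r + 1)))"
    unfolding homotopy_equivalent_space_iff_map by blast
qed

end
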